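(* Let $\Gamma$ be a group satisfying the finiteness property $FP_\infty(\mathbb{Q})$ and let $n\ge 1$. Fix a based free resolution $P_\bullet$ with $P_0=\mathbb{C}\Gamma$ and its Laplace operators $\Delta_k\in M_{m_k}(\mathbb{C}\Gamma)$ as described in the context. Then $\Gamma$ has property $(T_n)$ if and only if for every $0\le k\le n$ there exist $\epsilon>0$ and finitely many elements $x_1,\dots,x_j\in M_{m_k}(\mathbb{C}\Gamma)$ such that \[ \Delta_0(\Delta_k-\epsilon)\Delta_0=\sum_{i=1}^j x_i^*x_i, \] where $\Delta_0\in\mathbb{C}\Gamma$ is regarded as the scalar matrix $\Delta_0\cdot I_{m_k}$ in $M_{m_k}(\mathbb{C}\Gamma)$ and $\epsilon$ as $\epsilon\cdot I_{m_k}$.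
   Context: A (discrete, countable) group $\Gamma$ has property $(T_n)$ if $H^j(\Gamma,V)=0$ for every $1\le j\le n$ and every unitary $\Gamma$-representation $V$ (on a complex Hilbert space) with no nontrivial $\Gamma$-invariant vectors. $\Gamma$ is $FP_\infty(\mathbb{Q})$ if the trivial module $\mathbb{Q}$ has a projective $\mathbb{Q}\Gamma$-resolution by finitely generated modules in all degrees. Laplace operators: fix a resolution of the trivial module $\mathbb{Q}$ by finitely generated free left $\mathbb{Q}\Gamma$-modules with chosen bases and let $P_\bullet$ be its tensor product with $\mathbb{C}$, so that $0\leftarrow\mathbb{C}\leftarrow P_0\xleftarrow{d_1}P_1\xleftarrow{d_2}P_2\leftarrow\cdots$ is exact; assume $P_0=\mathbb{C}\Gamma$. Let $m_k$ be the rank of $P_k$, so $P_k\cong(\mathbb{C}\Gamma)^{m_k}$ (row vectors), and $d_k$ is right multiplication by a matrix $D_k$ of size $m_k\times m_{k-1}$ over $\mathbb{C}\Gamma$. The group algebra has the involution $(a\gamma)^*=\bar a\gamma^{-1}$ for $a\in\mathbb{C}$, $\gamma\in\Gamma$, and for matrices $*$ is the transpose followed by the entrywise involution. The formal adjoint $d_k^*:P_{k-1}\to P_k$ is given by $D_k^*$. The Laplace operator is $\Delta_k=d_k^*d_k+d_{k+1}d_{k+1}^*:P_k\to P_k$ (with the convention $d_0=0$, so $\Delta_0=d_1d_1^*$), identified with its representing matrix $\Delta_k=D_kD_k^*+D_{k+1}^*D_{k+1}\in M_{m_k}(\mathbb{C}\Gamma)$; in particular $\Delta_0=D_1^*D_1\in\mathbb{C}\Gamma$.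 *)

theory Defs
  imports
    Complex_Main
    "HOL-Library.Countable"
    "HOL-Library.Poly_Mapping"
    "HOL-Algebra.Module"
    "Jordan_Normal_Form.Matrix"
begin

section \<open>Group algebras\<close>

text \<open>
  A discrete group is a type of class \<open>group_add\<close>. This class is not commutative: the
  group law is merely written \<open>+\<close>, the identity \<open>0\<close> and the inverse
  \<open>-\<close>. With this convention \<open>'g \<Rightarrow>\<^sub>0 'k\<close> with its convolution product
  is the group algebra of \<open>'g\<close> over \<open>'k\<close>, the element \<open>a\<gamma>\<close> being
  \<open>Poly_Mapping.single \<gamma> a\<close>.
\<close>

definition aug :: "('g::group_add \<Rightarrow>\<^sub>0 'k::comm_ring_1) \<Rightarrow> 'k" where
  "aug a = (\<Sum>g\<in>Poly_Mapping.keys a. Poly_Mapping.lookup a g)"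

definition star :: "('g::group_add \<Rightarrow>\<^sub>0 complex) \<Rightarrow> ('g \<Rightarrow>\<^sub>0 complex)" where
  "star a = (\<Sum>g\<in>Poly_Mapping.keys a. Poly_Mapping.single (- g) (cnj (Poly_Mapping.lookup a g)))"

lemma lookup_star: "Poly_Mapping.lookup (star a) g = cnj (Poly_Mapping.lookup a (- g))"
proof -
  have "Poly_Mapping.lookup (star a) g =
      (\<Sum>h\<in>Poly_Mapping.keys a. if h = - g then cnj (Poly_Mapping.lookup a h) else 0)"
    unfolding star_def lookup_sum lookup_single when_def
    by (intro sum.cong refl) (metis minus_minus)
  also have "\<dots> = cnj (Poly_Mapping.lookup a (- g))"
    by (simp add: sum.delta in_keys_iff)
  finally show ?thesis .
qed

definition mat_star :: "('g::group_add \<Rightarrow>\<^sub>0 complex) mat \<Rightarrow> ('g \<Rightarrow>\<^sub>0 complex) mat" where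
  "mat_star A = map_mat star (transpose_mat A)"

definition complexify :: "('g::group_add \<Rightarrow>\<^sub>0 rat) \<Rightarrow> ('g \<Rightarrow>\<^sub>0 complex)" where
  "complexify = Poly_Mapping.map of_rat"

lemma lookup_complexify: "Poly_Mapping.lookup (complexify a) g = of_rat (Poly_Mapping.lookup a g)"
  by (simp add: complexify_def Poly_Mapping.map.rep_eq when_def)


section \<open>Resolutions of the trivial module\<close>

text \<open>Row vectors are acted upon by matrices from the right, so that this is a map of left modules.\<close>

definition row_mult :: "'r::semiring_0 vec \<Rightarrow> 'r mat \<Rightarrow> 'r vec" where
  "row_mult v A = vec (dim_col A) (\<lambda>j. scalar_prod v (col A j))"

definition left_submodule :: "nat \<Rightarrow> 'r::ring_1 vec set \<Rightarrow> bool" where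
  "left_submodule m P \<longleftrightarrow> P \<subseteq> carrier_vec m \<and> 0\<^sub>v m \<in> P \<and>
     (\<forall>u\<in>P. \<forall>v\<in>P. u + v \<in> P) \<and> (\<forall>a. \<forall>v\<in>P. a \<cdot>\<^sub>v v \<in> P)"

text \<open>
  A finitely generated projective module is, up to isomorphism, a direct summand of a free module of
  finite rank; accordingly such modules are represented by summands of \<open>R^m\<close>.
\<close>

definition direct_summand :: "nat \<Rightarrow> 'r::ring_1 vec set \<Rightarrow> bool" where
  "direct_summand m P \<longleftrightarrow> left_submodule m P \<and>
     (\<exists>Q. left_submodule m Q \<and> P \<inter> Q = {0\<^sub>v m} \<and>
          (\<forall>v\<in>carrier_vec m. \<exists>p\<in>P. \<exists>q\<in>Q. v = p + q))"

definition left_linear :: "'r::ring_1 vec set \<Rightarrow> 'r vec set \<Rightarrow> ('r vec \<Rightarrow> 'r vec) \<Rightarrow> bool" where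
  "left_linear P P' f \<longleftrightarrow> f ` P \<subseteq> P' \<and> (\<forall>u\<in>P. \<forall>v\<in>P. f (u + v) = f u + f v) \<and>
     (\<forall>a. \<forall>v\<in>P. f (a \<cdot>\<^sub>v v) = a \<cdot>\<^sub>v f v)"

text \<open>Maps to the trivial module \<open>\<rat>\<close>, on which the group ring acts through \<open>aug\<close>.\<close>

definition left_linear_to_trivial ::
  "('g::group_add \<Rightarrow>\<^sub>0 rat) vec set \<Rightarrow> (('g \<Rightarrow>\<^sub>0 rat) vec \<Rightarrow> rat) \<Rightarrow> bool" where
  "left_linear_to_trivial P \<eta> \<longleftrightarrow> (\<forall>u\<in>P. \<forall>v\<in>P. \<eta> (u + v) = \<eta> u + \<eta> v) \<and>
     (\<forall>a. \<forall>v\<in>P. \<eta> (a \<cdot>\<^sub>v v) = aug a * \<eta> v)"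

text \<open>
  Exactness of \<open>0 \<leftarrow> \<rat> \<leftarrow> P 0 \<leftarrow> P 1 \<leftarrow> \<dots>\<close>, where the first nontrivial map is
  \<open>\<eta>\<close> and \<open>d k : P k \<rightarrow> P (k - 1)\<close> for \<open>k \<ge> 1\<close> (\<open>d 0\<close> is not used).
\<close>

definition resolves_trivial ::
  "(nat \<Rightarrow> ('g::group_add \<Rightarrow>\<^sub>0 rat) vec set) \<Rightarrow>
   (nat \<Rightarrow> ('g \<Rightarrow>\<^sub>0 rat) vec \<Rightarrow> ('g \<Rightarrow>\<^sub>0 rat) vec) \<Rightarrow>
   (('g \<Rightarrow>\<^sub>0 rat) vec \<Rightarrow> rat) \<Rightarrow> (nat \<Rightarrow> nat) \<Rightarrow> bool" where
  "resolves_trivial P d \<eta> m \<longleftrightarrow>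
     left_linear_to_trivial (P 0) \<eta> \<and> (\<forall>k. left_linear (P (Suc k)) (P k) (d (Suc k))) \<and>
     \<eta> ` P 0 = UNIV \<and>
     d 1 ` P 1 = {v \<in> P 0. \<eta> v = 0} \<and>
     (\<forall>k. d (Suc (Suc k)) ` P (Suc (Suc k)) = {v \<in> P (Suc k). d (Suc k) v = 0\<^sub>v (m k)})"

definition FP_infinity_rat :: "'g::group_add itself \<Rightarrow> bool" where
  "FP_infinity_rat _ \<longleftrightarrow>
     (\<exists>(P :: nat \<Rightarrow> ('g \<Rightarrow>\<^sub>0 rat) vec set) d \<eta> m.
        (\<forall>k. direct_summand (m k) (P k)) \<and> resolves_trivial P d \<eta> m)"

text \<open>
  The matrix \<open>D k\<close> represents the differential from degree \<open>k \<ge> 1\<close> to degree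
  \<open>k - 1\<close>; \<open>D 0\<close> is not used.
\<close>

definition based_free_resolution ::
  "(nat \<Rightarrow> nat) \<Rightarrow> (nat \<Rightarrow> ('g::group_add \<Rightarrow>\<^sub>0 rat) mat) \<Rightarrow> (('g \<Rightarrow>\<^sub>0 rat) vec \<Rightarrow> rat) \<Rightarrow> bool" where
  "based_free_resolution m D \<eta> \<longleftrightarrow>
     (\<forall>k. D (Suc k) \<in> carrier_mat (m (Suc k)) (m k)) \<and>
     resolves_trivial (\<lambda>k. carrier_vec (m k)) (\<lambda>k v. row_mult v (D k)) \<eta> m"


section \<open>Laplace operators\<close>

fun laplace :: "(nat \<Rightarrow> ('g::group_add \<Rightarrow>\<^sub>0 complex) mat) \<Rightarrow> nat \<Rightarrow> ('g \<Rightarrow>\<^sub>0 complex) mat" where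
  "laplace D 0 = mat_star (D 1) * D 1"
| "laplace D (Suc k) =
     D (Suc k) * mat_star (D (Suc k)) + mat_star (D (Suc (Suc k))) * D (Suc (Suc k))"

definition scalar_mat :: "nat \<Rightarrow> 'r::ring_1 \<Rightarrow> 'r mat" where
  "scalar_mat m a = a \<cdot>\<^sub>m 1\<^sub>m m"

definition sum_of_squares :: "nat \<Rightarrow> ('g::group_add \<Rightarrow>\<^sub>0 complex) mat list \<Rightarrow> ('g \<Rightarrow>\<^sub>0 complex) mat" where
  "sum_of_squares m xs = foldr (\<lambda>x A. mat_star x * x + A) xs (0\<^sub>m m m)"


section \<open>Unitary representations\<close>

definition complex_ring :: "complex ring" where
  "complex_ring = \<lparr>carrier = UNIV, mult = (*), one = 1, zero = 0, add = (+)\<rparr>"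

lemma cring_complex_ring: "cring complex_ring"
  by (rule cringI; (rule abelian_groupI | rule comm_monoidI)?)
     (auto simp: complex_ring_def algebra_simps intro: exI[of _ "- x" for x :: complex])

text \<open>
  The fields \<open>mult\<close> and \<open>one\<close> inherited from \<open>ring\<close> play no role in a module.
  The inner product is linear in its first argument.
\<close>

record 'v inner_product_space = "(complex, 'v) module" +
  cinner :: "'v \<Rightarrow> 'v \<Rightarrow> complex"

definition hnorm :: "('v, 'b) inner_product_space_scheme \<Rightarrow> 'v \<Rightarrow> real" where
  "hnorm H x = sqrt (Re (cinner H x x))"

locale complex_hilbert_space = module complex_ring H for H (structure) +
  assumes cinner_add:
      "\<lbrakk>x \<in> carrier H; y \<in> carrier H; z \<in> carrier H\<rbrakk> \<Longrightarrow>
        cinner H (x \<oplus> y) z = cinner H x z + cinner H y z"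
    and cinner_smult:
      "\<lbrakk>x \<in> carrier H; y \<in> carrier H\<rbrakk> \<Longrightarrow> cinner H (a \<odot> x) y = a * cinner H x y"
    and cinner_commute:
      "\<lbrakk>x \<in> carrier H; y \<in> carrier H\<rbrakk> \<Longrightarrow> cinner H y x = cnj (cinner H x y)"
    and cinner_pos:
      "\<lbrakk>x \<in> carrier H; x \<noteq> \<zero>\<rbrakk> \<Longrightarrow> 0 < Re (cinner H x x)"
    and complete:
      "\<lbrakk>\<And>n. s n \<in> carrier H;
        \<And>e. 0 < e \<Longrightarrow> \<exists>N. \<forall>p\<ge>N. \<forall>q\<ge>N. hnorm H (s p \<ominus> s q) < e\<rbrakk> \<Longrightarrow>
        \<exists>l\<in>carrier H. (\<lambda>n. hnorm H (s n \<ominus> l)) \<longlonglongrightarrow> 0"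

locale unitary_representation = complex_hilbert_space H for H (structure) +
  fixes \<pi> :: "'g::group_add \<Rightarrow> 'v \<Rightarrow> 'v"
  assumes rep_closed: "x \<in> carrier H \<Longrightarrow> \<pi> g x \<in> carrier H"
    and rep_add: "\<lbrakk>x \<in> carrier H; y \<in> carrier H\<rbrakk> \<Longrightarrow> \<pi> g (x \<oplus> y) = \<pi> g x \<oplus> \<pi> g y"
    and rep_smult: "x \<in> carrier H \<Longrightarrow> \<pi> g (a \<odot> x) = a \<odot> \<pi> g x"
    and rep_one: "x \<in> carrier H \<Longrightarrow> \<pi> 0 x = x"
    and rep_mult: "x \<in> carrier H \<Longrightarrow> \<pi> (g + h) x = \<pi> g (\<pi> h x)"
    and rep_isometric:
      "\<lbrakk>x \<in> carrier H; y \<in> carrier H\<rbrakk> \<Longrightarrow> cinner H (\<pi> g x) (\<pi> g y) = cinner H x y"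

definition no_invariant_vectors ::
  "('v, 'b) inner_product_space_scheme \<Rightarrow> ('g \<Rightarrow> 'v \<Rightarrow> 'v) \<Rightarrow> bool" where
  "no_invariant_vectors H \<pi> \<longleftrightarrow>
     (\<forall>x\<in>carrier H. (\<forall>g. \<pi> g x = x) \<longrightarrow> x = \<zero>\<^bsub>H\<^esub>)"


section \<open>Group cohomology\<close>

text \<open>
  Group cohomology is computed by the homogeneous standard complex. A \<open>j\<close>-cochain is an
  equivariant function of \<open>j + 1\<close> group elements; values on lists of other lengths are
  irrelevant.
\<close>

definition cochain ::
  "('v, 'b) inner_product_space_scheme \<Rightarrow> ('g::group_add \<Rightarrow> 'v \<Rightarrow> 'v) \<Rightarrow> nat \<Rightarrow> ('g list \<Rightarrow> 'v) \<Rightarrow> bool" where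
  "cochain H \<pi> j c \<longleftrightarrow>
     (\<forall>xs. length xs = Suc j \<longrightarrow>
        c xs \<in> carrier H \<and> (\<forall>g. c (map (\<lambda>x. g + x) xs) = \<pi> g (c xs)))"

definition coboundary ::
  "('v, 'b) inner_product_space_scheme \<Rightarrow> ('g list \<Rightarrow> 'v) \<Rightarrow> 'g list \<Rightarrow> 'v" where
  "coboundary H c xs =
     (\<Oplus>\<^bsub>H\<^esub>i\<in>{..<length xs}. ((-1) ^ i) \<odot>\<^bsub>H\<^esub> c (take i xs @ drop (Suc i) xs))"

text \<open>Vanishing of the cohomology in a degree \<open>j \<ge> 1\<close>: every cocycle is a coboundary.\<close>

definition cohomology_vanishes ::
  "('v, 'b) inner_product_space_scheme \<Rightarrow> ('g::group_add \<Rightarrow> 'v \<Rightarrow> 'v) \<Rightarrow> nat \<Rightarrow> bool" where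
  "cohomology_vanishes H \<pi> j \<longleftrightarrow>
     (\<forall>c. cochain H \<pi> j c \<and> (\<forall>xs. length xs = j + 2 \<longrightarrow> coboundary H c xs = \<zero>\<^bsub>H\<^esub>) \<longrightarrow>
        (\<exists>b. cochain H \<pi> (j - 1) b \<and> (\<forall>xs. length xs = j + 1 \<longrightarrow> c xs = coboundary H b xs)))"

text \<open>
  The type \<open>'v\<close> serves as the universe from which the underlying sets of the Hilbert spaces
  are taken.
\<close>

definition property_T :: "'v itself \<Rightarrow> 'g::group_add itself \<Rightarrow> nat \<Rightarrow> bool" where
  "property_T _ _ n \<longleftrightarrow>
     (\<forall>j. 1 \<le> j \<and> j \<le> n \<longrightarrow>
        (\<forall>(H :: 'v inner_product_space) (\<pi> :: 'g \<Rightarrow> 'v \<Rightarrow> 'v).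
           unitary_representation H \<pi> \<and> no_invariant_vectors H \<pi> \<longrightarrow> cohomology_vanishes H \<pi> j))"

end

(* Cochains with values in a unitary representation H, taken along the based resolution, are tuples in
   H^(m k), and Delta_k acts on them as the Hodge Laplacian.

   A sum of squares in degree 0 says that Delta_0 >= eps on the image of Delta_0; without invariant
   vectors Delta_0 is injective, and a contraction argument makes it surjective. The sum of squares in
   degree k then gives Delta_k >= eps on all of H^(m k), so that every k-cocycle is Delta_k z for some z
   and hence the coboundary of d_k^* z.

   Conversely, if Delta_0 Delta_k Delta_0 - eps Delta_0^2 is a sum of squares for no eps > 0, a
   separation argument gives one positive functional that is 1 on Delta_0^2 and 0 on
   Delta_0 Delta_k Delta_0. Its GNS representation carries a harmonic k-cochain of norm 1, which
   contradicts the vanishing of the cohomology as soon as there are no invariant vectors. That is where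
   degree 1 enters twice: the representation is generated by 1-cocycles, so an invariant vector would
   give a nonzero homomorphism from the group to the complex numbers, and the same argument with
   Delta_0 and Delta_0^2 in place of Delta_0^2 and Delta_0 Delta_k Delta_0 yields
   Delta_0^2 - eps Delta_0 as a sum of squares, which makes Delta_0^2 an order unit. *)
theory Submission
  imports Defs "HOL-Library.Function_Algebras" "HOL-Analysis.Abstract_Topology_2"
begin

section \<open>Linear extension and positive functionals\<close>

text \<open>The sandwich by Delta_0 is forced by invariant vectors: Delta_k may have a kernel on
  them, and Delta_0 kills them. It also shapes the functional. The unit matrix need not lie below a
  multiple of Delta_0^2, so the functional is defined only on what Delta_0^2 bounds, and no vector
  for the unit row is available. The vectors that remain come from the entries of d_1; that they are
  bounded follows from the degree 0 inequality, which therefore precedes the other degrees. Two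
  further obstacles determine the constructions. Property (T_n) refers to the homogeneous standard
  complex but the Laplacians to a based resolution, so the two are compared by equivariant chain
  homotopies, over the rationals because the differentials are rational. And the Hilbert spaces in
  property (T_n) have their elements in a type of which only an embedding of the reals is known. The
  representations built here must be small: each is the completion of a space spanned by countably
  many vectors, encoded as functions on a countable set.\<close>

definition lin :: "('k::field \<Rightarrow> 'b::ab_group_add \<Rightarrow> 'b) \<Rightarrow> ('x \<Rightarrow> 'b) \<Rightarrow> ('x \<Rightarrow>\<^sub>0 'k) \<Rightarrow> 'b" where
  "lin sc s p = (\<Sum>x\<in>Poly_Mapping.keys p. sc (Poly_Mapping.lookup p x) (s x))"

definition psc :: "'k::field \<Rightarrow> ('x \<Rightarrow>\<^sub>0 'k) \<Rightarrow> ('x \<Rightarrow>\<^sub>0 'k)" where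
  "psc r = Poly_Mapping.map ((*) r)"

lemma lookup_psc [simp]: "Poly_Mapping.lookup (psc r p) x = r * Poly_Mapping.lookup p x"
  by (simp add: psc_def Poly_Mapping.map.rep_eq when_def)

interpretation psc: vector_space "psc :: 'k::field \<Rightarrow> ('x \<Rightarrow>\<^sub>0 'k) \<Rightarrow> _"
  by standard (auto intro!: poly_mapping_eqI simp: lookup_add algebra_simps)

lemma psc_single [simp]: "psc r (Poly_Mapping.single x s) = Poly_Mapping.single x (r * s)"
  by (rule poly_mapping_eqI) (simp add: lookup_single when_def)

lemma poly_mapping_expand: "p = (\<Sum>x\<in>Poly_Mapping.keys p. Poly_Mapping.single x (Poly_Mapping.lookup p x))"
  by (rule poly_mapping_eqI)
    (simp add: lookup_sum lookup_single when_def sum.delta' in_keys_iff)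

context vector_space
begin


lemma lin_super:
  fixes p :: "'x \<Rightarrow>\<^sub>0 'a"
  assumes "finite A" "Poly_Mapping.keys p \<subseteq> A"
  shows "lin scale s p = (\<Sum>x\<in>A. scale (Poly_Mapping.lookup p x) (s x))"
  unfolding lin_def by (rule sum.mono_neutral_left) (use assms in \<open>auto simp: in_keys_iff\<close>)

lemma lin_zero [simp]: "lin scale s 0 = 0"
  by (simp add: lin_def)

lemma lin_single [simp]: "lin scale s (Poly_Mapping.single x r) = scale r (s x)"
  by (simp add: lin_def)

lemma lin_add: "lin scale s (p + q) = lin scale s p + lin scale s q"
proof -
  let ?A = "Poly_Mapping.keys p \<union> Poly_Mapping.keys q"
  have "lin scale s (p + q) = (\<Sum>x\<in>?A. scale (Poly_Mapping.lookup (p + q) x) (s x))"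
    by (rule lin_super) (use Poly_Mapping.keys_add[of p q] in auto)
  also have "\<dots> = lin scale s p + lin scale s q"
    by (subst (1 2) lin_super[of ?A]) (auto simp: lookup_add scale_left_distrib sum.distrib)
  finally show ?thesis .
qed

lemma lin_psc: "lin scale s (psc r p) = scale r (lin scale s p)"
proof -
  have "lin scale s (psc r p) = (\<Sum>x\<in>Poly_Mapping.keys p. scale (Poly_Mapping.lookup (psc r p) x) (s x))"
    by (rule lin_super) (auto simp: in_keys_iff)
  then show ?thesis by (simp add: lin_def scale_sum_right)
qed

lemma lin_minus: "lin scale s (- p) = - lin scale s p"
  using lin_add[of s p "- p"] by (simp add: add_eq_0_iff)

lemma lin_diff: "lin scale s (p - q) = lin scale s p - lin scale s q"
  using lin_add[of s p "- q"] by (simp add: lin_minus)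

lemma lin_sum: "lin scale s (\<Sum>i\<in>I. p i) = (\<Sum>i\<in>I. lin scale s (p i))"
  by (induction I rule: infinite_finite_induct) (auto simp: lin_add)

lemma lin_cong: "(\<And>x. x \<in> Poly_Mapping.keys p \<Longrightarrow> s x = t x) \<Longrightarrow> lin scale s p = lin scale t p"
  by (simp add: lin_def)

lemma lin_fun_add: "lin scale (\<lambda>x. s x + t x) p = lin scale s p + lin scale t p"
  by (simp add: lin_def sum.distrib scale_right_distrib)

lemma lin_fun_diff: "lin scale (\<lambda>x. s x - t x) p = lin scale s p - lin scale t p"
  by (simp add: lin_def sum_subtractf scale_right_diff_distrib)

lemma lin_fun_zero [simp]: "lin scale (\<lambda>x. 0) p = 0"
  by (simp add: lin_def)

lemma lin_lin: "lin scale c (lin psc s p) = lin scale (\<lambda>x. lin scale c (s x)) p"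
  by (simp add: lin_def[of psc] lin_sum lin_psc) (simp add: lin_def[of scale "\<lambda>x. lin scale c (s x)"])

lemma lin_mem:
  assumes "0 \<in> S" "\<And>x y. x \<in> S \<Longrightarrow> y \<in> S \<Longrightarrow> x + y \<in> S" "\<And>a x. x \<in> S \<Longrightarrow> scale a x \<in> S"
    "\<And>x. x \<in> Poly_Mapping.keys p \<Longrightarrow> s x \<in> S"
  shows "lin scale s p \<in> S"
proof -
  have "(\<Sum>x\<in>A. scale (Poly_Mapping.lookup p x) (s x)) \<in> S" if "finite A" "A \<subseteq> Poly_Mapping.keys p" for A
    using that by (induction A) (use assms in auto)
  then show ?thesis by (simp add: lin_def)
qed

end

lemma psc_lin_id [simp]: "lin psc (\<lambda>x. Poly_Mapping.single x 1) p = p"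
  using poly_mapping_expand[of p] by (simp add: lin_def)

lemma keys_lin: "Poly_Mapping.keys (lin psc s p) \<subseteq> (\<Union>x\<in>Poly_Mapping.keys p. Poly_Mapping.keys (s x))"
  unfolding lin_def
  by (rule order_trans[OF Poly_Mapping.keys_sum]) (auto simp: in_keys_iff)

lemma chain_lin:
  assumes "Poly_Mapping.keys p \<subseteq> X" "\<And>x. x \<in> X \<Longrightarrow> Poly_Mapping.keys (s x) \<subseteq> Y"
  shows "Poly_Mapping.keys (lin psc s p) \<subseteq> Y"
  using keys_lin[of s p] assms by blast

section \<open>Positive functionals on a cone with a unit\<close>

text \<open>The maximal cone omitting \<open>-e\<close> defines a total preorder, which an order unit turns into
  a functional: this replaces the Hahn-Banach theorem.\<close>

locale unital_cone = vector_space sc for sc :: "real \<Rightarrow> 'a::ab_group_add \<Rightarrow> 'a" +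
  fixes C :: "'a set" and e :: 'a
  assumes cone_zero: "0 \<in> C"
    and cone_add: "x \<in> C \<Longrightarrow> y \<in> C \<Longrightarrow> x + y \<in> C"
    and cone_scale: "x \<in> C \<Longrightarrow> 0 \<le> r \<Longrightarrow> sc r x \<in> C"
    and unit_in: "e \<in> C" and not_minus: "- e \<notin> C"
begin

text \<open>The largest subspace on which \<open>e\<close> is an order unit. In the application
  \<open>e\<close> is Delta_0 or the diagonal matrix of Delta_0^2, which need not bound all
  matrices.\<close>

definition bounded_part :: "'a set" where
  "bounded_part = {x. \<exists>r. sc r e + x \<in> C \<and> sc r e - x \<in> C}"

lemma bounded_add: "x \<in> bounded_part \<Longrightarrow> y \<in> bounded_part \<Longrightarrow> x + y \<in> bounded_part"
proof -
  assume "x \<in> bounded_part" "y \<in> bounded_part"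
  then obtain r s where *: "sc r e + x \<in> C" "sc r e - x \<in> C" "sc s e + y \<in> C" "sc s e - y \<in> C"
    by (auto simp: bounded_part_def)
  have "sc (r + s) e + (x + y) \<in> C" "sc (r + s) e - (x + y) \<in> C"
    using cone_add[OF *(1,3)] cone_add[OF *(2,4)] by (simp_all add: scale_left_distrib algebra_simps)
  then show ?thesis by (auto simp: bounded_part_def)
qed

lemma bounded_scale: "x \<in> bounded_part \<Longrightarrow> sc t x \<in> bounded_part"
proof -
  assume "x \<in> bounded_part"
  then obtain r where *: "sc r e + x \<in> C" "sc r e - x \<in> C" by (auto simp: bounded_part_def)
  consider "0 \<le> t" | "t \<le> 0" by linarith
  then show ?thesis
  proof cases
    case 1
    then show ?thesis
      using cone_scale[OF *(1), of t] cone_scale[OF *(2), of t]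
      by (auto simp: bounded_part_def scale_right_distrib scale_right_diff_distrib intro!: exI[of _ "t * r"])
  next
    case 2
    then show ?thesis
      using cone_scale[OF *(1), of "- t"] cone_scale[OF *(2), of "- t"]
      by (auto simp: bounded_part_def scale_right_distrib scale_right_diff_distrib intro!: exI[of _ "- t * r"])
  qed
qed

lemma maximal_cone:
  "\<exists>M. C \<subseteq> M \<and> unital_cone sc M e \<and> (\<forall>x. x \<in> M \<or> - x \<in> M)"
proof -
  define \<A> where "\<A> = {M. C \<subseteq> M \<and> unital_cone sc M e}"
  have ne: "\<A> \<noteq> {}" using unital_cone_axioms by (auto simp: \<A>_def)
  have "\<exists>M\<in>\<A>. \<forall>X\<in>\<A>. M \<subseteq> X \<longrightarrow> X = M"
  proof (rule subset_Zorn_nonempty[OF ne])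
    fix \<C> assume ch: "\<C> \<noteq> {}" "subset.chain \<A> \<C>"
    then have sub: "\<C> \<subseteq> \<A>" and tot: "\<And>X Y. X \<in> \<C> \<Longrightarrow> Y \<in> \<C> \<Longrightarrow> X \<subseteq> Y \<or> Y \<subseteq> X"
      by (auto simp: subset.chain_def)
    have uc: "unital_cone sc M e" if "M \<in> \<C>" for M using that sub by (auto simp: \<A>_def)
    have "unital_cone sc (\<Union>\<C>) e"
    proof
      show "0 \<in> \<Union>\<C>" using ch uc unital_cone.cone_zero by blast
      fix x y assume "x \<in> \<Union>\<C>" "y \<in> \<Union>\<C>"
      then obtain X Y where "X \<in> \<C>" "Y \<in> \<C>" "x \<in> X" "y \<in> Y" by auto
      then show "x + y \<in> \<Union>\<C>"
        using tot[of X Y] unital_cone.cone_add[OF uc[of X], of x y] unital_cone.cone_add[OF uc[of Y], of x y]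
        by blast
    next
      fix x and r :: real assume "x \<in> \<Union>\<C>" "0 \<le> r"
      then show "sc r x \<in> \<Union>\<C>" using uc unital_cone.cone_scale by blast
    next
      show "e \<in> \<Union>\<C>" using ch uc unital_cone.unit_in by blast
      show "- e \<notin> \<Union>\<C>" using uc unital_cone.not_minus by blast
    qed
    moreover have "C \<subseteq> \<Union>\<C>" using ch sub by (auto simp: \<A>_def)
    ultimately show "\<Union>\<C> \<in> \<A>" by (simp add: \<A>_def)
  qed
  then obtain M where M: "C \<subseteq> M" "unital_cone sc M e"
    and max: "\<And>X. C \<subseteq> X \<Longrightarrow> unital_cone sc X e \<Longrightarrow> M \<subseteq> X \<Longrightarrow> X = M"
    by (auto simp: \<A>_def)
  interpret M: unital_cone sc M e by fact
  \<comment> \<open>Maximality: the cone generated by \<open>M\<close> and \<open>x\<close> must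
    stop being proper, that is, contain \<open>- e\<close>.\<close>
  have ext: "\<exists>c\<in>M. \<exists>t\<ge>0. - e = c + sc t x" if "x \<notin> M" for x
  proof (rule ccontr)
    assume neg: "\<not> ?thesis"
    define X where "X = {c + sc t x | c t. c \<in> M \<and> 0 \<le> t}"
    have MX: "M \<subseteq> X"
    proof
      fix c assume "c \<in> M"
      then have "c = c + sc 0 x \<and> c \<in> M \<and> (0::real) \<le> 0" by simp
      then show "c \<in> X" unfolding X_def by blast
    qed
    have "unital_cone sc X e"
    proof
      show "0 \<in> X" "e \<in> X" using MX M.cone_zero M.unit_in by auto
      show "- e \<notin> X" using neg by (auto simp: X_def)
      fix y z assume "y \<in> X" "z \<in> X"
      then obtain c t c' t' where "y = c + sc t x" "c \<in> M" "0 \<le> t" "z = c' + sc t' x" "c' \<in> M" "0 \<le> t'"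
        by (auto simp: X_def)
      then have "y + z = (c + c') + sc (t + t') x" "c + c' \<in> M" "0 \<le> t + t'"
        by (auto simp: scale_left_distrib algebra_simps M.cone_add)
      then show "y + z \<in> X" unfolding X_def by blast
    next
      fix y and r :: real assume "y \<in> X" "0 \<le> r"
      then obtain c t where "y = c + sc t x" "c \<in> M" "0 \<le> t" by (auto simp: X_def)
      then have "sc r y = sc r c + sc (r * t) x" "sc r c \<in> M" "0 \<le> r * t"
        using \<open>0 \<le> r\<close> by (auto simp: scale_right_distrib M.cone_scale)
      then show "sc r y \<in> X" unfolding X_def by blast
    qed
    then have "X = M" using max MX M(1) by blast
    moreover have "x \<in> X"
      unfolding X_def using M.cone_zero by (auto intro!: exI[of _ 0] exI[of _ 1])
    ultimately show False using that by simp
  qed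
  have "x \<in> M \<or> - x \<in> M" for x
  proof (rule ccontr)
    assume "\<not> ?thesis"
    then obtain c t c' t' where c: "c \<in> M" "0 \<le> t" "- e = c + sc t x" "c' \<in> M" "0 \<le> t'" "- e = c' + sc t' (- x)"
      using ext[of x] ext[of "- x"] by blast
    have "t \<noteq> 0" using c M.not_minus by auto
    then have t: "0 < t + t'" using c by linarith
    \<comment> \<open>The weights cancel \<open>x\<close> from the two expressions for
      \<open>- e\<close>.\<close>
    have "sc (t + t') (- e) = sc t (- e) + sc t' (- e)" by (simp only: scale_left_distrib)
    also have "\<dots> = sc t c' + sc t' c"
      by (subst c(6), subst c(3)) (simp add: scale_right_distrib scale_right_diff_distrib mult.commute)
    finally have "sc (t + t') (- e) \<in> M" using c by (auto intro: M.cone_add M.cone_scale)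
    from M.cone_scale[OF this, of "1 / (t + t')"] have "- e \<in> M" using t by simp
    then show False using M.not_minus by simp
  qed
  then show ?thesis using M by blast
qed

theorem positive_functional:
  "\<exists>\<phi>. (\<forall>x\<in>bounded_part. \<forall>y\<in>bounded_part. \<phi> (x + y) = \<phi> x + \<phi> y) \<and>
       (\<forall>r. \<forall>x\<in>bounded_part. \<phi> (sc r x) = r * \<phi> x) \<and>
       (\<forall>x\<in>bounded_part \<inter> C. 0 \<le> \<phi> x) \<and> \<phi> e = (1::real)"
proof -
  obtain M where M: "C \<subseteq> M" "unital_cone sc M e" and tot: "\<And>x. x \<in> M \<or> - x \<in> M"
    using maximal_cone by blast
  interpret M: unital_cone sc M e by fact
  \<comment> \<open>The lower cut of \<open>x\<close> on the line through \<open>e\<close>, for the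
    total preorder whose positive elements are \<open>M\<close>.\<close>
  define L where "L x = {r. x - sc r e \<in> M}" for x
  define \<phi> where "\<phi> x = Sup (L x)" for x
  have pos: "sc r e \<in> M \<longleftrightarrow> 0 \<le> r" for r
  proof
    assume a: "sc r e \<in> M"
    show "0 \<le> r"
    proof (rule ccontr)
      assume "\<not> 0 \<le> r"
      then have "- e = sc (- 1 / r) (sc r e)" "0 \<le> - 1 / r" by (auto simp: divide_simps)
      then show False using M.cone_scale[OF a] M.not_minus by metis
    qed
  qed (use M.cone_scale M.unit_in in auto)
  have le: "r \<le> s" if "x - sc r e \<in> M" "sc s e - x \<in> M" for r s x
    using M.cone_add[OF that] pos[of "s - r"] by (simp add: scale_left_diff_distrib)
  have down: "s \<in> L x" if "r \<in> L x" "s \<le> r" for r s x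
  proof -
    have "sc (r - s) e \<in> M" using that pos by simp
    from M.cone_add[OF _ this, of "x - sc r e"] that show ?thesis
      by (simp add: L_def scale_left_diff_distrib)
  qed
  have bd: "L x \<noteq> {}" "bdd_above (L x)" if x: "x \<in> bounded_part" for x
  proof -
    obtain r where r: "sc r e + x \<in> C" "sc r e - x \<in> C" using x by (auto simp: bounded_part_def)
    have "- r \<in> L x" using r(1) M(1) by (auto simp: L_def add.commute)
    then show "L x \<noteq> {}" by auto
    show "bdd_above (L x)" using le[of x _ r] r(2) M(1) by (auto simp: L_def intro!: bdd_aboveI[of _ r])
  qed
  have below: "x - sc r e \<in> M" if "x \<in> bounded_part" "r < \<phi> x" for x r
    using less_cSupD[of "L x" r] bd[OF that(1)] that down[of _ x r] unfolding \<phi>_def L_def by force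
  have above: "sc r e - x \<in> M" if "x \<in> bounded_part" "\<phi> x < r" for x r
  proof (rule ccontr)
    assume "\<not> ?thesis"
    then have "r \<in> L x" using tot[of "sc r e - x"] by (auto simp: L_def)
    then have "r \<le> \<phi> x" unfolding \<phi>_def by (rule cSup_upper) (use bd that in auto)
    then show False using that by simp
  qed
  \<comment> \<open>Bounds of \<open>x\<close> by \<open>t - d\<close> and \<open>t + d\<close> for
    every \<open>d\<close> pin down the supremum, so additivity and homogeneity reduce to membership
    in \<open>M\<close>.\<close>
  have uniq: "\<phi> x = t" if x: "x \<in> bounded_part"
    and lo: "\<And>d. 0 < d \<Longrightarrow> x - sc (t - d) e \<in> M" and hi: "\<And>d. 0 < d \<Longrightarrow> sc (t + d) e - x \<in> M" for x t
  proof (rule antisym; rule field_le_epsilon)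
    fix d :: real assume d: "0 < d"
    have "\<phi> x - d / 2 \<le> t + d / 2" by (rule le[OF below[OF x] hi]) (use d in auto)
    then show "\<phi> x \<le> t + d" by (simp add: field_simps)
    have "t - d / 2 \<le> \<phi> x + d / 2" by (rule le[OF lo above[OF x]]) (use d in auto)
    then show "t \<le> \<phi> x + d" by (simp add: field_simps)
  qed
  have add: "\<phi> (x + y) = \<phi> x + \<phi> y" if xy: "x \<in> bounded_part" "y \<in> bounded_part" for x y
  proof (rule uniq[OF bounded_add[OF xy]])
    fix d :: real assume d: "0 < d"
    show "x + y - sc (\<phi> x + \<phi> y - d) e \<in> M"
    proof -
      have "(x - sc (\<phi> x - d / 2) e) + (y - sc (\<phi> y - d / 2) e) \<in> M"
        by (intro M.cone_add below) (use xy d in auto)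
      also have "(x - sc (\<phi> x - d / 2) e) + (y - sc (\<phi> y - d / 2) e)
          = x + y - sc ((\<phi> x - d / 2) + (\<phi> y - d / 2)) e" by (simp only: scale_left_distrib) simp
      finally show ?thesis by (simp add: algebra_simps)
    qed
    show "sc (\<phi> x + \<phi> y + d) e - (x + y) \<in> M"
    proof -
      have "(sc (\<phi> x + d / 2) e - x) + (sc (\<phi> y + d / 2) e - y) \<in> M"
        by (intro M.cone_add above) (use xy d in auto)
      also have "(sc (\<phi> x + d / 2) e - x) + (sc (\<phi> y + d / 2) e - y)
          = sc ((\<phi> x + d / 2) + (\<phi> y + d / 2)) e - (x + y)" by (simp only: scale_left_distrib) simp
      finally show ?thesis by (simp add: algebra_simps)
    qed
  qed
  have b0: "0 \<in> bounded_part" using cone_zero by (auto simp: bounded_part_def intro!: exI[of _ 0])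
  have phi0: "\<phi> 0 = 0" using add[OF b0 b0] by simp
  have scale_pos: "\<phi> (sc r x) = r * \<phi> x" if x: "x \<in> bounded_part" and r: "0 < r" for x r
  proof (rule uniq[OF bounded_scale[OF x]])
    fix d :: real assume d: "0 < d"
    have "sc r (x - sc (\<phi> x - d / r) e) \<in> M"
      by (intro M.cone_scale below) (use x d r in auto)
    then show "sc r x - sc (r * \<phi> x - d) e \<in> M" using r by (simp add: scale_right_diff_distrib right_diff_distrib)
    have "sc r (sc (\<phi> x + d / r) e - x) \<in> M"
      by (intro M.cone_scale above) (use x d r in auto)
    then show "sc (r * \<phi> x + d) e - sc r x \<in> M" using r by (simp add: scale_right_diff_distrib distrib_left)
  qed
  have neg: "\<phi> (- x) = - \<phi> x" if x: "x \<in> bounded_part" for x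
    using add[OF x bounded_scale[OF x, of "- 1"]] phi0 by simp
  have scale: "\<phi> (sc r x) = r * \<phi> x" if x: "x \<in> bounded_part" for x r
  proof -
    consider "0 < r" | "r = 0" | "r < 0" by linarith
    then show ?thesis
    proof cases
      case 3
      then show ?thesis using scale_pos[OF bounded_scale[OF x, of "- 1"], of "- r"] neg[OF x] by simp
    qed (use scale_pos[OF x] phi0 in auto)
  qed
  have nonneg: "0 \<le> \<phi> x" if "x \<in> bounded_part \<inter> C" for x
  proof -
    have "0 \<in> L x" using that M(1) by (auto simp: L_def)
    then show ?thesis unfolding \<phi>_def by (rule cSup_upper) (use bd that in auto)
  qed
  have e: "e \<in> bounded_part"
    using unit_in cone_add[OF unit_in unit_in] cone_zero by (auto simp: bounded_part_def intro!: exI[of _ 1])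
  have "\<phi> e = 1"
  proof (rule uniq[OF e])
    fix d :: real assume d: "0 < d"
    show "e - sc (1 - d) e \<in> M" "sc (1 + d) e - e \<in> M"
      using d pos[of d] by (simp_all add: scale_left_diff_distrib scale_left_distrib)
  qed
  then show ?thesis using add scale nonneg by blast
qed

end

section \<open>Hilbert spaces\<close>

definition nrm :: "('a \<Rightarrow> 'a \<Rightarrow> complex) \<Rightarrow> 'a \<Rightarrow> real" where
  "nrm ip x = sqrt (Re (ip x x))"

text \<open>Two needs shape the locale: \<open>S\<close> is a subset of a type with total addition,
  so that finite sums are ordinary sums, and the form may have null vectors, as the form of a state
  has before completion.\<close>

locale semi_hilbert = vector_space sc for sc :: "complex \<Rightarrow> 'a::ab_group_add \<Rightarrow> 'a" +
  fixes S :: "'a set" and ip :: "'a \<Rightarrow> 'a \<Rightarrow> complex"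
  assumes S_zero [simp]: "0 \<in> S"
    and S_add [simp]: "x \<in> S \<Longrightarrow> y \<in> S \<Longrightarrow> x + y \<in> S"
    and S_scale [simp]: "x \<in> S \<Longrightarrow> sc a x \<in> S"
    and ip_add: "x \<in> S \<Longrightarrow> y \<in> S \<Longrightarrow> z \<in> S \<Longrightarrow> ip (x + y) z = ip x z + ip y z"
    and ip_scale: "x \<in> S \<Longrightarrow> y \<in> S \<Longrightarrow> ip (sc a x) y = a * ip x y"
    and ip_commute: "x \<in> S \<Longrightarrow> y \<in> S \<Longrightarrow> ip y x = cnj (ip x y)"
    and ip_nonneg: "x \<in> S \<Longrightarrow> 0 \<le> Re (ip x x)"
begin

lemma S_minus [simp]: "x \<in> S \<Longrightarrow> - x \<in> S"
  using S_scale[of x "- 1"] by simp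

lemma S_diff [simp]: "x \<in> S \<Longrightarrow> y \<in> S \<Longrightarrow> x - y \<in> S"
  using S_add[of x "- y"] by simp

lemma S_sum [simp]: "(\<And>i. i \<in> I \<Longrightarrow> f i \<in> S) \<Longrightarrow> sum f I \<in> S"
  by (induction I rule: infinite_finite_induct) auto

lemma ip_zero_left [simp]: "y \<in> S \<Longrightarrow> ip 0 y = 0"
  using ip_scale[of 0 y 0] by simp

lemma ip_zero_right [simp]: "y \<in> S \<Longrightarrow> ip y 0 = 0"
  using ip_commute[of 0 y] by simp

lemma ip_minus_left: "x \<in> S \<Longrightarrow> y \<in> S \<Longrightarrow> ip (- x) y = - ip x y"
  using ip_scale[of x y "- 1"] by simp

lemma ip_diff_left: "x \<in> S \<Longrightarrow> y \<in> S \<Longrightarrow> z \<in> S \<Longrightarrow> ip (x - y) z = ip x z - ip y z"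
  using ip_add[of x "- y" z] by (simp add: ip_minus_left)

lemma ip_add_right: "x \<in> S \<Longrightarrow> y \<in> S \<Longrightarrow> z \<in> S \<Longrightarrow> ip z (x + y) = ip z x + ip z y"
  using ip_commute[of "x + y" z] ip_commute[of x z] ip_commute[of y z] by (simp add: ip_add)

lemma ip_scale_right: "x \<in> S \<Longrightarrow> y \<in> S \<Longrightarrow> ip y (sc a x) = cnj a * ip y x"
  using ip_commute[of "sc a x" y] ip_commute[of x y] by (simp add: ip_scale)

lemma ip_minus_right: "x \<in> S \<Longrightarrow> y \<in> S \<Longrightarrow> ip y (- x) = - ip y x"
  using ip_scale_right[of x y "- 1"] by simp

lemma ip_diff_right: "x \<in> S \<Longrightarrow> y \<in> S \<Longrightarrow> z \<in> S \<Longrightarrow> ip z (x - y) = ip z x - ip z y"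
  using ip_add_right[of x "- y" z] by (simp add: ip_minus_right)

lemma ip_sum_left: "(\<And>i. i \<in> I \<Longrightarrow> f i \<in> S) \<Longrightarrow> y \<in> S \<Longrightarrow> ip (sum f I) y = (\<Sum>i\<in>I. ip (f i) y)"
  by (induction I rule: infinite_finite_induct) (auto simp: ip_add)

lemma ip_sum_right: "(\<And>i. i \<in> I \<Longrightarrow> f i \<in> S) \<Longrightarrow> y \<in> S \<Longrightarrow> ip y (sum f I) = (\<Sum>i\<in>I. ip y (f i))"
  by (induction I rule: infinite_finite_induct) (auto simp: ip_add_right)

lemma ip_self: "x \<in> S \<Longrightarrow> ip x x = of_real ((nrm ip x)\<^sup>2)"
proof -
  assume x: "x \<in> S"
  have "Im (ip x x) = 0" using ip_commute[OF x x] by (simp add: complex_eq_iff)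
  then show ?thesis using ip_nonneg[OF x] by (simp add: nrm_def complex_eq_iff)
qed

lemma nrm_nonneg [simp]: "x \<in> S \<Longrightarrow> 0 \<le> nrm ip x"
  using ip_nonneg by (simp add: nrm_def)

lemma nrm_sq: "x \<in> S \<Longrightarrow> (nrm ip x)\<^sup>2 = Re (ip x x)"
  using ip_nonneg by (simp add: nrm_def)

lemma nrm_zero [simp]: "nrm ip 0 = 0"
  by (simp add: nrm_def)

lemma nrm_scale: "x \<in> S \<Longrightarrow> nrm ip (sc a x) = cmod a * nrm ip x"
proof -
  assume x: "x \<in> S"
  have "ip (sc a x) (sc a x) = (a * cnj a) * ip x x"
    using x by (simp add: ip_scale ip_scale_right)
  also have "\<dots> = of_real ((cmod a)\<^sup>2 * (nrm ip x)\<^sup>2)"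
    unfolding complex_norm_square[symmetric] ip_self[OF x] by simp
  finally have "Re (ip (sc a x) (sc a x)) = (cmod a * nrm ip x)\<^sup>2"
    by (simp only: Re_complex_of_real power_mult_distrib)
  then have "nrm ip (sc a x) = sqrt ((cmod a * nrm ip x)\<^sup>2)" by (simp only: nrm_def[of ip "sc a x"])
  then show ?thesis using x by simp
qed

lemma nrm_add_sq: "x \<in> S \<Longrightarrow> y \<in> S \<Longrightarrow> (nrm ip (x + y))\<^sup>2 = (nrm ip x)\<^sup>2 + 2 * Re (ip x y) + (nrm ip y)\<^sup>2"
  using ip_commute[of x y] by (simp add: nrm_sq ip_add ip_add_right)

lemma cauchy_schwarz:
  assumes x: "x \<in> S" and y: "y \<in> S"
  shows "cmod (ip x y) \<le> nrm ip x * nrm ip y"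
proof (cases "nrm ip y = 0")
  case True
  \<comment> \<open>As \<open>y\<close> is a null vector there is no best multiple of it to
    subtract; instead the bound is used for arbitrarily large \<open>t\<close>.\<close>
  have le: "2 * t * (cmod (ip x y))\<^sup>2 \<le> (nrm ip x)\<^sup>2" for t
  proof -
    define b where "b = of_real (- t) * ip x y"
    have "0 \<le> (nrm ip (x + sc b y))\<^sup>2" by simp
    also have "\<dots> = (nrm ip x)\<^sup>2 + 2 * Re (cnj b * ip x y)"
      using x y True by (simp add: nrm_add_sq ip_scale_right nrm_scale)
    also have "cnj b * ip x y = of_real (- t) * (ip x y * cnj (ip x y))" by (simp add: b_def)
    also have "\<dots> = of_real (- t * (cmod (ip x y))\<^sup>2)"
      unfolding complex_norm_square[symmetric] by simp
    finally show ?thesis by simp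
  qed
  have "cmod (ip x y) = 0"
  proof (rule ccontr)
    assume "cmod (ip x y) \<noteq> 0"
    then have "2 * (((nrm ip x)\<^sup>2 + 1) / (2 * (cmod (ip x y))\<^sup>2)) * (cmod (ip x y))\<^sup>2 = (nrm ip x)\<^sup>2 + 1"
      by simp
    then show False using le[of "((nrm ip x)\<^sup>2 + 1) / (2 * (cmod (ip x y))\<^sup>2)"] by linarith
  qed
  then show ?thesis using True by simp
next
  case False
  then have ny: "0 < nrm ip y" using nrm_nonneg[OF y] by linarith
  \<comment> \<open>The coefficient that makes \<open>x + sc a y\<close> orthogonal to
    \<open>y\<close>.\<close>
  define a where "a = - ip x y / of_real ((nrm ip y)\<^sup>2)"
  have ca: "cmod a = cmod (ip x y) / (nrm ip y)\<^sup>2" by (simp add: a_def norm_divide norm_power)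
  have "0 \<le> (nrm ip (x + sc a y))\<^sup>2" by simp
  also have "\<dots> = (nrm ip x)\<^sup>2 + 2 * Re (cnj a * ip x y) + (cmod a)\<^sup>2 * (nrm ip y)\<^sup>2"
    using x y by (simp add: nrm_add_sq ip_scale_right nrm_scale power_mult_distrib)
  also have "cnj a * ip x y = - of_real ((cmod (ip x y))\<^sup>2 / (nrm ip y)\<^sup>2)"
  proof -
    have "cnj a * ip x y = - (ip x y * cnj (ip x y)) / of_real ((nrm ip y)\<^sup>2)"
      by (simp add: a_def mult.commute)
    then show ?thesis unfolding complex_norm_square[symmetric] by simp
  qed
  also have "(cmod a)\<^sup>2 * (nrm ip y)\<^sup>2 = (cmod (ip x y))\<^sup>2 / (nrm ip y)\<^sup>2"
    using ny unfolding ca by (simp add: power_divide divide_simps power2_eq_square)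
  finally have "(cmod (ip x y))\<^sup>2 / (nrm ip y)\<^sup>2 \<le> (nrm ip x)\<^sup>2" by simp
  then have "(cmod (ip x y))\<^sup>2 \<le> (nrm ip x * nrm ip y)\<^sup>2"
    using ny by (simp add: divide_simps power_mult_distrib)
  then show ?thesis by (rule power2_le_imp_le) (use x y in simp)
qed

lemma nrm_triangle: "x \<in> S \<Longrightarrow> y \<in> S \<Longrightarrow> nrm ip (x + y) \<le> nrm ip x + nrm ip y"
proof (rule power2_le_imp_le)
  assume xy: "x \<in> S" "y \<in> S"
  have "Re (ip x y) \<le> nrm ip x * nrm ip y"
    using cauchy_schwarz[OF xy] complex_Re_le_cmod order_trans by blast
  then show "(nrm ip (x + y))\<^sup>2 \<le> (nrm ip x + nrm ip y)\<^sup>2"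
    using xy by (simp add: nrm_add_sq power2_sum)
qed simp

lemma nrm_minus: "x \<in> S \<Longrightarrow> nrm ip (- x) = nrm ip x"
  using nrm_scale[of x "- 1"] by simp

lemma nrm_diff_commute: "x \<in> S \<Longrightarrow> y \<in> S \<Longrightarrow> nrm ip (x - y) = nrm ip (y - x)"
  using nrm_minus[of "x - y"] by simp

lemma nrm_triangle_diff:
  "x \<in> S \<Longrightarrow> y \<in> S \<Longrightarrow> z \<in> S \<Longrightarrow> nrm ip (x - z) \<le> nrm ip (x - y) + nrm ip (y - z)"
  using nrm_triangle[of "x - y" "y - z"] by simp

lemma nrm_sum: "(\<And>i. i \<in> I \<Longrightarrow> f i \<in> S) \<Longrightarrow> nrm ip (sum f I) \<le> (\<Sum>i\<in>I. nrm ip (f i))"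
proof (induction I rule: infinite_finite_induct)
  case (insert i I)
  then have "nrm ip (f i + sum f I) \<le> nrm ip (f i) + nrm ip (sum f I)" by (intro nrm_triangle) auto
  then show ?case using insert by auto
qed auto

text \<open>The tail of the geometric series bounds the distance to all later terms. This serves
  both the contraction iteration and the square summable cocycle of a character.\<close>

lemma geometric_cauchy:
  assumes s: "\<And>n. s n \<in> S" and st: "\<And>n. nrm ip (s (Suc n) - s n) \<le> c * r ^ n"
    and r: "0 \<le> r" "r < 1" and c: "0 \<le> c" and e: "0 < (e::real)"
  shows "\<exists>N. \<forall>p\<ge>N. \<forall>q\<ge>N. nrm ip (s p - s q) < e"
proof -
  have step: "nrm ip (s (n + k) - s n) \<le> c * r ^ n / (1 - r)" for n k
  proof -
    have "nrm ip (s (n + k) - s n) \<le> c * r ^ n * (\<Sum>i<k. r ^ i)"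
    proof (induction k)
      case (Suc k)
      have "nrm ip (s (n + Suc k) - s n) \<le> nrm ip (s (Suc (n + k)) - s (n + k)) + nrm ip (s (n + k) - s n)"
        using nrm_triangle_diff[OF s[of "Suc (n + k)"] s[of "n + k"] s[of n]] by simp
      also have "\<dots> \<le> c * r ^ (n + k) + c * r ^ n * (\<Sum>i<k. r ^ i)" by (rule add_mono[OF st Suc])
      finally show ?case by (simp add: power_add algebra_simps)
    qed (simp add: s)
    also have "\<dots> \<le> c * r ^ n * (1 / (1 - r))"
      using c r by (intro mult_left_mono) (simp_all add: sum_gp_strict divide_right_mono)
    finally show ?thesis by simp
  qed
  have "(\<lambda>n. c * r ^ n / (1 - r)) \<longlonglongrightarrow> c * 0 / (1 - r)"
    using r by (intro tendsto_intros LIMSEQ_power_zero) auto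
  then have "eventually (\<lambda>n. c * r ^ n / (1 - r) < e) sequentially"
    using e by (intro order_tendstoD(2)[where y = "c * 0 / (1 - r)"]) auto
  then obtain N where N: "\<And>n. n \<ge> N \<Longrightarrow> c * r ^ n / (1 - r) < e"
    by (auto simp: eventually_sequentially)
  have "nrm ip (s p - s q) < e" if "p \<ge> N" "q \<ge> N" for p q
  proof (cases "q \<le> p")
    case True
    then show ?thesis using step[of q "p - q"] N[OF that(2)] by simp
  next
    case False
    then show ?thesis using step[of p "q - p"] N[OF that(1)] nrm_diff_commute[OF s[of p] s[of q]] by simp
  qed
  then show ?thesis by blast
qed

end

locale pre_hilbert = semi_hilbert +
  assumes ip_definite: "x \<in> S \<Longrightarrow> Re (ip x x) = 0 \<Longrightarrow> x = 0"
begin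

lemma nrm_eq_0: "x \<in> S \<Longrightarrow> nrm ip x = 0 \<longleftrightarrow> x = 0"
  using ip_definite[of x] by (auto simp: nrm_def)

end

section \<open>Complete spaces and coercive equations\<close>

locale hilbert = pre_hilbert +
  assumes complete: "\<lbrakk>\<And>n. s n \<in> S; \<And>e. 0 < e \<Longrightarrow> \<exists>N. \<forall>p\<ge>N. \<forall>q\<ge>N. nrm ip (s p - s q) < e\<rbrakk> \<Longrightarrow>
        \<exists>l\<in>S. (\<lambda>n. nrm ip (s n - l)) \<longlonglongrightarrow> 0"
begin

text \<open>The iteration \<open>s \<mapsto> s + t (y - B s)\<close> multiplies the defect \<open>y - B s\<close>, which stays in
  \<open>Y\<close>, by the contraction \<open>1 - t B\<close>.\<close>

lemma coercive_solve:
  assumes B_S: "\<And>x. x \<in> S \<Longrightarrow> B x \<in> S"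
    and B_add: "\<And>x y. x \<in> S \<Longrightarrow> y \<in> S \<Longrightarrow> B (x + y) = B x + B y"
    and B_scale: "\<And>a x. x \<in> S \<Longrightarrow> B (sc a x) = sc a (B x)"
    and B_bound: "\<And>x. x \<in> S \<Longrightarrow> nrm ip (B x) \<le> R * nrm ip x"
    and Y: "Y \<subseteq> S" "0 \<in> Y" "\<And>x y. x \<in> Y \<Longrightarrow> y \<in> Y \<Longrightarrow> x + y \<in> Y" "\<And>a x. x \<in> Y \<Longrightarrow> sc a x \<in> Y"
    and B_Y: "\<And>x. x \<in> Y \<Longrightarrow> B x \<in> Y"
    and eps: "0 < \<epsilon>" "\<And>x. x \<in> Y \<Longrightarrow> \<epsilon> * (nrm ip x)\<^sup>2 \<le> Re (ip (B x) x)"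
    and y: "y \<in> Y"
  shows "\<exists>z\<in>S. B z = y \<and> (\<exists>s. (\<forall>n. s n \<in> Y) \<and> (\<lambda>n. nrm ip (s n - z)) \<longlonglongrightarrow> 0)"
proof -
  \<comment> \<open>The bound is enlarged so that \<open>\<epsilon> < Q\<close>, which places
    \<open>1 - \<epsilon>\<^sup>2 / Q\<^sup>2\<close> strictly between 0 and 1.\<close>
  define Q where "Q = max R (\<epsilon> + 1)"
  have Q: "\<epsilon> < Q" "0 < Q" using eps(1) by (auto simp: Q_def)
  have B_Q: "nrm ip (B x) \<le> Q * nrm ip x" if "x \<in> S" for x
  proof -
    have "R * nrm ip x \<le> Q * nrm ip x" using that by (intro mult_right_mono) (auto simp: Q_def)
    then show ?thesis using B_bound[OF that] by linarith
  qed
  \<comment> \<open>The minimiser of \<open>1 - 2 * t * \<epsilon> + t\<^sup>2 * Q\<^sup>2\<close>,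
    which bounds the square of the contraction factor; the minimum is
    \<open>r\<^sup>2\<close>.\<close>
  define t where "t = \<epsilon> / Q\<^sup>2"
  define r where "r = sqrt (1 - \<epsilon>\<^sup>2 / Q\<^sup>2)"
  have q: "\<epsilon>\<^sup>2 / Q\<^sup>2 < 1" "0 < \<epsilon>\<^sup>2 / Q\<^sup>2" using Q eps(1) by (simp_all add: power_strict_mono)
  have r: "0 \<le> r" "r < 1" "r\<^sup>2 = 1 - \<epsilon>\<^sup>2 / Q\<^sup>2" using q by (simp_all add: r_def)
  have t: "0 < t" using eps Q by (simp add: t_def)
  have Y_minus: "- x \<in> Y" if "x \<in> Y" for x using Y(4)[OF that, of "- 1"] by simp
  have Y_diff: "x - z \<in> Y" if "x \<in> Y" "z \<in> Y" for x z using Y(3)[OF that(1) Y_minus[OF that(2)]] by simp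
  have B_minus: "B (- x) = - B x" if "x \<in> S" for x using B_scale[OF that, of "- 1"] by simp
  have contr: "nrm ip (x - sc t (B x)) \<le> r * nrm ip x" if x: "x \<in> Y" for x
  proof (rule power2_le_imp_le)
    have xS: "x \<in> S" "B x \<in> S" using x Y(1) B_S by auto
    have "(nrm ip (x - sc t (B x)))\<^sup>2 = (nrm ip (x + sc (- t) (B x)))\<^sup>2" by simp
    also have "\<dots> = (nrm ip x)\<^sup>2 + 2 * Re (- t * ip x (B x)) + t\<^sup>2 * (nrm ip (B x))\<^sup>2"
      using xS by (subst nrm_add_sq) (auto simp: ip_scale_right nrm_scale power_mult_distrib simp del: scale_minus_left)
    also have "Re (- t * ip x (B x)) = - t * Re (ip (B x) x)" using ip_commute[OF xS] by simp
    also have "(nrm ip x)\<^sup>2 + 2 * (- t * Re (ip (B x) x)) + t\<^sup>2 * (nrm ip (B x))\<^sup>2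
      \<le> (nrm ip x)\<^sup>2 + 2 * (- t * (\<epsilon> * (nrm ip x)\<^sup>2)) + t\<^sup>2 * (Q * nrm ip x)\<^sup>2"
    proof -
      have "t * (\<epsilon> * (nrm ip x)\<^sup>2) \<le> t * Re (ip (B x) x)" using eps(2)[OF x] t by simp
      moreover have "t\<^sup>2 * (nrm ip (B x))\<^sup>2 \<le> t\<^sup>2 * (Q * nrm ip x)\<^sup>2"
        using B_Q[OF xS(1)] xS by (intro mult_left_mono power_mono) auto
      ultimately show ?thesis by linarith
    qed
    also have "\<dots> = r\<^sup>2 * (nrm ip x)\<^sup>2"
      using Q unfolding r(3) t_def by (simp add: field_simps power2_eq_square)
    finally show "(nrm ip (x - sc t (B x)))\<^sup>2 \<le> (r * nrm ip x)\<^sup>2" by (simp add: power_mult_distrib)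
    show "0 \<le> r * nrm ip x" using r xS by simp
  qed
  define s where "s = rec_nat 0 (\<lambda>_ u. u + sc t (y - B u))"
  have s0: "s 0 = 0" and sS: "\<And>n. s (Suc n) = s n + sc t (y - B (s n))" by (simp_all add: s_def)
  have sY: "s n \<in> Y" for n by (induction n) (auto simp: s0 sS Y y B_Y Y_diff)
  then have s_in: "s n \<in> S" for n using Y(1) by blast
  have yS: "y \<in> S" using y Y(1) by blast
  have dY: "y - B (s n) \<in> Y" for n using sY y B_Y Y_diff by blast
  have B0: "B 0 = 0" using B_scale[OF S_zero, of 0] by simp
  have dS: "y - B (s (Suc n)) = (y - B (s n)) - sc t (B (y - B (s n)))" for n
    using dY[of n] Y(1) s_in[of n] by (auto simp: sS B_add B_scale subset_iff)
  have dn: "nrm ip (y - B (s n)) \<le> nrm ip y * r ^ n" for n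
  proof (induction n)
    case (Suc n)
    have "nrm ip (y - B (s (Suc n))) \<le> r * nrm ip (y - B (s n))" unfolding dS by (rule contr[OF dY])
    also have "\<dots> \<le> r * (nrm ip y * r ^ n)" using Suc r by (intro mult_left_mono) auto
    finally show ?case by (simp add: mult_ac)
  qed (simp add: s0 B0)
  have "nrm ip (s (Suc n) - s n) \<le> (t * nrm ip y) * r ^ n" for n
    using dn[of n] t dY[of n] Y(1) by (auto simp: sS nrm_scale subset_iff mult.assoc)
  then have "\<exists>N. \<forall>p\<ge>N. \<forall>q\<ge>N. nrm ip (s p - s q) < e" if "0 < e" for e
    using geometric_cauchy[OF s_in _ r(1,2) _ that] t yS by (meson mult_nonneg_nonneg less_imp_le nrm_nonneg)
  \<comment> \<open>\<open>Y\<close> is not assumed closed, so the limit is only known to lie in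
    \<open>S\<close>. The sequence in \<open>Y\<close> is kept in the conclusion for later arguments
    by continuity.\<close>
  from complete[OF s_in this] obtain z where z: "z \<in> S" and lim: "(\<lambda>n. nrm ip (s n - z)) \<longlonglongrightarrow> 0" by blast
  have "B z = y"
  proof -
    have bound: "nrm ip (y - B z) \<le> nrm ip y * r ^ n + Q * nrm ip (s n - z)" for n
    proof -
      have "nrm ip (y - B z) \<le> nrm ip (y - B (s n)) + nrm ip (B (s n) - B z)"
        using yS z s_in B_S by (intro nrm_triangle_diff) auto
      also have "B (s n) - B z = B (s n - z)" using B_add[of "s n" "- z"] B_minus[OF z] s_in z by simp
      also have "nrm ip (B (s n - z)) \<le> Q * nrm ip (s n - z)" using B_Q s_in z by auto
      finally show ?thesis using dn[of n] by linarith
    qed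
    have "(\<lambda>n. nrm ip y * r ^ n + Q * nrm ip (s n - z)) \<longlonglongrightarrow> nrm ip y * 0 + Q * 0"
      using r lim by (intro tendsto_intros LIMSEQ_power_zero) auto
    then have "nrm ip (y - B z) \<le> nrm ip y * 0 + Q * 0"
      by (rule Lim_bounded2[where N = 0]) (use bound in auto)
    then have "nrm ip (y - B z) = 0" using nrm_nonneg[of "y - B z"] yS z B_S by fastforce
    then show ?thesis using nrm_eq_0[of "y - B z"] yS z B_S by simp
  qed
  then show ?thesis using z lim sY by blast
qed

end

section \<open>Finite powers of a Hilbert space\<close>

context pre_hilbert
begin

definition tsc :: "complex \<Rightarrow> (nat \<Rightarrow> 'a) \<Rightarrow> (nat \<Rightarrow> 'a)" where
  "tsc a \<xi> = (\<lambda>i. sc a (\<xi> i))"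

text \<open>Coordinates from \<open>m\<close> on are pinned to 0, which keeps \<open>tip m\<close>
  definite and lets pointwise addition of functions serve as the addition of tuples.\<close>

definition tup :: "nat \<Rightarrow> (nat \<Rightarrow> 'a) set" where
  "tup m = {\<xi>. \<forall>i. (i < m \<longrightarrow> \<xi> i \<in> S) \<and> (\<not> i < m \<longrightarrow> \<xi> i = 0)}"

definition tip :: "nat \<Rightarrow> (nat \<Rightarrow> 'a) \<Rightarrow> (nat \<Rightarrow> 'a) \<Rightarrow> complex" where
  "tip m \<xi> \<zeta> = (\<Sum>i<m. ip (\<xi> i) (\<zeta> i))"

lemma tup_nth: "\<xi> \<in> tup m \<Longrightarrow> \<xi> i \<in> S"
  by (cases "i < m") (auto simp: tup_def)

lemma tsc_vector_space: "vector_space tsc"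
  by standard (auto simp: tsc_def fun_eq_iff scale_right_distrib scale_left_distrib)

lemma tup_pre_hilbert: "pre_hilbert tsc (tup m) (tip m)"
proof -
  interpret T: vector_space tsc by (rule tsc_vector_space)
  show ?thesis
  proof
    fix \<xi> \<zeta> assume *: "\<xi> \<in> tup m" "\<zeta> \<in> tup m"
    show "tip m \<zeta> \<xi> = cnj (tip m \<xi> \<zeta>)"
      unfolding tip_def cnj_sum by (intro sum.cong refl ip_commute) (use * tup_nth in auto)
  next
    fix \<xi> assume *: "\<xi> \<in> tup m"
    show "0 \<le> Re (tip m \<xi> \<xi>)" using * by (auto simp: tip_def tup_nth intro!: sum_nonneg ip_nonneg)
    assume "Re (tip m \<xi> \<xi>) = 0"
    then have "\<And>i. i < m \<Longrightarrow> Re (ip (\<xi> i) (\<xi> i)) = 0"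
      using * by (simp add: tip_def sum_nonneg_eq_0_iff ip_nonneg tup_nth)
    then have "\<And>i. \<xi> i = 0" using * ip_definite unfolding tup_def by blast
    then show "\<xi> = 0" by (simp add: fun_eq_iff)
  next
    show "0 \<in> tup m" by (simp add: tup_def)
    fix \<xi> \<zeta> assume *: "\<xi> \<in> tup m" "\<zeta> \<in> tup m"
    then show "\<xi> + \<zeta> \<in> tup m" by (auto simp: tup_def)
    fix a show "tsc a \<xi> \<in> tup m" using * by (auto simp: tup_def tsc_def)
    show "tip m (tsc a \<xi>) \<zeta> = a * tip m \<xi> \<zeta>"
      using * by (simp add: tip_def tsc_def ip_scale tup_nth sum_distrib_left)
    fix \<chi> assume "\<chi> \<in> tup m"
    then show "tip m (\<xi> + \<zeta>) \<chi> = tip m \<xi> \<chi> + tip m \<zeta> \<chi>"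
      using * by (simp add: tip_def ip_add tup_nth sum.distrib)
  qed
qed

lemma tup_nrm_sq: "\<xi> \<in> tup m \<Longrightarrow> (nrm (tip m) \<xi>)\<^sup>2 = (\<Sum>i<m. (nrm ip (\<xi> i))\<^sup>2)"
proof -
  interpret T: pre_hilbert tsc "tup m" "tip m" by (rule tup_pre_hilbert)
  assume "\<xi> \<in> tup m"
  then show ?thesis by (simp add: T.nrm_sq) (simp add: nrm_sq tip_def tup_nth)
qed

lemma tup_nrm_ge: "\<xi> \<in> tup m \<Longrightarrow> nrm ip (\<xi> i) \<le> nrm (tip m) \<xi>"
proof (rule power2_le_imp_le)
  assume *: "\<xi> \<in> tup m"
  interpret T: pre_hilbert tsc "tup m" "tip m" by (rule tup_pre_hilbert)
  show "0 \<le> nrm (tip m) \<xi>" using * by (rule T.nrm_nonneg)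
  show "(nrm ip (\<xi> i))\<^sup>2 \<le> (nrm (tip m) \<xi>)\<^sup>2"
  proof (cases "i < m")
    case True
    then show ?thesis using * unfolding tup_nrm_sq[OF *] by (intro member_le_sum) (auto simp: tup_nth)
  next
    case False
    then show ?thesis using * by (simp add: tup_def)
  qed
qed

end

lemma (in hilbert) tup_hilbert: "hilbert tsc (tup m) (tip m)"
proof -
  interpret T: pre_hilbert tsc "tup m" "tip m" by (rule tup_pre_hilbert)
  show ?thesis
  proof
    fix s :: "nat \<Rightarrow> nat \<Rightarrow> 'a"
    assume s: "\<And>n. s n \<in> tup m" and ca: "\<And>e. 0 < e \<Longrightarrow> \<exists>N. \<forall>p\<ge>N. \<forall>q\<ge>N. nrm (tip m) (s p - s q) < e"
    have "\<exists>l\<in>S. (\<lambda>n. nrm ip (s n i - l)) \<longlonglongrightarrow> 0" for i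
    proof (rule complete)
      fix e :: real assume "0 < e"
      then obtain N where N: "\<forall>p\<ge>N. \<forall>q\<ge>N. nrm (tip m) (s p - s q) < e" using ca by blast
      have "nrm ip (s p i - s q i) < e" if "p \<ge> N" "q \<ge> N" for p q
        using tup_nrm_ge[OF T.S_diff[OF s[of p] s[of q]], of i] N that by fastforce
      then show "\<exists>N. \<forall>p\<ge>N. \<forall>q\<ge>N. nrm ip (s p i - s q i) < e" by blast
    qed (use s tup_nth in auto)
    then obtain l where l: "\<And>i. l i \<in> S" "\<And>i. (\<lambda>n. nrm ip (s n i - l i)) \<longlonglongrightarrow> 0" by metis
    define l' where "l' i = (if i < m then l i else 0)" for i
    have l': "l' \<in> tup m" using l by (auto simp: tup_def l'_def)
    have "(\<lambda>n. sqrt (\<Sum>i<m. (nrm ip ((s n - l') i))\<^sup>2)) \<longlonglongrightarrow> sqrt (\<Sum>i<m. 0\<^sup>2)"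
      by (intro tendsto_intros) (use l(2) in \<open>auto simp: l'_def\<close>)
    moreover have "sqrt (\<Sum>i<m. (nrm ip ((s n - l') i))\<^sup>2) = nrm (tip m) (s n - l')" for n
      unfolding tup_nrm_sq[OF T.S_diff[OF s l'], symmetric]
      using T.nrm_nonneg[OF T.S_diff[OF s[of n] l']] by simp
    ultimately show "\<exists>l\<in>tup m. (\<lambda>n. nrm (tip m) (s n - l)) \<longlonglongrightarrow> 0" using l' by auto
  qed
qed

section \<open>Comparison of free resolutions\<close>

interpretation fld: vector_space "(*) :: 'k::field \<Rightarrow> 'k \<Rightarrow> 'k"
  by standard (auto simp: algebra_simps)

text \<open>The augmentation of degree 0 chains onto the trivial module.\<close>

definition csum :: "('x \<Rightarrow>\<^sub>0 rat) \<Rightarrow> rat" where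
  "csum = lin (*) (\<lambda>_. 1)"

definition gact :: "('g \<Rightarrow> 'x \<Rightarrow> 'x) \<Rightarrow> 'g \<Rightarrow> ('x \<Rightarrow>\<^sub>0 rat) \<Rightarrow> ('x \<Rightarrow>\<^sub>0 rat)" where
  "gact act g = lin psc (\<lambda>x. Poly_Mapping.single (act g x) 1)"

text \<open>A free module over the rational group ring is given by a free action on the set \<open>X k\<close> of its
  rational basis elements; every \<open>x\<close> is the translate by \<open>gam x\<close> of its orbit representative
  \<open>tau x\<close>.\<close>

locale free_resolution =
  fixes act :: "'g::group_add \<Rightarrow> 'x \<Rightarrow> 'x" and X :: "nat \<Rightarrow> 'x set"
    and bd :: "nat \<Rightarrow> 'x \<Rightarrow> ('x \<Rightarrow>\<^sub>0 rat)" and gam :: "'x \<Rightarrow> 'g" and tau :: "'x \<Rightarrow> 'x"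
  assumes act_add: "act (g + h) x = act g (act h x)"
    and act_X: "x \<in> X k \<Longrightarrow> act g x \<in> X k"
    and tau_X: "x \<in> X k \<Longrightarrow> tau x \<in> X k"
    and act_gam_tau: "x \<in> X k \<Longrightarrow> act (gam x) (tau x) = x"
    and gam_act: "x \<in> X k \<Longrightarrow> gam (act g x) = g + gam x"
    and tau_act: "x \<in> X k \<Longrightarrow> tau (act g x) = tau x"
    and nonempty: "X 0 \<noteq> {}"
    and bd_X: "x \<in> X (Suc k) \<Longrightarrow> Poly_Mapping.keys (bd (Suc k) x) \<subseteq> X k"
    and bd_act: "x \<in> X (Suc k) \<Longrightarrow> bd (Suc k) (act g x) = gact act g (bd (Suc k) x)"
    and bd_bd: "x \<in> X (Suc (Suc k)) \<Longrightarrow> lin psc (bd (Suc k)) (bd (Suc (Suc k)) x) = 0"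
    and csum_bd: "x \<in> X 1 \<Longrightarrow> csum (bd 1 x) = 0"
    and exact: "Poly_Mapping.keys p \<subseteq> X (Suc k) \<Longrightarrow> lin psc (bd (Suc k)) p = 0 \<Longrightarrow>
      \<exists>q. Poly_Mapping.keys q \<subseteq> X (Suc (Suc k)) \<and> lin psc (bd (Suc (Suc k))) q = p"
    and exact_0: "Poly_Mapping.keys p \<subseteq> X 0 \<Longrightarrow> csum p = 0 \<Longrightarrow>
      \<exists>q. Poly_Mapping.keys q \<subseteq> X 1 \<and> lin psc (bd 1) q = p"


lemma lin_gact: "vector_space sc \<Longrightarrow> lin sc s (gact act g p) = lin sc (\<lambda>x. s (act g x)) p"
  by (simp add: gact_def vector_space.lin_lin vector_space.lin_single vector_space_def module.scale_one)

lemma lin_equivariant: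
  assumes "Poly_Mapping.keys p \<subseteq> X" "\<And>x. x \<in> X \<Longrightarrow> s (act g x) = gact act' g (s x)"
  shows "lin psc s (gact act g p) = gact act' g (lin psc s p)"
proof -
  have "lin psc s (gact act g p) = lin psc (\<lambda>x. s (act g x)) p"
    by (rule lin_gact) (rule psc.vector_space_axioms)
  also have "\<dots> = lin psc (\<lambda>x. gact act' g (s x)) p"
    by (rule psc.lin_cong) (use assms in auto)
  finally show ?thesis by (simp add: gact_def psc.lin_lin)
qed

lemma gact_add: "gact act g (p + q) = gact act g p + gact act g q"
  and gact_diff: "gact act g (p - q) = gact act g p - gact act g q"
  and gact_single: "gact act g (Poly_Mapping.single x r) = Poly_Mapping.single (act g x) r"
  by (simp_all add: gact_def psc.lin_add psc.lin_diff)

lemma csum_diff: "csum (p - q) = csum p - csum q"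
  and csum_single: "csum (Poly_Mapping.single x r) = r"
  by (simp_all add: csum_def fld.lin_diff)

lemma csum_lin: "csum (lin psc s p) = lin (*) (\<lambda>x. csum (s x)) p"
  by (simp add: csum_def fld.lin_lin)

text \<open>The normalisation by \<open>csum\<close> in degree 0 says that the map covers the
  identity of the trivial module; this is what makes two such maps homotopic.\<close>

definition chain_map ::
  "('g \<Rightarrow> 'x \<Rightarrow> 'x) \<Rightarrow> (nat \<Rightarrow> 'x set) \<Rightarrow> (nat \<Rightarrow> 'x \<Rightarrow> ('x \<Rightarrow>\<^sub>0 rat)) \<Rightarrow>
   ('g \<Rightarrow> 'y \<Rightarrow> 'y) \<Rightarrow> (nat \<Rightarrow> 'y set) \<Rightarrow> (nat \<Rightarrow> 'y \<Rightarrow> ('y \<Rightarrow>\<^sub>0 rat)) \<Rightarrow>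
   (nat \<Rightarrow> 'x \<Rightarrow> ('y \<Rightarrow>\<^sub>0 rat)) \<Rightarrow> bool" where
  "chain_map act X bd act' X' bd' f \<longleftrightarrow>
     (\<forall>k. \<forall>x\<in>X k. Poly_Mapping.keys (f k x) \<subseteq> X' k \<and> (\<forall>g. f k (act g x) = gact act' g (f k x))) \<and>
     (\<forall>x\<in>X 0. csum (f 0 x) = 1) \<and>
     (\<forall>k. \<forall>x\<in>X (Suc k). lin psc (bd' (Suc k)) (f (Suc k) x) = lin psc (f k) (bd (Suc k) x))"

section \<open>Comparison maps and homotopies\<close>

locale two_resolutions = A: free_resolution act X bd gam tau + C: free_resolution act' X' bd' gam' tau'
  for act :: "'g::group_add \<Rightarrow> 'x \<Rightarrow> 'x" and X bd gam tau
    and act' :: "'g::group_add \<Rightarrow> 'y \<Rightarrow> 'y" and X' bd' gam' tau'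
begin

text \<open>Freeness turns pointwise solutions into an equivariant one: a solution is chosen at the
  orbit representative \<open>tau x\<close> only and translated by \<open>gam x\<close>.\<close>

lemma lift:
  assumes u: "\<And>x g. x \<in> X k \<Longrightarrow> u (act g x) = gact act' g (u x)"
    and solv: "\<And>x. x \<in> X k \<Longrightarrow>
      \<exists>q. Poly_Mapping.keys q \<subseteq> X' (Suc l) \<and> lin psc (bd' (Suc l)) q = u x"
  shows "\<exists>h. \<forall>x\<in>X k. Poly_Mapping.keys (h x) \<subseteq> X' (Suc l) \<and>
    lin psc (bd' (Suc l)) (h x) = u x \<and> (\<forall>g. h (act g x) = gact act' g (h x))"
proof -
  obtain h0 where h0: "\<And>x. x \<in> X k \<Longrightarrow> Poly_Mapping.keys (h0 x) \<subseteq> X' (Suc l) \<and> lin psc (bd' (Suc l)) (h0 x) = u x"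
    using solv by metis
  define h where "h x = gact act' (gam x) (h0 (tau x))" for x
  have "Poly_Mapping.keys (h x) \<subseteq> X' (Suc l)" if "x \<in> X k" for x
    unfolding h_def gact_def
    by (rule chain_lin[where X = "X' (Suc l)"]) (use h0 A.tau_X that C.act_X in auto)
  moreover have "lin psc (bd' (Suc l)) (h x) = u x" if x: "x \<in> X k" for x
  proof -
    have "lin psc (bd' (Suc l)) (h x) = gact act' (gam x) (lin psc (bd' (Suc l)) (h0 (tau x)))"
      unfolding h_def
      by (rule lin_equivariant[where X = "X' (Suc l)"]) (use h0[OF A.tau_X[OF x]] C.bd_act in blast)+
    also have "\<dots> = u x" using h0 A.tau_X[OF x] u[OF A.tau_X[OF x]] A.act_gam_tau[OF x] by metis
    finally show ?thesis .
  qed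
  moreover have "h (act g x) = gact act' g (h x)" if x: "x \<in> X k" for x g
  proof -
    have "gact act' (g + gam x) p = gact act' g (gact act' (gam x) p)" for p
      by (simp add: gact_def psc.lin_lin C.act_add)
    then show ?thesis by (simp add: h_def A.gam_act[OF x] A.tau_act[OF x])
  qed
  ultimately show ?thesis by blast
qed

lemma chain_map_exists: "\<exists>f. chain_map act X bd act' X' bd' f"
proof -
  \<comment> \<open>The last clause, solvability in the next degree, is the hypothesis that
    dependent choice hands on from degree to degree.\<close>
  define P where "P k f \<longleftrightarrow>
     (\<forall>x\<in>X k. Poly_Mapping.keys (f x) \<subseteq> X' k \<and> (\<forall>g. f (act g x) = gact act' g (f x))) \<and>
     (k = 0 \<longrightarrow> (\<forall>x\<in>X k. csum (f x) = 1)) \<and>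
     (\<forall>x\<in>X (Suc k). \<exists>q. Poly_Mapping.keys q \<subseteq> X' (Suc k) \<and>
        lin psc (bd' (Suc k)) q = lin psc f (bd (Suc k) x))" for k f
  have "\<exists>f. \<forall>k. P k (f k) \<and>
      (\<forall>x\<in>X (Suc k). lin psc (bd' (Suc k)) (f (Suc k) x) = lin psc (f k) (bd (Suc k) x))"
  proof (rule dependent_nat_choice)
    obtain y where y: "y \<in> X' 0" using C.nonempty by auto
    \<comment> \<open>All orbits are sent to the orbit of the single element \<open>y\<close>; only
      the translate \<open>gam x\<close> is remembered, so equivariance comes from
      \<open>gam_act\<close>.\<close>
    define f where "f x = Poly_Mapping.single (act' (gam x) y) (1::rat)" for x
    have f1: "csum (f x) = 1" for x by (simp add: f_def csum_single)
    have "\<exists>q. Poly_Mapping.keys q \<subseteq> X' 1 \<and> lin psc (bd' 1) q = lin psc f (bd 1 x)" if x: "x \<in> X 1" for x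
    proof (rule C.exact_0)
      show "Poly_Mapping.keys (lin psc f (bd 1 x)) \<subseteq> X' 0"
        using C.act_X[OF y] by (intro chain_lin[OF order_refl]) (auto simp: f_def)
      show "csum (lin psc f (bd 1 x)) = 0"
        using A.csum_bd[OF x] by (simp add: csum_lin f1) (simp add: csum_def)
    qed
    moreover have "Poly_Mapping.keys (f x) \<subseteq> X' 0" "f (act g x) = gact act' g (f x)" if "x \<in> X 0" for x g
      using C.act_X[OF y] A.gam_act[OF that] by (auto simp: f_def gact_single C.act_add)
    ultimately have "P 0 f" using f1 unfolding P_def One_nat_def by blast
    then show "\<exists>f. P 0 f" by blast
  next
    fix f k assume Pk: "P k f"
    have eq: "lin psc f (bd (Suc k) (act g x)) = gact act' g (lin psc f (bd (Suc k) x))" if x: "x \<in> X (Suc k)" for g x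
      unfolding A.bd_act[OF x]
      by (rule lin_equivariant[OF A.bd_X[OF x]]) (use Pk in \<open>auto simp: P_def\<close>)
    have "\<exists>f'. \<forall>x\<in>X (Suc k). Poly_Mapping.keys (f' x) \<subseteq> X' (Suc k) \<and>
        lin psc (bd' (Suc k)) (f' x) = lin psc f (bd (Suc k) x) \<and> (\<forall>g. f' (act g x) = gact act' g (f' x))"
      by (rule lift) (use eq Pk in \<open>auto simp: P_def\<close>)
    then obtain f' where f': "\<And>x. x \<in> X (Suc k) \<Longrightarrow> Poly_Mapping.keys (f' x) \<subseteq> X' (Suc k)"
        "\<And>x. x \<in> X (Suc k) \<Longrightarrow> lin psc (bd' (Suc k)) (f' x) = lin psc f (bd (Suc k) x)"
        "\<And>x g. x \<in> X (Suc k) \<Longrightarrow> f' (act g x) = gact act' g (f' x)" by blast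
    have "\<exists>q. Poly_Mapping.keys q \<subseteq> X' (Suc (Suc k)) \<and>
        lin psc (bd' (Suc (Suc k))) q = lin psc f' (bd (Suc (Suc k)) x)" if x: "x \<in> X (Suc (Suc k))" for x
    proof (rule C.exact)
      show "Poly_Mapping.keys (lin psc f' (bd (Suc (Suc k)) x)) \<subseteq> X' (Suc k)"
        by (rule chain_lin[OF A.bd_X[OF x] f'(1)])
      have "lin psc (bd' (Suc k)) (lin psc f' (bd (Suc (Suc k)) x))
          = lin psc (\<lambda>y. lin psc f (bd (Suc k) y)) (bd (Suc (Suc k)) x)"
        unfolding psc.lin_lin by (rule psc.lin_cong) (use f'(2) A.bd_X[OF x] in auto)
      also have "\<dots> = 0" using A.bd_bd[OF x] by (simp flip: psc.lin_lin)
      finally show "lin psc (bd' (Suc k)) (lin psc f' (bd (Suc (Suc k)) x)) = 0" .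
    qed
    then have "P (Suc k) f'" using f' unfolding P_def by blast
    then show "\<exists>f'. P (Suc k) f' \<and>
        (\<forall>x\<in>X (Suc k). lin psc (bd' (Suc k)) (f' x) = lin psc f (bd (Suc k) x))"
      using f'(2) by blast
  qed
  then show ?thesis
  proof (rule ex_forward)
    fix f assume "\<forall>k. P k (f k) \<and>
      (\<forall>x\<in>X (Suc k). lin psc (bd' (Suc k)) (f (Suc k) x) = lin psc (f k) (bd (Suc k) x))"
    then have "\<And>k. P k (f k)" "\<And>k x. x \<in> X (Suc k) \<Longrightarrow>
        lin psc (bd' (Suc k)) (f (Suc k) x) = lin psc (f k) (bd (Suc k) x)" by simp_all
    then show "chain_map act X bd act' X' bd' f" unfolding P_def chain_map_def by simp
  qed
qed

lemma homotopy_exists: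
  assumes f: "chain_map act X bd act' X' bd' f" and f': "chain_map act X bd act' X' bd' f'"
  shows "\<exists>h. \<forall>k. (\<forall>x\<in>X k. Poly_Mapping.keys (h k x) \<subseteq> X' (Suc k) \<and>
         (\<forall>g. h k (act g x) = gact act' g (h k x))) \<and>
      (\<forall>x\<in>X (Suc k). lin psc (bd' (Suc (Suc k))) (h (Suc k) x) =
         f (Suc k) x - f' (Suc k) x - lin psc (h k) (bd (Suc k) x))"
proof -
  have fc: "\<And>k x. x \<in> X k \<Longrightarrow> Poly_Mapping.keys (f k x) \<subseteq> X' k"
      "\<And>k x g. x \<in> X k \<Longrightarrow> f k (act g x) = gact act' g (f k x)"
      "\<And>x. x \<in> X 0 \<Longrightarrow> csum (f 0 x) = 1"
      "\<And>k x. x \<in> X (Suc k) \<Longrightarrow> lin psc (bd' (Suc k)) (f (Suc k) x) = lin psc (f k) (bd (Suc k) x)"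
    using f unfolding chain_map_def by blast+
  have fc': "\<And>k x. x \<in> X k \<Longrightarrow> Poly_Mapping.keys (f' k x) \<subseteq> X' k"
      "\<And>k x g. x \<in> X k \<Longrightarrow> f' k (act g x) = gact act' g (f' k x)"
      "\<And>x. x \<in> X 0 \<Longrightarrow> csum (f' 0 x) = 1"
      "\<And>k x. x \<in> X (Suc k) \<Longrightarrow> lin psc (bd' (Suc k)) (f' (Suc k) x) = lin psc (f' k) (bd (Suc k) x)"
    using f' unfolding chain_map_def by blast+
  have keys_diff: "Poly_Mapping.keys (p - q) \<subseteq> Z" if "Poly_Mapping.keys p \<subseteq> Z" "Poly_Mapping.keys q \<subseteq> Z"
    for p q :: "'y \<Rightarrow>\<^sub>0 rat" and Z
    using that by (auto simp: in_keys_iff lookup_minus subset_iff) (metis diff_zero)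
  define P where "P k h \<longleftrightarrow>
     (\<forall>x\<in>X k. Poly_Mapping.keys (h x) \<subseteq> X' (Suc k) \<and> (\<forall>g. h (act g x) = gact act' g (h x))) \<and>
     (\<forall>x\<in>X (Suc k). \<exists>q. Poly_Mapping.keys q \<subseteq> X' (Suc (Suc k)) \<and>
        lin psc (bd' (Suc (Suc k))) q = f (Suc k) x - f' (Suc k) x - lin psc h (bd (Suc k) x))" for k h
  \<comment> \<open>\<open>r\<close> stands for the previous homotopy composed with the boundary.
    With \<open>r = 0\<close> the same computation covers the start of the induction.\<close>
  have next_solv: "\<exists>q. Poly_Mapping.keys q \<subseteq> X' (Suc (Suc k)) \<and>
        lin psc (bd' (Suc (Suc k))) q = f (Suc k) x - f' (Suc k) x - lin psc h (bd (Suc k) x)"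
    if x: "x \<in> X (Suc k)" and hk: "\<And>y. y \<in> X k \<Longrightarrow> Poly_Mapping.keys (h y) \<subseteq> X' (Suc k)"
      and hd: "\<And>y. y \<in> X k \<Longrightarrow> lin psc (bd' (Suc k)) (h y) = f k y - f' k y - r y"
      and r: "lin psc r (bd (Suc k) x) = 0" for k x h r
  proof (rule C.exact)
    show "Poly_Mapping.keys (f (Suc k) x - f' (Suc k) x - lin psc h (bd (Suc k) x)) \<subseteq> X' (Suc k)"
      by (intro keys_diff fc(1)[OF x] fc'(1)[OF x] chain_lin[OF A.bd_X[OF x] hk])
    have "lin psc (bd' (Suc k)) (lin psc h (bd (Suc k) x)) = lin psc (\<lambda>y. f k y - f' k y - r y) (bd (Suc k) x)"
      unfolding psc.lin_lin by (rule psc.lin_cong) (use hd A.bd_X[OF x] in auto)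
    also have "\<dots> = lin psc (f k) (bd (Suc k) x) - lin psc (f' k) (bd (Suc k) x)"
      by (simp add: psc.lin_fun_diff r)
    finally show "lin psc (bd' (Suc k)) (f (Suc k) x - f' (Suc k) x - lin psc h (bd (Suc k) x)) = 0"
      by (simp add: psc.lin_diff fc(4)[OF x] fc'(4)[OF x])
  qed
  have "\<exists>h. \<forall>k. P k (h k) \<and> (\<forall>x\<in>X (Suc k). lin psc (bd' (Suc (Suc k))) (h (Suc k) x) =
         f (Suc k) x - f' (Suc k) x - lin psc (h k) (bd (Suc k) x))"
  proof (rule dependent_nat_choice)
    have "\<exists>h. \<forall>x\<in>X 0. Poly_Mapping.keys (h x) \<subseteq> X' (Suc 0) \<and>
        lin psc (bd' (Suc 0)) (h x) = f 0 x - f' 0 x \<and> (\<forall>g. h (act g x) = gact act' g (h x))"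
    proof (rule lift)
      fix x g assume x: "x \<in> X 0"
      show "f 0 (act g x) - f' 0 (act g x) = gact act' g (f 0 x - f' 0 x)"
        by (simp add: gact_diff fc(2)[OF x] fc'(2)[OF x])
      show "\<exists>q. Poly_Mapping.keys q \<subseteq> X' (Suc 0) \<and> lin psc (bd' (Suc 0)) q = f 0 x - f' 0 x"
        using C.exact_0[OF keys_diff[OF fc(1)[OF x] fc'(1)[OF x]]]
        by (simp add: csum_diff fc(3)[OF x] fc'(3)[OF x])
    qed
    then obtain h where h: "\<And>x. x \<in> X 0 \<Longrightarrow> Poly_Mapping.keys (h x) \<subseteq> X' (Suc 0)"
        "\<And>x. x \<in> X 0 \<Longrightarrow> lin psc (bd' (Suc 0)) (h x) = f 0 x - f' 0 x - 0"
        "\<And>x g. x \<in> X 0 \<Longrightarrow> h (act g x) = gact act' g (h x)" by (metis diff_zero)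
    have "P 0 h" unfolding P_def using h next_solv[OF _ h(1,2)] psc.lin_fun_zero by blast
    then show "\<exists>h. P 0 h" by blast
  next
    fix h k assume Pk: "P k h"
    have "\<exists>h'. \<forall>x\<in>X (Suc k). Poly_Mapping.keys (h' x) \<subseteq> X' (Suc (Suc k)) \<and>
        lin psc (bd' (Suc (Suc k))) (h' x) = f (Suc k) x - f' (Suc k) x - lin psc h (bd (Suc k) x) \<and>
        (\<forall>g. h' (act g x) = gact act' g (h' x))"
    proof (rule lift)
      fix x g assume x: "x \<in> X (Suc k)"
      have "lin psc h (bd (Suc k) (act g x)) = gact act' g (lin psc h (bd (Suc k) x))"
        unfolding A.bd_act[OF x]
        by (rule lin_equivariant[OF A.bd_X[OF x]]) (use Pk in \<open>auto simp: P_def\<close>)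
      then show "f (Suc k) (act g x) - f' (Suc k) (act g x) - lin psc h (bd (Suc k) (act g x))
          = gact act' g (f (Suc k) x - f' (Suc k) x - lin psc h (bd (Suc k) x))"
        by (simp add: gact_diff fc(2)[OF x] fc'(2)[OF x])
      show "\<exists>q. Poly_Mapping.keys q \<subseteq> X' (Suc (Suc k)) \<and>
        lin psc (bd' (Suc (Suc k))) q = f (Suc k) x - f' (Suc k) x - lin psc h (bd (Suc k) x)"
        using Pk x by (auto simp: P_def)
    qed
    then obtain h' where h': "\<And>x. x \<in> X (Suc k) \<Longrightarrow> Poly_Mapping.keys (h' x) \<subseteq> X' (Suc (Suc k))"
        "\<And>x. x \<in> X (Suc k) \<Longrightarrow> lin psc (bd' (Suc (Suc k))) (h' x) =
           f (Suc k) x - f' (Suc k) x - lin psc h (bd (Suc k) x)"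
        "\<And>x g. x \<in> X (Suc k) \<Longrightarrow> h' (act g x) = gact act' g (h' x)" by blast
    have "lin psc (\<lambda>y. lin psc h (bd (Suc k) y)) (bd (Suc (Suc k)) x) = 0" if "x \<in> X (Suc (Suc k))" for x
      using A.bd_bd[OF that] by (simp flip: psc.lin_lin)
    then have "P (Suc k) h'" unfolding P_def using h' next_solv[OF _ h'(1,2)] by blast
    then show "\<exists>h'. P (Suc k) h' \<and> (\<forall>x\<in>X (Suc k). lin psc (bd' (Suc (Suc k))) (h' x) =
         f (Suc k) x - f' (Suc k) x - lin psc h (bd (Suc k) x))" using h'(2) by blast
  qed
  then show ?thesis
  proof (rule ex_forward)
    fix h assume h: "\<forall>k. P k (h k) \<and> (\<forall>x\<in>X (Suc k). lin psc (bd' (Suc (Suc k))) (h (Suc k) x) =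
         f (Suc k) x - f' (Suc k) x - lin psc (h k) (bd (Suc k) x))"
    show "\<forall>k. (\<forall>x\<in>X k. Poly_Mapping.keys (h k x) \<subseteq> X' (Suc k) \<and>
         (\<forall>g. h k (act g x) = gact act' g (h k x))) \<and>
      (\<forall>x\<in>X (Suc k). lin psc (bd' (Suc (Suc k))) (h (Suc k) x) =
         f (Suc k) x - f' (Suc k) x - lin psc (h k) (bd (Suc k) x))"
      using h unfolding P_def by simp
  qed
qed

end

section \<open>Equivariant cochains and independence of the resolution\<close>

locale coefficients = vector_space sc for sc :: "rat \<Rightarrow> 'a::ab_group_add \<Rightarrow> 'a" +
  fixes S :: "'a set" and rep :: "'g::group_add \<Rightarrow> 'a \<Rightarrow> 'a"
  assumes S_zero: "0 \<in> S" and S_add: "x \<in> S \<Longrightarrow> y \<in> S \<Longrightarrow> x + y \<in> S" and S_scale: "x \<in> S \<Longrightarrow> sc r x \<in> S"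
    and rep_S: "x \<in> S \<Longrightarrow> rep g x \<in> S"
    and rep_add: "x \<in> S \<Longrightarrow> y \<in> S \<Longrightarrow> rep g (x + y) = rep g x + rep g y"
    and rep_scale: "x \<in> S \<Longrightarrow> rep g (sc r x) = sc r (rep g x)"
begin

definition cochain_on :: "('g \<Rightarrow> 'x \<Rightarrow> 'x) \<Rightarrow> 'x set \<Rightarrow> ('x \<Rightarrow> 'a) \<Rightarrow> bool" where
  "cochain_on act X c \<longleftrightarrow> (\<forall>x\<in>X. c x \<in> S \<and> (\<forall>g. c (act g x) = rep g (c x)))"

text \<open>The index is shifted: \<open>k\<close> refers to cohomology in degree
  \<open>Suc k\<close>, so that exactly the positive degrees occur.\<close>

definition vanishes ::
  "('g \<Rightarrow> 'x \<Rightarrow> 'x) \<Rightarrow> (nat \<Rightarrow> 'x set) \<Rightarrow> (nat \<Rightarrow> 'x \<Rightarrow> ('x \<Rightarrow>\<^sub>0 rat)) \<Rightarrow> nat \<Rightarrow> bool" where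
  "vanishes act X bd k \<longleftrightarrow> (\<forall>c. cochain_on act (X (Suc k)) c \<and>
      (\<forall>x\<in>X (Suc (Suc k)). lin sc c (bd (Suc (Suc k)) x) = 0) \<longrightarrow>
      (\<exists>b. cochain_on act (X k) b \<and> (\<forall>x\<in>X (Suc k). c x = lin sc b (bd (Suc k) x))))"

lemma lin_S: "(\<And>x. x \<in> Poly_Mapping.keys p \<Longrightarrow> c x \<in> S) \<Longrightarrow> lin sc c p \<in> S"
  by (rule lin_mem) (use S_zero S_add S_scale in auto)

lemma S_minus: "x \<in> S \<Longrightarrow> - x \<in> S"
  using S_scale[of x "- 1"] by simp

lemma S_diff: "x \<in> S \<Longrightarrow> y \<in> S \<Longrightarrow> x - y \<in> S"
  using S_add[of x "- y"] S_minus[of y] by simp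

lemma rep_zero: "rep g 0 = 0"
  using rep_add[OF S_zero S_zero, of g] by simp

lemma rep_lin:
  assumes "\<And>x. x \<in> Poly_Mapping.keys p \<Longrightarrow> c x \<in> S"
  shows "rep g (lin sc c p) = lin sc (\<lambda>x. rep g (c x)) p"
proof -
  have "rep g (\<Sum>x\<in>A. sc (Poly_Mapping.lookup p x) (c x)) = (\<Sum>x\<in>A. sc (Poly_Mapping.lookup p x) (rep g (c x)))
      \<and> (\<Sum>x\<in>A. sc (Poly_Mapping.lookup p x) (c x)) \<in> S"
    if "finite A" "A \<subseteq> Poly_Mapping.keys p" for A
    using that by (induction A) (use assms S_zero S_add S_scale rep_add rep_scale rep_zero in auto)
  then show ?thesis by (simp add: lin_def)
qed

lemma rep_diff: "x \<in> S \<Longrightarrow> y \<in> S \<Longrightarrow> rep g (x - y) = rep g x - rep g y"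
  using rep_add[of "x - y" y g] S_diff[of x y] by (simp add: algebra_simps)

lemma cochain_lin_act:
  assumes "cochain_on act X c" "Poly_Mapping.keys p \<subseteq> X"
  shows "lin sc c (gact act g p) = rep g (lin sc c p)"
proof -
  have "lin sc c (gact act g p) = lin sc (\<lambda>x. c (act g x)) p"
    by (rule lin_gact) (rule vector_space_axioms)
  also have "\<dots> = lin sc (\<lambda>x. rep g (c x)) p"
    by (rule lin_cong) (use assms in \<open>auto simp: cochain_on_def\<close>)
  also have "\<dots> = rep g (lin sc c p)"
    by (rule rep_lin[symmetric]) (use assms in \<open>auto simp: cochain_on_def\<close>)
  finally show ?thesis .
qed

lemma cochain_lin:
  assumes "cochain_on act' X' c" "\<And>x. x \<in> X \<Longrightarrow> Poly_Mapping.keys (f x) \<subseteq> X'"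
    "\<And>x g. x \<in> X \<Longrightarrow> f (act g x) = gact act' g (f x)"
  shows "cochain_on act X (\<lambda>x. lin sc c (f x))"
  unfolding cochain_on_def
proof (intro ballI conjI allI)
  fix x g assume x: "x \<in> X"
  show "lin sc c (f x) \<in> S" by (rule lin_S) (use assms x in \<open>auto simp: cochain_on_def\<close>)
  show "lin sc c (f (act g x)) = rep g (lin sc c (f x))"
    unfolding assms(3)[OF x] by (rule cochain_lin_act[OF assms(1) assms(2)[OF x]])
qed

text \<open>The cocycle is pulled back along a comparison map \<alpha>, integrated there, and the
  primitive is pulled back along a map \<beta> in the other direction. This integrates the pullback
  of the cocycle along \<alpha>\<beta>; a homotopy from \<alpha>\<beta> to the identity corrects the
  difference.\<close>

theorem vanishes_transfer:
  assumes A: "free_resolution act X bd gam tau" and C: "free_resolution act' X' bd' gam' tau'"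
    and van: "vanishes act X bd k"
  shows "vanishes act' X' bd' k"
  unfolding vanishes_def
proof (intro allI impI, elim conjE)
  interpret A: free_resolution act X bd gam tau by fact
  interpret C: free_resolution act' X' bd' gam' tau' by fact
  interpret AC: two_resolutions act X bd gam tau act' X' bd' gam' tau' ..
  interpret CA: two_resolutions act' X' bd' gam' tau' act X bd gam tau ..
  interpret CC: two_resolutions act' X' bd' gam' tau' act' X' bd' gam' tau' ..
  fix c assume c: "cochain_on act' (X' (Suc k)) c"
    and cc: "\<forall>x\<in>X' (Suc (Suc k)). lin sc c (bd' (Suc (Suc k)) x) = 0"
  obtain \<alpha> where "chain_map act X bd act' X' bd' \<alpha>" using AC.chain_map_exists by blast
  then have \<alpha>: "\<And>k x. x \<in> X k \<Longrightarrow> Poly_Mapping.keys (\<alpha> k x) \<subseteq> X' k"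
      "\<And>k x g. x \<in> X k \<Longrightarrow> \<alpha> k (act g x) = gact act' g (\<alpha> k x)"
      "\<And>x. x \<in> X 0 \<Longrightarrow> csum (\<alpha> 0 x) = 1"
      "\<And>k x. x \<in> X (Suc k) \<Longrightarrow> lin psc (bd' (Suc k)) (\<alpha> (Suc k) x) = lin psc (\<alpha> k) (bd (Suc k) x)"
    unfolding chain_map_def by blast+
  obtain \<beta> where "chain_map act' X' bd' act X bd \<beta>" using CA.chain_map_exists by blast
  then have \<beta>: "\<And>k x. x \<in> X' k \<Longrightarrow> Poly_Mapping.keys (\<beta> k x) \<subseteq> X k"
      "\<And>k x g. x \<in> X' k \<Longrightarrow> \<beta> k (act' g x) = gact act g (\<beta> k x)"
      "\<And>x. x \<in> X' 0 \<Longrightarrow> csum (\<beta> 0 x) = 1"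
      "\<And>k x. x \<in> X' (Suc k) \<Longrightarrow> lin psc (bd (Suc k)) (\<beta> (Suc k) x) = lin psc (\<beta> k) (bd' (Suc k) x)"
    unfolding chain_map_def by blast+
  have comp: "chain_map act' X' bd' act' X' bd' (\<lambda>k x. lin psc (\<alpha> k) (\<beta> k x))"
    unfolding chain_map_def
  proof (intro conjI allI ballI)
    fix k x g assume x: "x \<in> X' k"
    show "Poly_Mapping.keys (lin psc (\<alpha> k) (\<beta> k x)) \<subseteq> X' k" by (rule chain_lin[OF \<beta>(1)[OF x] \<alpha>(1)])
    show "lin psc (\<alpha> k) (\<beta> k (act' g x)) = gact act' g (lin psc (\<alpha> k) (\<beta> k x))"
      unfolding \<beta>(2)[OF x] by (rule lin_equivariant[OF \<beta>(1)[OF x]]) (rule \<alpha>(2))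
  next
    fix x assume x: "x \<in> X' 0"
    have "csum (lin psc (\<alpha> 0) (\<beta> 0 x)) = lin (*) (\<lambda>y. csum (\<alpha> 0 y)) (\<beta> 0 x)"
      by (rule csum_lin)
    also have "\<dots> = lin (*) (\<lambda>_. 1) (\<beta> 0 x)"
      by (rule fld.lin_cong) (use \<alpha>(3) \<beta>(1)[OF x] in blast)
    also have "\<dots> = csum (\<beta> 0 x)" by (simp only: csum_def)
    finally have "csum (lin psc (\<alpha> 0) (\<beta> 0 x)) = csum (\<beta> 0 x)" .
    then show "csum (lin psc (\<alpha> 0) (\<beta> 0 x)) = 1" using \<beta>(3)[OF x] by simp
  next
    fix k x assume x: "x \<in> X' (Suc k)"
    have "lin psc (bd' (Suc k)) (lin psc (\<alpha> (Suc k)) (\<beta> (Suc k) x))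
        = lin psc (\<lambda>y. lin psc (\<alpha> k) (bd (Suc k) y)) (\<beta> (Suc k) x)"
      unfolding psc.lin_lin by (rule psc.lin_cong) (use \<alpha>(4) \<beta>(1)[OF x] in auto)
    also have "\<dots> = lin psc (\<alpha> k) (lin psc (\<beta> k) (bd' (Suc k) x))"
      by (simp flip: psc.lin_lin add: \<beta>(4)[OF x])
    finally show "lin psc (bd' (Suc k)) (lin psc (\<alpha> (Suc k)) (\<beta> (Suc k) x))
        = lin psc (\<lambda>x. lin psc (\<alpha> k) (\<beta> k x)) (bd' (Suc k) x)" by (simp add: psc.lin_lin)
  qed
  have ident: "chain_map act' X' bd' act' X' bd' (\<lambda>k x. Poly_Mapping.single x 1)"
    unfolding chain_map_def by (auto simp: gact_single csum_single)
  obtain h where h: "\<And>k x. x \<in> X' k \<Longrightarrow> Poly_Mapping.keys (h k x) \<subseteq> X' (Suc k)"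
    "\<And>k x g. x \<in> X' k \<Longrightarrow> h k (act' g x) = gact act' g (h k x)"
    "\<And>k x. x \<in> X' (Suc k) \<Longrightarrow> lin psc (bd' (Suc (Suc k))) (h (Suc k) x) =
       lin psc (\<alpha> (Suc k)) (\<beta> (Suc k) x) - Poly_Mapping.single x 1 - lin psc (h k) (bd' (Suc k) x)"
    using CC.homotopy_exists[OF comp ident] by blast
  have zero: "lin sc c (lin psc (bd' (Suc (Suc k))) p) = 0" if "Poly_Mapping.keys p \<subseteq> X' (Suc (Suc k))" for p
  proof -
    have "lin sc c (lin psc (bd' (Suc (Suc k))) p) = lin sc (\<lambda>_. 0) p"
      unfolding lin_lin by (rule lin_cong) (use cc that in auto)
    then show ?thesis by simp
  qed
  define c' where "c' x = lin sc c (\<alpha> (Suc k) x)" for x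
  have "cochain_on act (X (Suc k)) c'"
    unfolding c'_def by (rule cochain_lin[OF c]) (use \<alpha> in auto)
  moreover have "lin sc c' (bd (Suc (Suc k)) x) = 0" if x: "x \<in> X (Suc (Suc k))" for x
  proof -
    have "lin sc c' (bd (Suc (Suc k)) x) = lin sc c (lin psc (\<alpha> (Suc k)) (bd (Suc (Suc k)) x))"
      unfolding c'_def by (simp add: lin_lin)
    also have "\<dots> = 0" unfolding \<alpha>(4)[OF x, symmetric] by (rule zero[OF \<alpha>(1)[OF x]])
    finally show ?thesis .
  qed
  ultimately obtain b where b: "cochain_on act (X k) b"
    and cb: "\<And>x. x \<in> X (Suc k) \<Longrightarrow> c' x = lin sc b (bd (Suc k) x)"
    using van unfolding vanishes_def by blast
  \<comment> \<open>Applied to the homotopy identity, the cocycle \<open>c\<close> kills the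
    boundary of \<open>h (Suc k) y\<close>. Hence \<open>c\<close> and its pullback along
    \<alpha>\<beta> differ by the coboundary of the subtracted term.\<close>
  define b' where "b' y = lin sc b (\<beta> k y) - lin sc c (h k y)" for y
  have b1: "cochain_on act' (X' k) (\<lambda>y. lin sc b (\<beta> k y))" by (rule cochain_lin[OF b]) (use \<beta> in auto)
  have b2: "cochain_on act' (X' k) (\<lambda>y. lin sc c (h k y))" by (rule cochain_lin[OF c]) (use h in auto)
  have "cochain_on act' (X' k) b'"
    using b1 b2 unfolding cochain_on_def b'_def by (auto simp: S_diff rep_diff)
  moreover have "c y = lin sc b' (bd' (Suc k) y)" if y: "y \<in> X' (Suc k)" for y
  proof -
    have "lin sc (\<lambda>y. lin sc b (\<beta> k y)) (bd' (Suc k) y) = lin sc b (lin psc (bd (Suc k)) (\<beta> (Suc k) y))"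
      unfolding \<beta>(4)[OF y] by (simp add: lin_lin)
    also have "\<dots> = lin sc c' (\<beta> (Suc k) y)"
      unfolding lin_lin by (rule lin_cong) (use cb \<beta>(1)[OF y] in auto)
    also have "\<dots> = lin sc c (lin psc (\<alpha> (Suc k)) (\<beta> (Suc k) y))"
      unfolding c'_def by (simp add: lin_lin)
    finally have 1: "lin sc (\<lambda>y. lin sc b (\<beta> k y)) (bd' (Suc k) y) = lin sc c (lin psc (\<alpha> (Suc k)) (\<beta> (Suc k) y))" .
    have "0 = lin sc c (lin psc (bd' (Suc (Suc k))) (h (Suc k) y))" using zero[OF h(1)[OF y]] by simp
    also have "\<dots> = lin sc c (lin psc (\<alpha> (Suc k)) (\<beta> (Suc k) y)) - c y - lin sc c (lin psc (h k) (bd' (Suc k) y))"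
      unfolding h(3)[OF y] by (simp add: lin_diff)
    finally have 2: "c y = lin sc c (lin psc (\<alpha> (Suc k)) (\<beta> (Suc k) y)) - lin sc c (lin psc (h k) (bd' (Suc k) y))"
      by (simp add: algebra_simps)
    show ?thesis unfolding b'_def lin_fun_diff 1 by (subst 2) (simp add: lin_lin)
  qed
  ultimately show "\<exists>b. cochain_on act' (X' k) b \<and> (\<forall>x\<in>X' (Suc k). c x = lin sc b (bd' (Suc k) x))" by blast
qed

end

section \<open>The group algebra and unitary representations\<close>

lemma pm_induct [case_names zero single add]:
  assumes "P 0" "\<And>x a. P (Poly_Mapping.single x a)" "\<And>p q. P p \<Longrightarrow> P q \<Longrightarrow> P (p + q)"
  shows "P (p :: 'x \<Rightarrow>\<^sub>0 'a::comm_monoid_add)"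
proof -
  have "P (\<Sum>x\<in>A. Poly_Mapping.single x (Poly_Mapping.lookup p x))" for A
    by (induction A rule: infinite_finite_induct) (auto intro: assms)
  moreover have "p = (\<Sum>x\<in>Poly_Mapping.keys p. Poly_Mapping.single x (Poly_Mapping.lookup p x))"
    by (rule poly_mapping_expand)
  ultimately show ?thesis by metis
qed

lemma lookup_single_mult:
  fixes q :: "'g::group_add \<Rightarrow>\<^sub>0 'k::comm_ring_1"
  shows "Poly_Mapping.lookup (Poly_Mapping.single g a * q) h = a * Poly_Mapping.lookup q (- g + h)"
proof (induction q rule: pm_induct)
  case (single x b)
  have "g + x = h \<longleftrightarrow> x = - g + h" by (metis add.assoc add.left_inverse add_0 add.right_inverse)
  then show ?case by (simp add: mult_single lookup_single when_def)
qed (auto simp: distrib_left lookup_add)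

lemma star_zero [simp]: "star 0 = 0"
  by (rule poly_mapping_eqI) (simp add: lookup_star)

lemma star_add: "star (p + q) = star p + star q"
  by (rule poly_mapping_eqI) (simp add: lookup_star lookup_add)

lemma star_single [simp]: "star (Poly_Mapping.single g a) = Poly_Mapping.single (- g) (cnj a)"
  by (rule poly_mapping_eqI) (auto simp: lookup_star lookup_single when_def)

lemma star_star [simp]: "star (star p) = p"
  by (rule poly_mapping_eqI) (simp add: lookup_star)

lemma star_minus: "star (- p) = - star p"
  by (rule poly_mapping_eqI) (simp add: lookup_star)

lemma star_diff: "star (p - q) = star p - star q"
  by (rule poly_mapping_eqI) (simp add: lookup_star lookup_minus)

lemma star_sum: "star (\<Sum>i\<in>I. f i) = (\<Sum>i\<in>I. star (f i))"
  by (induction I rule: infinite_finite_induct) (auto simp: star_add)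

lemma star_mult: "star (p * q) = star q * star p"
proof (induction p rule: pm_induct)
  case (single x a)
  show ?case by (induction q rule: pm_induct) (simp_all add: star_add distrib_left distrib_right mult_single minus_add mult.commute)
qed (simp_all add: star_add distrib_left distrib_right)

abbreviation (input) cst :: "complex \<Rightarrow> ('g::group_add \<Rightarrow>\<^sub>0 complex)" where
  "cst a \<equiv> Poly_Mapping.single 0 a"

lemma cst_mult: "cst a * p = psc a p"
  by (rule poly_mapping_eqI) (simp add: lookup_single_mult)

lemma mult_cst: "p * cst a = psc a p"
proof (induction p rule: pm_induct)
  case (single x b)
  show ?case by (simp add: mult_single mult.commute)
qed (simp_all add: distrib_right psc.scale_right_distrib)

lemma psc_mult_left:
  fixes p q :: "'g::group_add \<Rightarrow>\<^sub>0 complex"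
  shows "psc a p * q = psc a (p * q)"
  by (simp only: cst_mult[symmetric] mult.assoc)

lemma psc_mult_right:
  fixes p q :: "'g::group_add \<Rightarrow>\<^sub>0 complex"
  shows "p * psc a q = psc a (p * q)"
  by (simp only: mult_cst[symmetric] mult.assoc)

lemma star_psc: "star (psc a p) = psc (cnj a) (star p)"
  by (rule poly_mapping_eqI) (simp add: lookup_star)

lemma mat_star_carrier [simp]: "A \<in> carrier_mat n m \<Longrightarrow> mat_star A \<in> carrier_mat m n"
  by (simp add: mat_star_def)

lemma mat_star_index: "A \<in> carrier_mat n m \<Longrightarrow> i < m \<Longrightarrow> j < n \<Longrightarrow> mat_star A $$ (i, j) = star (A $$ (j, i))"
  by (simp add: mat_star_def)

lemma mat_mult_index:
  "A \<in> carrier_mat n m \<Longrightarrow> B \<in> carrier_mat m l \<Longrightarrow> i < n \<Longrightarrow> j < l \<Longrightarrow>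
    (A * B) $$ (i, j) = (\<Sum>k<m. A $$ (i, k) * B $$ (k, j))"
  by (auto simp: scalar_prod_def lessThan_atLeast0 intro!: sum.cong)

lemma mat_star_star [simp]: "mat_star (mat_star A) = A"
  by (rule eq_matI) (auto simp: mat_star_def)

section \<open>Group algebra elements acting on vectors, matrices acting on tuples\<close>

locale unirep = hilbert +
  fixes rep :: "'g::group_add \<Rightarrow> 'a \<Rightarrow> 'a"
  assumes rep_S [simp]: "x \<in> S \<Longrightarrow> rep g x \<in> S"
    and rep_add: "x \<in> S \<Longrightarrow> y \<in> S \<Longrightarrow> rep g (x + y) = rep g x + rep g y"
    and rep_scale: "x \<in> S \<Longrightarrow> rep g (sc a x) = sc a (rep g x)"
    and rep_zero: "x \<in> S \<Longrightarrow> rep 0 x = x"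
    and rep_plus: "x \<in> S \<Longrightarrow> rep (g + h) x = rep g (rep h x)"
    and rep_ip: "x \<in> S \<Longrightarrow> y \<in> S \<Longrightarrow> ip (rep g x) (rep g y) = ip x y"
begin

definition act :: "('g \<Rightarrow>\<^sub>0 complex) \<Rightarrow> 'a \<Rightarrow> 'a" where
  "act p x = lin sc (\<lambda>g. rep g x) p"

lemma act_S [simp]: "x \<in> S \<Longrightarrow> act p x \<in> S"
  unfolding act_def by (rule lin_mem) auto

lemma act_zero_left [simp]: "act 0 x = 0"
  and act_single [simp]: "act (Poly_Mapping.single g a) x = sc a (rep g x)"
  and act_add_left: "act (p + q) x = act p x + act q x"
  and act_diff_left: "act (p - q) x = act p x - act q x"
  and act_sum_left: "act (sum f I) x = (\<Sum>i\<in>I. act (f i) x)"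
  by (simp_all add: act_def lin_add lin_diff lin_sum)

lemma act_add: "x \<in> S \<Longrightarrow> y \<in> S \<Longrightarrow> act p (x + y) = act p x + act p y"
  by (simp add: act_def rep_add lin_fun_add)

lemma act_scale: "x \<in> S \<Longrightarrow> act p (sc a x) = sc a (act p x)"
  by (simp add: act_def rep_scale lin_def scale_sum_right mult.commute)

lemma act_zero [simp]: "act p 0 = 0"
  using act_scale[OF S_zero, of p 0] by simp

lemma act_minus: "x \<in> S \<Longrightarrow> act p (- x) = - act p x"
  using act_scale[of x p "- 1"] by simp

lemma act_diff: "x \<in> S \<Longrightarrow> y \<in> S \<Longrightarrow> act p (x - y) = act p x - act p y"
  using act_add[of x "- y" p] act_minus[of y p] by simp

lemma act_sum: "(\<And>i. i \<in> I \<Longrightarrow> f i \<in> S) \<Longrightarrow> act p (sum f I) = (\<Sum>i\<in>I. act p (f i))"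
  by (induction I rule: infinite_finite_induct) (auto simp: act_add)

lemma act_mult: "x \<in> S \<Longrightarrow> act (p * q) x = act p (act q x)"
proof (induction p rule: pm_induct)
  case (single g a)
  then show ?case
    by (induction q rule: pm_induct)
      (simp_all add: distrib_left act_add_left mult_single rep_plus rep_scale rep_add scale_right_distrib
        rep_scale[OF S_zero, of _ 0, simplified])
qed (simp_all add: distrib_right act_add_left)

lemma ip_rep: "x \<in> S \<Longrightarrow> y \<in> S \<Longrightarrow> ip (rep g x) y = ip x (rep (- g) y)"
  using rep_ip[of x "rep (- g) y" g] rep_plus[of y g "- g"] by (simp add: rep_zero)

lemma ip_act: "x \<in> S \<Longrightarrow> y \<in> S \<Longrightarrow> ip (act p x) y = ip x (act (star p) y)"
proof (induction p rule: pm_induct)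
  case (single g a)
  then show ?case by (simp add: ip_scale ip_scale_right ip_rep)
qed (simp_all add: act_add_left ip_add star_add ip_add_right)

lemma nrm_rep: "x \<in> S \<Longrightarrow> nrm ip (rep g x) = nrm ip x"
  by (simp add: nrm_def rep_ip)

lemma act_bounded: "\<exists>R\<ge>0. \<forall>x\<in>S. nrm ip (act p x) \<le> R * nrm ip x"
proof (induction p rule: pm_induct)
  case zero
  show ?case by (auto intro!: exI[of _ 0])
next
  case (single g a)
  show ?case by (auto simp: nrm_scale nrm_rep intro!: exI[of _ "cmod a"])
next
  case (add p q)
  then obtain R R' where R: "0 \<le> R" "0 \<le> R'" "\<And>x. x \<in> S \<Longrightarrow> nrm ip (act p x) \<le> R * nrm ip x"
    "\<And>x. x \<in> S \<Longrightarrow> nrm ip (act q x) \<le> R' * nrm ip x" by blast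
  have "nrm ip (act (p + q) x) \<le> (R + R') * nrm ip x" if x: "x \<in> S" for x
    using nrm_triangle[of "act p x" "act q x"] R(3,4)[OF x] x by (simp add: act_add_left distrib_right)
  then show ?case using R by (intro exI[of _ "R + R'"]) auto
qed

text \<open>A tuple holds the values of an equivariant cochain on a basis. The differential
  multiplies row vectors by a matrix from the right, so composing a cochain with it lets the same
  matrix act on the tuple from the left.\<close>

definition mact :: "('g \<Rightarrow>\<^sub>0 complex) mat \<Rightarrow> (nat \<Rightarrow> 'a) \<Rightarrow> (nat \<Rightarrow> 'a)" where
  "mact A \<xi> = (\<lambda>i. if i < dim_row A then \<Sum>j<dim_col A. act (A $$ (i, j)) (\<xi> j) else 0)"

lemma mact_tup: "A \<in> carrier_mat n m \<Longrightarrow> \<xi> \<in> tup m \<Longrightarrow> mact A \<xi> \<in> tup n"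
  by (auto simp: tup_def mact_def intro!: S_sum)

lemma mact_nth: "A \<in> carrier_mat n m \<Longrightarrow> i < n \<Longrightarrow> mact A \<xi> i = (\<Sum>j<m. act (A $$ (i, j)) (\<xi> j))"
  by (auto simp: mact_def)

lemma mact_out: "A \<in> carrier_mat n m \<Longrightarrow> \<not> i < n \<Longrightarrow> mact A \<xi> i = 0"
  by (auto simp: mact_def)

lemma mact_add: "\<xi> \<in> tup m \<Longrightarrow> \<zeta> \<in> tup m \<Longrightarrow> mact A (\<xi> + \<zeta>) = mact A \<xi> + mact A \<zeta>"
  by (auto simp: fun_eq_iff mact_def act_add tup_nth sum.distrib)

lemma mact_scale: "\<xi> \<in> tup m \<Longrightarrow> mact A (tsc a \<xi>) = tsc a (mact A \<xi>)"
  by (auto simp: fun_eq_iff mact_def act_scale tup_nth tsc_def scale_sum_right)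

lemma mact_zero [simp]: "mact A 0 = 0"
  by (simp add: mact_def fun_eq_iff)

lemma mact_mult:
  assumes A: "A \<in> carrier_mat n m" and B: "B \<in> carrier_mat m l" and \<xi>: "\<xi> \<in> tup l"
  shows "mact (A * B) \<xi> = mact A (mact B \<xi>)"
proof
  fix i
  show "mact (A * B) \<xi> i = mact A (mact B \<xi>) i"
  proof (cases "i < n")
    case True
    have "mact (A * B) \<xi> i = (\<Sum>j<l. \<Sum>k<m. act (A $$ (i, k)) (act (B $$ (k, j)) (\<xi> j)))"
      using A B True tup_nth[OF \<xi>]
      by (simp add: mact_nth[OF mult_carrier_mat[OF A B]] mat_mult_index[OF A B] act_sum_left act_mult
          del: index_mult_mat)
    also have "\<dots> = (\<Sum>k<m. act (A $$ (i, k)) (\<Sum>j<l. act (B $$ (k, j)) (\<xi> j)))"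
      using tup_nth[OF \<xi>] by (subst sum.swap) (simp add: act_sum)
    also have "\<dots> = mact A (mact B \<xi>) i" by (simp add: mact_nth[OF A True] mact_nth[OF B])
    finally show ?thesis .
  qed (use A B in \<open>simp add: mact_def\<close>)
qed

lemma mact_add_mat:
  assumes "A \<in> carrier_mat n m" "B \<in> carrier_mat n m"
  shows "mact (A + B) \<xi> = mact A \<xi> + mact B \<xi>"
  using assms by (auto simp: fun_eq_iff mact_def act_add_left sum.distrib)

lemma mact_diff_mat:
  assumes "A \<in> carrier_mat n m" "B \<in> carrier_mat n m"
  shows "mact (A - B) \<xi> = mact A \<xi> - mact B \<xi>"
  using assms by (auto simp: fun_eq_iff mact_def act_diff_left sum_subtractf)

lemma mact_scalar:
  assumes "\<xi> \<in> tup m"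
  shows "mact (scalar_mat m a) \<xi> = (\<lambda>i. act a (\<xi> i))"
proof
  fix i
  have "(\<Sum>j<m. act ((a \<cdot>\<^sub>m 1\<^sub>m m) $$ (i, j)) (\<xi> j)) = (\<Sum>j<m. if j = i then act a (\<xi> i) else 0)" if "i < m"
    using that by (intro sum.cong) auto
  then show "mact (scalar_mat m a) \<xi> i = act a (\<xi> i)"
    using assms by (auto simp: mact_def scalar_mat_def sum.delta tup_def)
qed

lemma mact_adjoint:
  assumes A: "A \<in> carrier_mat n m" and \<xi>: "\<xi> \<in> tup m" and \<zeta>: "\<zeta> \<in> tup n"
  shows "tip n (mact A \<xi>) \<zeta> = tip m \<xi> (mact (mat_star A) \<zeta>)"
proof -
  have "tip n (mact A \<xi>) \<zeta> = (\<Sum>i<n. \<Sum>j<m. ip (\<xi> j) (act (star (A $$ (i, j))) (\<zeta> i)))"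
    using tup_nth[OF \<xi>] tup_nth[OF \<zeta>] by (simp add: tip_def mact_nth[OF A] ip_sum_left ip_act)
  also have "\<dots> = (\<Sum>j<m. \<Sum>i<n. ip (\<xi> j) (act (mat_star A $$ (j, i)) (\<zeta> i)))"
    using mat_star_index[OF A] by (subst sum.swap) simp
  also have "\<dots> = tip m \<xi> (mact (mat_star A) \<zeta>)"
    using tup_nth[OF \<xi>] tup_nth[OF \<zeta>] A
    by (simp add: tip_def mact_nth[OF mat_star_carrier[OF A]] ip_sum_right)
  finally show ?thesis .
qed

lemma mact_bounded:
  assumes A: "A \<in> carrier_mat n m"
  shows "\<exists>R. \<forall>\<xi>\<in>tup m. nrm (tip n) (mact A \<xi>) \<le> R * nrm (tip m) \<xi>"
proof -
  have "\<exists>R. \<forall>i j. 0 \<le> R i j \<and> (\<forall>x\<in>S. nrm ip (act (A $$ (i, j)) x) \<le> R i j * nrm ip x)"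
    using act_bounded[of "A $$ (i, j)" for i j] by metis
  then obtain R where R: "\<And>i j. 0 \<le> R i j" "\<And>i j x. x \<in> S \<Longrightarrow> nrm ip (act (A $$ (i, j)) x) \<le> R i j * nrm ip x"
    by blast
  \<comment> \<open>The Euclidean norm is at most the sum of the coordinates, which suffices for a
    crude bound by the sum of all entry bounds.\<close>
  have sq: "(\<Sum>i<k. (f i)\<^sup>2) \<le> (\<Sum>i<k. f i)\<^sup>2" if "\<And>i. 0 \<le> f i" for k :: nat and f :: "nat \<Rightarrow> real"
  proof (induction k)
    case (Suc k)
    have "0 \<le> sum f {..<k} * f k" by (intro mult_nonneg_nonneg sum_nonneg that)
    then show ?case using Suc power2_sum[of "sum f {..<k}" "f k"] unfolding sum.lessThan_Suc by linarith
  qed simp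
  have "nrm (tip n) (mact A \<xi>) \<le> (\<Sum>i<n. \<Sum>j<m. R i j) * nrm (tip m) \<xi>" if \<xi>: "\<xi> \<in> tup m" for \<xi>
  proof -
    interpret T: pre_hilbert tsc "tup n" "tip n" by (rule tup_pre_hilbert)
    interpret T': pre_hilbert tsc "tup m" "tip m" by (rule tup_pre_hilbert)
    have m: "mact A \<xi> \<in> tup n" by (rule mact_tup[OF A \<xi>])
    have "nrm (tip n) (mact A \<xi>) \<le> (\<Sum>i<n. nrm ip (mact A \<xi> i))"
    proof (rule power2_le_imp_le)
      show "(nrm (tip n) (mact A \<xi>))\<^sup>2 \<le> (\<Sum>i<n. nrm ip (mact A \<xi> i))\<^sup>2"
        unfolding tup_nrm_sq[OF m] by (rule sq) (use tup_nth[OF m] in auto)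
    qed (use tup_nth[OF m] in \<open>auto intro: sum_nonneg\<close>)
    also have "\<dots> \<le> (\<Sum>i<n. (\<Sum>j<m. R i j) * nrm (tip m) \<xi>)"
    proof (rule sum_mono)
      fix i assume "i \<in> {..<n}"
      then have "nrm ip (mact A \<xi> i) \<le> (\<Sum>j<m. nrm ip (act (A $$ (i, j)) (\<xi> j)))"
        using tup_nth[OF \<xi>] by (simp add: mact_nth[OF A]) (rule nrm_sum, simp)
      also have "\<dots> \<le> (\<Sum>j<m. R i j * nrm (tip m) \<xi>)"
      proof (rule sum_mono)
        fix j
        have "nrm ip (act (A $$ (i, j)) (\<xi> j)) \<le> R i j * nrm ip (\<xi> j)" using R tup_nth[OF \<xi>] by blast
        also have "\<dots> \<le> R i j * nrm (tip m) \<xi>" using R tup_nrm_ge[OF \<xi>] by (intro mult_left_mono) auto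
        finally show "nrm ip (act (A $$ (i, j)) (\<xi> j)) \<le> R i j * nrm (tip m) \<xi>" .
      qed
      finally show "nrm ip (mact A \<xi> i) \<le> (\<Sum>j<m. R i j) * nrm (tip m) \<xi>" by (simp add: sum_distrib_right)
    qed
    finally show ?thesis by (simp add: sum_distrib_right)
  qed
  then show ?thesis by blast
qed

end

section \<open>The standard and the based resolution\<close>

text \<open>Recursion through the cone \<open>xs \<mapsto> x # xs\<close> reduces \<open>\<partial>\<partial> = 0\<close> and
  exactness to the identity \<open>lbd_cone\<close>. The empty list spans the trivial module in degree \<open>-1\<close>.\<close>

fun lbd :: "'g list \<Rightarrow> ('g list \<Rightarrow>\<^sub>0 rat)" where
  "lbd [] = 0"
| "lbd (x # xs) = Poly_Mapping.single xs 1 - lin psc (\<lambda>ys. Poly_Mapping.single (x # ys) 1) (lbd xs)"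

abbreviation lcone :: "'g \<Rightarrow> ('g list \<Rightarrow>\<^sub>0 rat) \<Rightarrow> ('g list \<Rightarrow>\<^sub>0 rat)" where
  "lcone x \<equiv> lin psc (\<lambda>ys. Poly_Mapping.single (x # ys) 1)"

lemma lbd_cone: "lin psc lbd (lcone x p) = p - lcone x (lin psc lbd p)"
  by (simp add: psc.lin_lin psc.lin_fun_diff)

lemma lbd_lbd: "lin psc lbd (lbd xs) = 0"
  by (induction xs) (simp_all add: psc.lin_diff lbd_cone)

lemma keys_lbd: "Poly_Mapping.keys (lbd xs) \<subseteq> {ys. Suc (length ys) = length xs}"
proof (induction xs)
  case (Cons x xs)
  have "Poly_Mapping.keys (lcone x (lbd xs)) \<subseteq> {ys. Suc (length ys) = length (x # xs)}"
    by (rule chain_lin[OF Cons]) auto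
  then show ?case
    by (auto simp: in_keys_iff lookup_minus lookup_single subset_iff when_def split: if_splits)
qed simp

lemma lbd_map: "lbd (map ((+) g) xs) = gact (\<lambda>g. map ((+) g)) g (lbd xs)"
proof (induction xs)
  case (Cons x xs)
  have "lcone (g + x) (gact (\<lambda>g. map ((+) g)) g p) = gact (\<lambda>g. map ((+) g)) g (lcone x p)" for p
    by (simp add: gact_def psc.lin_lin)
  then show ?case by (simp add: Cons gact_diff gact_single)
qed (simp add: gact_def)

text \<open>Links the recursive boundary with the alternating sum in \<open>coboundary\<close>: the
  minus sign of the recursion shifts the exponent by one.\<close>

lemma lbd_sum: "lbd xs = (\<Sum>i<length xs. Poly_Mapping.single (take i xs @ drop (Suc i) xs) ((- 1) ^ i))"
proof (induction xs)
  case (Cons x xs)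
  show ?case
    unfolding lbd.simps Cons psc.lin_sum by (simp add: sum.lessThan_Suc_shift single_uminus sum_negf del: sum.lessThan_Suc)
qed simp

text \<open>Tuples with head \<open>0\<close> represent the orbits, and coning with \<open>0\<close>
  contracts the complex. The contraction is not equivariant, but exactness concerns the underlying
  rational vector spaces only.\<close>

lemma standard_resolution:
  "free_resolution (\<lambda>g::'g::group_add. map ((+) g)) (\<lambda>k. {xs. length xs = Suc k}) (\<lambda>_. lbd)
     hd (\<lambda>xs. map ((+) (- hd xs)) xs)"
proof
  fix g h :: 'g and x
  show "map ((+) (g + h)) x = map ((+) g) (map ((+) h) x)" by (simp add: add.assoc)
next
  show "{xs :: 'g list. length xs = Suc 0} \<noteq> {}" by (auto intro: exI[of _ "[0]"])
next
  fix g :: 'g and x :: "'g list" and k assume x: "x \<in> {xs. length xs = Suc k}"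
  then have ne: "x \<noteq> []" by auto
  show "map ((+) g) x \<in> {xs. length xs = Suc k}" "map ((+) (- hd x)) x \<in> {xs. length xs = Suc k}"
    using x by auto
  show "map ((+) (hd x)) (map ((+) (- hd x)) x) = x" by (simp add: add.assoc[symmetric] map_idI)
  show "hd (map ((+) g) x) = g + hd x" using ne by (simp add: hd_map)
  show "map ((+) (- hd (map ((+) g) x))) (map ((+) g) x) = map ((+) (- hd x)) x"
    using ne by (simp add: hd_map minus_add add.assoc[symmetric])
next
  fix x :: "'g list" and k assume "x \<in> {xs. length xs = Suc (Suc k)}"
  then show "Poly_Mapping.keys (lbd x) \<subseteq> {xs. length xs = Suc k}" using keys_lbd[of x] by auto
next
  fix x :: "'g list" and g show "lbd (map ((+) g) x) = gact (\<lambda>g. map ((+) g)) g (lbd x)" by (rule lbd_map)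
next
  fix x :: "'g list" show "lin psc lbd (lbd x) = 0" by (rule lbd_lbd)
next
  fix x :: "'g list" assume "x \<in> {xs. length xs = Suc 1}"
  then obtain a b where "x = [a, b]" by (auto simp: length_Suc_conv)
  then show "csum (lbd x) = 0" by (simp add: csum_diff csum_single)
next
  fix p :: "'g list \<Rightarrow>\<^sub>0 rat" and k
  assume p: "Poly_Mapping.keys p \<subseteq> {xs. length xs = Suc (Suc k)}" "lin psc lbd p = 0"
  show "\<exists>q. Poly_Mapping.keys q \<subseteq> {xs. length xs = Suc (Suc (Suc k))} \<and> lin psc lbd q = p"
  proof (intro exI conjI)
    show "Poly_Mapping.keys (lcone 0 p) \<subseteq> {xs. length xs = Suc (Suc (Suc k))}"
      by (rule chain_lin[OF p(1)]) auto
    show "lin psc lbd (lcone 0 p) = p" by (simp add: lbd_cone p(2))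
  qed
next
  fix p :: "'g list \<Rightarrow>\<^sub>0 rat"
  assume p: "Poly_Mapping.keys p \<subseteq> {xs. length xs = Suc 0}" "csum p = 0"
  \<comment> \<open>In degree 0 the recursive boundary lands in the line of the empty list and is
    the augmentation there.\<close>
  have "lin psc lbd p = lin psc (\<lambda>_. Poly_Mapping.single [] 1) p"
    by (rule psc.lin_cong) (use p(1) in \<open>auto simp: length_Suc_conv\<close>)
  also have "\<dots> = Poly_Mapping.single [] (csum p)"
    by (rule poly_mapping_eqI) (simp add: lin_def csum_def lookup_sum lookup_single when_def sum_distrib_right)
  finally have p0: "lin psc lbd p = 0" using p(2) by simp
  show "\<exists>q. Poly_Mapping.keys q \<subseteq> {xs. length xs = Suc 1} \<and> lin psc lbd q = p"
  proof (intro exI conjI)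
    show "Poly_Mapping.keys (lcone 0 p) \<subseteq> {xs. length xs = Suc 1}"
      by (rule chain_lin[OF p(1)]) auto
    show "lin psc lbd (lcone 0 p) = p" by (simp add: lbd_cone p0)
  qed
qed


section \<open>The chain complex of a based resolution\<close>

abbreviation gshift :: "'g::group_add \<Rightarrow> 'g \<times> 'i \<Rightarrow> 'g \<times> 'i" where
  "gshift h \<equiv> (\<lambda>(g, a). (h + g, a))"

text \<open>A row vector over the rational group ring as a chain: the pair \<open>(g, a)\<close> stands for
  \<open>g\<close> times the \<open>a\<close>-th basis vector.\<close>

definition vch :: "('g::group_add \<Rightarrow>\<^sub>0 rat) vec \<Rightarrow> ('g \<times> nat \<Rightarrow>\<^sub>0 rat)" where
  "vch v = (\<Sum>a<dim_vec v. lin psc (\<lambda>g. Poly_Mapping.single (g, a) 1) (v $ a))"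

lemma lookup_lin_pair:
  "Poly_Mapping.lookup (lin psc (\<lambda>g. Poly_Mapping.single (g, a) 1) p) (h, b) =
     (if a = b then Poly_Mapping.lookup p h else (0::rat))"
  by (auto simp: lin_def lookup_sum lookup_single when_def if_distrib in_keys_iff sum.delta' cong: if_cong)

lemma lookup_vch: "Poly_Mapping.lookup (vch v) (h, b) = (if b < dim_vec v then Poly_Mapping.lookup (v $ b) h else 0)"
  by (simp add: vch_def lookup_sum lookup_lin_pair)

lemma keys_vch: "v \<in> carrier_vec m \<Longrightarrow> Poly_Mapping.keys (vch v) \<subseteq> {(g, a). a < m}"
  by (auto simp: in_keys_iff lookup_vch split: if_splits)

lemma vch_inj: "v \<in> carrier_vec m \<Longrightarrow> w \<in> carrier_vec m \<Longrightarrow> vch v = vch w \<Longrightarrow> v = w"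
proof (rule eq_vecI)
  fix i assume *: "v \<in> carrier_vec m" "w \<in> carrier_vec m" "vch v = vch w" "i < dim_vec w"
  have "Poly_Mapping.lookup (v $ i) h = Poly_Mapping.lookup (w $ i) h" for h
    using arg_cong[OF *(3), of "\<lambda>p. Poly_Mapping.lookup p (h, i)"] *(1,2,4) by (auto simp: lookup_vch)
  then show "v $ i = w $ i" by (rule poly_mapping_eqI)
qed auto

lemma vch_zero [simp]: "vch (0\<^sub>v m) = 0"
  by (simp add: vch_def)

lemma vch_surj:
  assumes "Poly_Mapping.keys p \<subseteq> {(g, a). a < m}"
  shows "\<exists>v\<in>carrier_vec m. vch v = p"
proof
  define sl where "sl a = lin psc (\<lambda>(g, b). if b = a then Poly_Mapping.single g 1 else 0) p" for a
  have "Poly_Mapping.lookup (sl a) g = Poly_Mapping.lookup p (g, a)" for g a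
  proof -
    have "Poly_Mapping.lookup (sl a) g =
        (\<Sum>x\<in>Poly_Mapping.keys p. if x = (g, a) then Poly_Mapping.lookup p x else 0)"
      unfolding sl_def lin_def lookup_sum
      by (intro sum.cong refl) (auto simp: lookup_single when_def split: if_splits)
    then show ?thesis by (simp add: in_keys_iff)
  qed
  note sl = this
  show "vch (vec m sl) = p"
  proof (rule poly_mapping_eqI, safe)
    fix g b
    have "Poly_Mapping.lookup p (g, b) = 0" if "\<not> b < m"
    proof -
      have "(g, b) \<notin> Poly_Mapping.keys p" using assms that by auto
      then show ?thesis by (simp add: in_keys_iff)
    qed
    then show "Poly_Mapping.lookup (vch (vec m sl)) (g, b) = Poly_Mapping.lookup p (g, b)"
      by (auto simp: lookup_vch sl)
  qed
qed simp

lemma row_mult_carrier: "D \<in> carrier_mat n m \<Longrightarrow> row_mult v D \<in> carrier_vec m"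
  by (simp add: row_mult_def)

lemma row_mult_index:
  "D \<in> carrier_mat n m \<Longrightarrow> b < m \<Longrightarrow> row_mult v D $ b = (\<Sum>a<n. v $ a * D $$ (a, b))"
  by (auto simp: row_mult_def scalar_prod_def lessThan_atLeast0 intro!: sum.cong)

lemma row_mult_unit:
  fixes D :: "'r::ring_1 mat"
  shows "D \<in> carrier_mat n m \<Longrightarrow> i < n \<Longrightarrow> row_mult (unit_vec n i) D = row D i"
  by (rule eq_vecI) (auto simp: row_mult_def)

lemma lookup_group_mult:
  fixes p q :: "'g::group_add \<Rightarrow>\<^sub>0 'k::comm_ring_1"
  shows "Poly_Mapping.lookup (p * q) h = (\<Sum>g\<in>Poly_Mapping.keys p. Poly_Mapping.lookup p g * Poly_Mapping.lookup q (- g + h))"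
proof -
  have "p = (\<Sum>g\<in>Poly_Mapping.keys p. Poly_Mapping.single g (Poly_Mapping.lookup p g))"
    by (rule poly_mapping_expand)
  then have "p * q = (\<Sum>g\<in>Poly_Mapping.keys p. Poly_Mapping.single g (Poly_Mapping.lookup p g) * q)"
    by (metis sum_distrib_right)
  then show ?thesis by (simp add: lookup_sum lookup_single_mult)
qed

text \<open>The differential on rational basis elements: a row of the matrix gives it at the neutral
  element, translation elsewhere.\<close>

definition pbd :: "(nat \<Rightarrow> ('g::group_add \<Rightarrow>\<^sub>0 rat) mat) \<Rightarrow> nat \<Rightarrow> 'g \<times> nat \<Rightarrow> ('g \<times> nat \<Rightarrow>\<^sub>0 rat)" where
  "pbd D k x = gact gshift (fst x) (vch (row (D k) (snd x)))"

lemma lookup_gshift: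
  fixes p :: "'g::group_add \<times> 'i \<Rightarrow>\<^sub>0 rat"
  shows "Poly_Mapping.lookup (gact gshift g p) (h, b) = Poly_Mapping.lookup p (- g + h, b)"
proof (induction p rule: pm_induct)
  case (single x a)
  have "g + fst x = h \<longleftrightarrow> fst x = - g + h" by (metis add.assoc add.left_inverse add_0 add.right_inverse)
  then show ?case by (cases x) (auto simp: gact_single lookup_single when_def)
qed (simp_all add: gact_add lookup_add, simp add: gact_def)

lemma gshift_add: "gact gshift (g + h) p = gact gshift g (gact gshift (h::'g::group_add) p)"
  by (rule poly_mapping_eqI) (auto simp: lookup_gshift minus_add add.assoc diff_conv_add_uminus simp del: add_uminus_conv_diff)

text \<open>Both sides have the convolution of \<open>v\<close> with the entries of the matrix as
  coefficients. Kernels and images of \<open>row_mult\<close> thereby become kernels and images on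
  chains.\<close>

lemma lin_pbd_vch:
  assumes D: "D k \<in> carrier_mat n m" and v: "v \<in> carrier_vec n"
  shows "lin psc (pbd D k) (vch v) = vch (row_mult v (D k))"
proof (rule poly_mapping_eqI, safe)
  fix h b
  have "Poly_Mapping.lookup (lin psc (pbd D k) (vch v)) (h, b) =
     (\<Sum>a<n. \<Sum>g\<in>Poly_Mapping.keys (v $ a). Poly_Mapping.lookup (v $ a) g *
        (if b < m then Poly_Mapping.lookup (D k $$ (a, b)) (- g + h) else 0))"
    using D v by (auto simp: vch_def[of v] psc.lin_sum psc.lin_lin lin_def[of _ _ "v $ _"] lookup_sum pbd_def
        lookup_gshift lookup_vch intro!: sum.cong)
  also have "\<dots> = Poly_Mapping.lookup (vch (row_mult v (D k))) (h, b)"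
    using D v row_mult_carrier[OF D, of v]
    by (auto simp: lookup_vch row_mult_index[OF D] lookup_sum lookup_group_mult)
  finally show "Poly_Mapping.lookup (lin psc (pbd D k) (vch v)) (h, b) =
     Poly_Mapping.lookup (vch (row_mult v (D k))) (h, b)" .
qed

lemma aug_csum: "aug a = csum a"
  by (simp add: aug_def csum_def lin_def)

lemma csum_vch: "v \<in> carrier_vec 1 \<Longrightarrow> csum (vch v) = aug (v $ 0)"
  by (auto simp: vch_def csum_lin csum_single) (simp add: aug_csum csum_def)

lemma based_free_resolution_chains:
  assumes res: "based_free_resolution m D \<eta>" and m0: "m 0 = 1"
  shows "free_resolution gshift (\<lambda>k. {(g::'g::group_add, a). a < m k}) (pbd D) fst (\<lambda>(g, a). (0, a))"
proof -
  have D: "\<And>k. D (Suc k) \<in> carrier_mat (m (Suc k)) (m k)"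
    using res by (simp add: based_free_resolution_def)
  have eta_add: "\<And>u v. u \<in> carrier_vec 1 \<Longrightarrow> v \<in> carrier_vec 1 \<Longrightarrow> \<eta> (u + v) = \<eta> u + \<eta> v"
    and eta_scale: "\<And>a v. v \<in> carrier_vec 1 \<Longrightarrow> \<eta> (a \<cdot>\<^sub>v v) = aug a * \<eta> v"
    and eta_surj: "\<eta> ` carrier_vec 1 = UNIV"
    and im1: "(\<lambda>v. row_mult v (D 1)) ` carrier_vec (m 1) = {v \<in> carrier_vec 1. \<eta> v = 0}"
    and im: "\<And>k. (\<lambda>v. row_mult v (D (Suc (Suc k)))) ` carrier_vec (m (Suc (Suc k))) =
       {v \<in> carrier_vec (m (Suc k)). row_mult v (D (Suc k)) = 0\<^sub>v (m k)}"
    using res unfolding based_free_resolution_def resolves_trivial_def left_linear_to_trivial_def m0 by simp_all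
  \<comment> \<open>A left linear map on the rank one module is determined by its value at the basis
    vector. Surjectivity makes that value nonzero, so \<eta> and \<open>csum\<close> have the same
    kernel.\<close>
  have eta: "\<eta> v = aug (v $ 0) * \<eta> (unit_vec 1 0)" if v: "v \<in> carrier_vec 1" for v
  proof -
    have "v = (v $ 0) \<cdot>\<^sub>v unit_vec 1 0" using v by (intro eq_vecI) auto
    then show ?thesis using eta_scale[of "unit_vec 1 0" "v $ 0"] by simp
  qed
  have eta1: "\<eta> (unit_vec 1 0) \<noteq> 0"
  proof
    assume "\<eta> (unit_vec 1 0) = 0"
    moreover obtain v where "v \<in> carrier_vec 1" "\<eta> v = 1" using eta_surj by (metis UNIV_I imageE)
    ultimately show False using eta[of v] by simp
  qed
  have eta0: "\<eta> v = 0 \<longleftrightarrow> csum (vch v) = 0" if "v \<in> carrier_vec 1" for v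
    using eta[OF that] eta1 csum_vch[OF that] by simp
  have keys_pbd: "Poly_Mapping.keys (pbd D (Suc k) x) \<subseteq> {(g, a). a < m k}" if "snd x < m (Suc k)" for k x
    unfolding pbd_def gact_def
    by (rule chain_lin[OF keys_vch[of _ "m k"]]) (use D[of k] in \<open>auto simp: row_def\<close>)
  have row: "vch (row (D (Suc k)) a) = vch (row_mult (unit_vec (m (Suc k)) a) (D (Suc k)))" if "a < m (Suc k)" for k a
    using row_mult_unit[OF D that] by simp
  show ?thesis
  proof
    fix g :: 'g and x :: "'g \<times> nat" and k assume "x \<in> {(g, a). a < m (Suc k)}"
    then have "snd x < m (Suc k)" by auto
    then show "Poly_Mapping.keys (pbd D (Suc k) x) \<subseteq> {(g, a). a < m k}" by (rule keys_pbd)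
    show "pbd D (Suc k) (gshift g x) = gact gshift g (pbd D (Suc k) x)"
      by (cases x) (simp add: pbd_def gshift_add)
  next
    fix x :: "'g \<times> nat" and k assume "x \<in> {(g, a). a < m (Suc (Suc k))}"
    then obtain g a where x: "x = (g, a)" and a: "a < m (Suc (Suc k))" by auto
    let ?r = "row_mult (unit_vec (m (Suc (Suc k))) a) (D (Suc (Suc k)))"
    have r: "?r \<in> carrier_vec (m (Suc k))" "row_mult ?r (D (Suc k)) = 0\<^sub>v (m k)"
      using im[of k] by (metis (mono_tags, lifting) imageI mem_Collect_eq unit_vec_carrier)+
    have "lin psc (pbd D (Suc k)) (pbd D (Suc (Suc k)) x) = lin psc (pbd D (Suc k)) (gact gshift g (vch ?r))"
      by (simp add: pbd_def[of D "Suc (Suc k)"] x row[OF a])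
    also have "\<dots> = gact gshift g (lin psc (pbd D (Suc k)) (vch ?r))"
      by (rule lin_equivariant[where X = UNIV]) (auto simp: pbd_def gshift_add)
    also have "\<dots> = 0" by (simp add: lin_pbd_vch[of D "Suc k", OF D r(1)] r(2)) (simp add: gact_def)
    finally show "lin psc (pbd D (Suc k)) (pbd D (Suc (Suc k)) x) = 0" .
  next
    fix x :: "'g \<times> nat" assume "x \<in> {(g, a). a < m 1}"
    then obtain g a where x: "x = (g, a)" and a: "a < m (Suc 0)" by auto
    let ?r = "row_mult (unit_vec (m (Suc 0)) a) (D (Suc 0))"
    have r: "?r \<in> carrier_vec 1" "\<eta> ?r = 0"
      using im1 by (metis (mono_tags, lifting) One_nat_def imageI mem_Collect_eq unit_vec_carrier)+
    have "csum (pbd D 1 x) = csum (vch ?r)"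
      by (simp add: pbd_def x row[OF a] gact_def csum_lin csum_single) (simp add: csum_def)
    then show "csum (pbd D 1 x) = 0" using eta0[OF r(1)] r(2) by simp
  next
    fix p k assume p: "Poly_Mapping.keys p \<subseteq> {(g::'g, a). a < m (Suc k)}" "lin psc (pbd D (Suc k)) p = 0"
    obtain v where v: "v \<in> carrier_vec (m (Suc k))" "vch v = p" using vch_surj[OF p(1)] by blast
    have "vch (row_mult v (D (Suc k))) = vch (0\<^sub>v (m k))"
      using p(2) v(2) lin_pbd_vch[of D "Suc k", OF D v(1)] by simp
    moreover have rc: "row_mult v (D (Suc k)) \<in> carrier_vec (m k)"
      using D[of k] by (simp add: row_mult_def)
    ultimately have "row_mult v (D (Suc k)) = 0\<^sub>v (m k)"
      using vch_inj[of "row_mult v (D (Suc k))" "m k" "0\<^sub>v (m k)"] by simp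
    then have "v \<in> (\<lambda>v. row_mult v (D (Suc (Suc k)))) ` carrier_vec (m (Suc (Suc k)))"
      unfolding im using v(1) by simp
    then obtain w where w: "w \<in> carrier_vec (m (Suc (Suc k)))" "v = row_mult w (D (Suc (Suc k)))" by (rule imageE)
    show "\<exists>q. Poly_Mapping.keys q \<subseteq> {(g, a). a < m (Suc (Suc k))} \<and> lin psc (pbd D (Suc (Suc k))) q = p"
      using keys_vch[OF w(1)] lin_pbd_vch[of D "Suc (Suc k)", OF D w(1)] v(2) w(2) by (intro exI[of _ "vch w"]) simp
  next
    fix p assume p: "Poly_Mapping.keys p \<subseteq> {(g::'g, a). a < m 0}" "csum p = 0"
    obtain v where v: "v \<in> carrier_vec 1" "vch v = p" using vch_surj[OF p(1)] m0 by auto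
    then have "\<eta> v = 0" using eta0 p(2) by simp
    then have "v \<in> (\<lambda>v. row_mult v (D 1)) ` carrier_vec (m 1)"
      unfolding im1 using v(1) by simp
    then obtain w where w: "w \<in> carrier_vec (m 1)" "v = row_mult w (D 1)" by (rule imageE)
    show "\<exists>q. Poly_Mapping.keys q \<subseteq> {(g, a). a < m 1} \<and> lin psc (pbd D 1) q = p"
      using keys_vch[OF w(1)] lin_pbd_vch[of D 1, OF _ w(1)] D[of 0] v(2) w(2) by (intro exI[of _ "vch w"]) simp
  qed (auto simp: add.assoc m0)
qed

section \<open>Cohomology as a matrix condition\<close>

abbreviation std_vanishes where
  "std_vanishes sc S rep k \<equiv> coefficients.vanishes (\<lambda>r. sc (of_rat r)) S rep
     (\<lambda>g. map ((+) g)) (\<lambda>k. {xs. length xs = Suc k}) (\<lambda>_. lbd) k"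

lemma keys_complexify: "Poly_Mapping.keys (complexify p) = Poly_Mapping.keys p"
  by (auto simp: in_keys_iff lookup_complexify)

context unirep
begin

text \<open>Boundaries have rational coefficients, so a Hilbert space enters the comparison of
  resolutions through its rational scalars alone.\<close>

lemma rat_coefficients: "coefficients (\<lambda>r. sc (of_rat r)) S rep"
proof -
  have "vector_space (\<lambda>r. sc (of_rat r))"
    by standard (auto simp: scale_right_distrib scale_left_distrib of_rat_add of_rat_mult)
  then show ?thesis
    unfolding coefficients_def coefficients_axioms_def by (auto simp: rep_add rep_scale)
qed

sublocale Q: coefficients "\<lambda>r. sc (of_rat r)" S rep
  by (rule rat_coefficients)

lemma lin_complexify: "lin (\<lambda>r. sc (of_rat r)) (\<lambda>g. rep g x) p = act (complexify p) x"
  by (simp add: act_def lin_def keys_complexify lookup_complexify)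

definition invariant_free :: bool where
  "invariant_free \<longleftrightarrow> (\<forall>x\<in>S. (\<forall>g. rep g x = x) \<longrightarrow> x = 0)"

lemma cochain_vch:
  assumes c: "\<And>g a. a < m \<Longrightarrow> c (g, a) = rep g (\<xi> a)" and v: "v \<in> carrier_vec m"
  shows "lin (\<lambda>r. sc (of_rat r)) c (vch v) = (\<Sum>b<m. act (complexify (v $ b)) (\<xi> b))"
proof -
  have "lin (\<lambda>r. sc (of_rat r)) c (vch v) = (\<Sum>b<m. lin (\<lambda>r. sc (of_rat r)) (\<lambda>g. c (g, b)) (v $ b))"
    using v by (simp add: vch_def Q.lin_sum Q.lin_lin)
  then show ?thesis using c by (simp add: lin_complexify)
qed

text \<open>Equivariance moves the evaluation to a row of the matrix; in terms of basis values the
  coboundary operator is therefore the complexified matrix of the differential.\<close>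

lemma cochain_pbd:
  assumes c: "\<And>g a. a < m k \<Longrightarrow> c (g, a) = rep g (\<xi> a)" and \<xi>: "\<xi> \<in> tup (m k)"
    and D: "D (Suc k) \<in> carrier_mat (m (Suc k)) (m k)" and a: "a < m (Suc k)"
  shows "lin (\<lambda>r. sc (of_rat r)) c (pbd D (Suc k) (g, a)) = rep g (mact (map_mat complexify (D (Suc k))) \<xi> a)"
proof -
  have r: "row (D (Suc k)) a \<in> carrier_vec (m k)" using D a by auto
  have "Q.cochain_on gshift {(g, a). a < m k} c"
    using c tup_nth[OF \<xi>] by (auto simp: Q.cochain_on_def rep_plus)
  from Q.cochain_lin_act[OF this keys_vch[OF r]]
  have "lin (\<lambda>r. sc (of_rat r)) c (pbd D (Suc k) (g, a)) = rep g (lin (\<lambda>r. sc (of_rat r)) c (vch (row (D (Suc k)) a)))"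
    by (simp add: pbd_def)
  also have "lin (\<lambda>r. sc (of_rat r)) c (vch (row (D (Suc k)) a)) = (\<Sum>b<m k. act (complexify (row (D (Suc k)) a $ b)) (\<xi> b))"
    by (rule cochain_vch[OF c r])
  also have "\<dots> = mact (map_mat complexify (D (Suc k))) \<xi> a" using D a by (simp add: mact_def)
  finally show ?thesis .
qed

text \<open>Transfer in both directions replaces the standard complex by the based one, where
  freeness makes an equivariant cochain the same as an arbitrary tuple of values on the
  basis.\<close>

theorem vanishing_iff:
  assumes res: "based_free_resolution m D \<eta>" and m0: "m 0 = 1"
  shows "std_vanishes sc S rep k \<longleftrightarrow> (\<forall>\<xi>\<in>tup (m (Suc k)).
    mact (map_mat complexify (D (Suc (Suc k)))) \<xi> = 0 \<longrightarrow>
    (\<exists>\<zeta>\<in>tup (m k). \<xi> = mact (map_mat complexify (D (Suc k))) \<zeta>))"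
    (is "_ \<longleftrightarrow> ?R")
proof -
  have D: "\<And>k. D (Suc k) \<in> carrier_mat (m (Suc k)) (m k)"
    using res by (simp add: based_free_resolution_def)
  define X where "X k = {(g::'g, a). a < m k}" for k
  have fr: "free_resolution gshift X (pbd D) fst (\<lambda>(g, a). (0, a))"
    unfolding X_def by (rule based_free_resolution_chains[OF res m0])
  have "std_vanishes sc S rep k \<longleftrightarrow> Q.vanishes gshift X (pbd D) k"
    using Q.vanishes_transfer[OF fr standard_resolution] Q.vanishes_transfer[OF standard_resolution fr] by blast
  also have "\<dots> \<longleftrightarrow> ?R"
  proof
    assume van: "Q.vanishes gshift X (pbd D) k"
    show ?R
    proof (intro ballI impI)
      fix \<xi> assume \<xi>: "\<xi> \<in> tup (m (Suc k))" and z: "mact (map_mat complexify (D (Suc (Suc k)))) \<xi> = 0"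
      define c where "c = (\<lambda>(g, a). rep g (\<xi> a))"
      have "Q.cochain_on gshift (X (Suc k)) c"
        using tup_nth[OF \<xi>] by (auto simp: Q.cochain_on_def c_def rep_plus)
      moreover have "\<forall>x\<in>X (Suc (Suc k)). lin (\<lambda>r. sc (of_rat r)) c (pbd D (Suc (Suc k)) x) = 0"
        using cochain_pbd[where k = "Suc k" and c = c and D = D, OF _ \<xi> D] z by (auto simp: X_def c_def Q.rep_zero)
      ultimately obtain b where b: "Q.cochain_on gshift (X k) b"
        and cb: "\<And>x. x \<in> X (Suc k) \<Longrightarrow> c x = lin (\<lambda>r. sc (of_rat r)) b (pbd D (Suc k) x)"
        using van unfolding Q.vanishes_def by blast
      \<comment> \<open>The values at the neutral element, padded by 0 so as to lie in
        \<open>tup (m k)\<close>.\<close>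
      define \<zeta> where "\<zeta> a = (if a < m k then b (0, a) else 0)" for a
      have \<zeta>: "\<zeta> \<in> tup (m k)" using b by (auto simp: tup_def \<zeta>_def Q.cochain_on_def X_def)
      have bz: "b (g, a) = rep g (\<zeta> a)" if "a < m k" for g a
      proof -
        have "b (gshift g (0, a)) = rep g (b (0, a))" using b that unfolding Q.cochain_on_def X_def by blast
        then show ?thesis using that by (simp add: \<zeta>_def)
      qed
      have "\<xi> a = mact (map_mat complexify (D (Suc k))) \<zeta> a" for a
      proof (cases "a < m (Suc k)")
        case True
        have "rep 0 (\<xi> a) = rep 0 (mact (map_mat complexify (D (Suc k))) \<zeta> a)"
          using cb[of "(0, a)"] cochain_pbd[where k = k and D = D, OF bz \<zeta> D True] True by (simp add: X_def c_def)
        moreover have "mact (map_mat complexify (D (Suc k))) \<zeta> \<in> tup (m (Suc k))"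
          by (rule mact_tup[OF _ \<zeta>]) (use D in auto)
        ultimately show ?thesis using tup_nth \<xi> rep_zero by metis
      next
        case False
        then show ?thesis using \<xi> D[of k] by (auto simp: tup_def mact_def)
      qed
      then show "\<exists>\<zeta>\<in>tup (m k). \<xi> = mact (map_mat complexify (D (Suc k))) \<zeta>" using \<zeta> by blast
    qed
  next
    assume R: ?R
    show "Q.vanishes gshift X (pbd D) k"
      unfolding Q.vanishes_def
    proof (intro allI impI, elim conjE)
      fix c assume c: "Q.cochain_on gshift (X (Suc k)) c"
        and z: "\<forall>x\<in>X (Suc (Suc k)). lin (\<lambda>r. sc (of_rat r)) c (pbd D (Suc (Suc k)) x) = 0"
      define \<xi> where "\<xi> a = (if a < m (Suc k) then c (0, a) else 0)" for a
      have \<xi>: "\<xi> \<in> tup (m (Suc k))" using c by (auto simp: tup_def \<xi>_def Q.cochain_on_def X_def)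
      have cx: "c (g, a) = rep g (\<xi> a)" if "a < m (Suc k)" for g a
      proof -
        have "c (gshift g (0, a)) = rep g (c (0, a))" using c that unfolding Q.cochain_on_def X_def by blast
        then show ?thesis using that by (simp add: \<xi>_def)
      qed
      have "mact (map_mat complexify (D (Suc (Suc k)))) \<xi> a = 0" for a
      proof (cases "a < m (Suc (Suc k))")
        case True
        have "rep 0 (mact (map_mat complexify (D (Suc (Suc k)))) \<xi> a) = 0"
          using z cochain_pbd[where k = "Suc k" and D = D and g = 0, OF cx \<xi> D True] True by (simp add: X_def)
        moreover have "mact (map_mat complexify (D (Suc (Suc k)))) \<xi> \<in> tup (m (Suc (Suc k)))"
          by (rule mact_tup[OF _ \<xi>]) (use D in auto)
        ultimately show ?thesis using tup_nth rep_zero by metis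
      next
        case False
        then show ?thesis using D[of "Suc k"] by (auto simp: mact_def)
      qed
      then have "mact (map_mat complexify (D (Suc (Suc k)))) \<xi> = 0" by (simp add: fun_eq_iff)
      then obtain \<zeta> where \<zeta>: "\<zeta> \<in> tup (m k)" "\<xi> = mact (map_mat complexify (D (Suc k))) \<zeta>" using R \<xi> by blast
      define b where "b = (\<lambda>(g, a). rep g (\<zeta> a))"
      have "Q.cochain_on gshift (X k) b"
        using tup_nth[OF \<zeta>(1)] by (auto simp: Q.cochain_on_def b_def rep_plus)
      moreover have "\<forall>x\<in>X (Suc k). c x = lin (\<lambda>r. sc (of_rat r)) b (pbd D (Suc k) x)"
        using cx cochain_pbd[where k = k and c = b and D = D, OF _ \<zeta>(1) D] by (auto simp: X_def b_def \<zeta>(2))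
      ultimately show "\<exists>b. Q.cochain_on gshift (X k) b \<and>
          (\<forall>x\<in>X (Suc k). c x = lin (\<lambda>r. sc (of_rat r)) b (pbd D (Suc k) x))" by blast
    qed
  qed
  finally show ?thesis .
qed

text \<open>Cohomology sees only addition, scalars and the group action, so \<theta> is not asked to
  be isometric. The lemma serves both for moving given representations into function spaces and for
  moving constructed ones into \<open>'v\<close>.\<close>

lemma cohomology_iff:
  fixes H :: "('v, 'c) inner_product_space_scheme"
  assumes H: "module complex_ring H"
    and bij: "bij_betw \<theta> S (carrier H)"
    and th_add: "\<And>x y. x \<in> S \<Longrightarrow> y \<in> S \<Longrightarrow> \<theta> (x + y) = \<theta> x \<oplus>\<^bsub>H\<^esub> \<theta> y"
    and th_sc: "\<And>a x. x \<in> S \<Longrightarrow> \<theta> (sc a x) = a \<odot>\<^bsub>H\<^esub> \<theta> x"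
    and th_rep: "\<And>g x. x \<in> S \<Longrightarrow> \<theta> (rep g x) = \<pi> g (\<theta> x)"
  shows "cohomology_vanishes H \<pi> (Suc k) \<longleftrightarrow> std_vanishes sc S rep k"
proof -
  interpret H: module complex_ring H by fact
  have th_S: "\<theta> x \<in> carrier H" if "x \<in> S" for x using bij that by (auto simp: bij_betw_def)
  have inj: "\<theta> x = \<theta> y \<longleftrightarrow> x = y" if "x \<in> S" "y \<in> S" for x y
    using bij that by (auto simp: bij_betw_def inj_on_def)
  define \<theta>' where "\<theta>' = inv_into S \<theta>"
  have th': "\<theta>' y \<in> S" "\<theta> (\<theta>' y) = y" if "y \<in> carrier H" for y
    using bij that unfolding \<theta>'_def by (auto simp: bij_betw_def inv_into_into f_inv_into_f)
  have th0: "\<theta> 0 = \<zero>\<^bsub>H\<^esub>"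
  proof -
    have "\<theta> 0 \<oplus>\<^bsub>H\<^esub> \<theta> 0 = \<theta> 0" using th_add[of 0 0] by simp
    then show ?thesis using th_S[OF S_zero] H.add.l_cancel_one by blast
  qed
  have fin: "finsum H (\<lambda>i. \<theta> (f i)) A = \<theta> (sum f A)" if "finite A" "\<And>i. i \<in> A \<Longrightarrow> f i \<in> S"
    for f and A :: "nat set"
    using that
  proof (induction A)
    case empty
    then show ?case by (simp add: th0)
  next
    case (insert i A)
    have "finsum H (\<lambda>i. \<theta> (f i)) (insert i A) = \<theta> (f i) \<oplus>\<^bsub>H\<^esub> finsum H (\<lambda>i. \<theta> (f i)) A"
      by (rule H.finsum_insert) (use insert th_S in auto)
    then show ?case using insert by (simp add: th_add)
  qed
  \<comment> \<open>Values of a cochain on lists of other lengths are arbitrary, hence the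
    hypothesis on just the lengths that occur in the boundary.\<close>
  have cob: "coboundary H (\<lambda>xs. \<theta> (c xs)) xs = \<theta> (lin (\<lambda>r. sc (of_rat r)) c (lbd xs))"
    if c: "\<And>ys. Suc (length ys) = length xs \<Longrightarrow> c ys \<in> S" for c xs
  proof -
    have cS: "c (take i xs @ drop (Suc i) xs) \<in> S" if "i \<in> {..<length xs}" for i
      by (rule c) (use that in auto)
    have "coboundary H (\<lambda>xs. \<theta> (c xs)) xs =
        finsum H (\<lambda>i. \<theta> (sc ((- 1) ^ i) (c (take i xs @ drop (Suc i) xs)))) {..<length xs}"
      unfolding coboundary_def by (rule H.finsum_cong') (use cS th_S th_sc in \<open>auto simp flip: th_sc\<close>)
    also have "\<dots> = \<theta> (\<Sum>i<length xs. sc ((- 1) ^ i) (c (take i xs @ drop (Suc i) xs)))"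
      by (rule fin) (use cS in auto)
    also have "(\<Sum>i<length xs. sc ((- 1) ^ i) (c (take i xs @ drop (Suc i) xs)))
        = lin (\<lambda>r. sc (of_rat r)) c (lbd xs)"
      by (simp add: lbd_sum[of xs] Q.lin_sum of_rat_power of_rat_minus)
    finally show ?thesis .
  qed
  have linS: "lin (\<lambda>r. sc (of_rat r)) c (lbd xs) \<in> S"
    if "\<And>ys. Suc (length ys) = length xs \<Longrightarrow> c ys \<in> S" for c xs
    by (rule Q.lin_S) (use keys_lbd[of xs] that in auto)
  have coch: "cochain H \<pi> j (\<lambda>xs. \<theta> (c xs)) \<longleftrightarrow> Q.cochain_on (\<lambda>g. map ((+) g)) {xs. length xs = Suc j} c"
    if "\<And>xs. length xs = Suc j \<Longrightarrow> c xs \<in> S" for j c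
    using that th_S inj th_rep unfolding cochain_def Q.cochain_on_def by (auto simp flip: th_rep simp: inj)
  show ?thesis
  proof
    assume van: "cohomology_vanishes H \<pi> (Suc k)"
    show "std_vanishes sc S rep k"
      unfolding Q.vanishes_def
    proof (intro allI impI, elim conjE)
      fix c assume c: "Q.cochain_on (\<lambda>g. map ((+) g)) {xs. length xs = Suc (Suc k)} c"
        and z: "\<forall>x\<in>{xs. length xs = Suc (Suc (Suc k))}. lin (\<lambda>r. sc (of_rat r)) c (lbd x) = 0"
      have cS: "\<And>xs. length xs = Suc (Suc k) \<Longrightarrow> c xs \<in> S" using c by (auto simp: Q.cochain_on_def)
      have "cochain H \<pi> (Suc k) (\<lambda>xs. \<theta> (c xs))" using coch[of "Suc k" c] cS c by blast
      moreover have "\<forall>xs. length xs = Suc k + 2 \<longrightarrow> coboundary H (\<lambda>xs. \<theta> (c xs)) xs = \<zero>\<^bsub>H\<^esub>"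
        using cob[of _ c] cS z by (auto simp: th0)
      ultimately obtain b where b: "cochain H \<pi> k b"
        and cb: "\<And>xs. length xs = Suc (Suc k) \<Longrightarrow> \<theta> (c xs) = coboundary H b xs"
        using van unfolding cohomology_vanishes_def by auto
      define b' where "b' xs = \<theta>' (b xs)" for xs
      have bc: "b xs \<in> carrier H" if "length xs = Suc k" for xs using b that by (auto simp: cochain_def)
      have bS: "b' xs \<in> S" "\<theta> (b' xs) = b xs" if "length xs = Suc k" for xs
        using th'[OF bc[OF that]] by (auto simp: b'_def)
      have "cochain H \<pi> k (\<lambda>xs. \<theta> (b' xs))" using b bS(2) unfolding cochain_def by simp
      then have "Q.cochain_on (\<lambda>g. map ((+) g)) {xs. length xs = Suc k} b'" using coch[of k b'] bS(1) by blast
      moreover have "c xs = lin (\<lambda>r. sc (of_rat r)) b' (lbd xs)" if xs: "length xs = Suc (Suc k)" for xs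
      proof -
        have "coboundary H b xs = coboundary H (\<lambda>xs. \<theta> (b' xs)) xs"
          unfolding coboundary_def
          by (rule H.finsum_cong') (use bS bc xs in \<open>auto simp: complex_ring_def intro!: H.smult_closed\<close>)
        also have "\<dots> = \<theta> (lin (\<lambda>r. sc (of_rat r)) b' (lbd xs))" by (rule cob) (use bS xs in auto)
        finally have "\<theta> (c xs) = \<theta> (lin (\<lambda>r. sc (of_rat r)) b' (lbd xs))" using cb[OF xs] by simp
        moreover have "lin (\<lambda>r. sc (of_rat r)) b' (lbd xs) \<in> S" by (rule linS) (use bS xs in auto)
        ultimately show ?thesis using inj cS[OF xs] by blast
      qed
      ultimately show "\<exists>b. Q.cochain_on (\<lambda>g. map ((+) g)) {xs. length xs = Suc k} b \<and>
          (\<forall>x\<in>{xs. length xs = Suc (Suc k)}. c x = lin (\<lambda>r. sc (of_rat r)) b (lbd x))" by blast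
    qed
  next
    assume van: "std_vanishes sc S rep k"
    show "cohomology_vanishes H \<pi> (Suc k)"
      unfolding cohomology_vanishes_def
    proof (intro allI impI, elim conjE)
      fix c assume c: "cochain H \<pi> (Suc k) c"
        and z: "\<forall>xs. length xs = Suc k + 2 \<longrightarrow> coboundary H c xs = \<zero>\<^bsub>H\<^esub>"
      define c' where "c' xs = \<theta>' (c xs)" for xs
      have cc: "c xs \<in> carrier H" if "length xs = Suc (Suc k)" for xs using c that by (auto simp: cochain_def)
      have cS: "c' xs \<in> S" "\<theta> (c' xs) = c xs" if "length xs = Suc (Suc k)" for xs
        using th'[OF cc[OF that]] by (auto simp: c'_def)
      have "cochain H \<pi> (Suc k) (\<lambda>xs. \<theta> (c' xs))" using c cS(2) unfolding cochain_def by simp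
      then have "Q.cochain_on (\<lambda>g. map ((+) g)) {xs. length xs = Suc (Suc k)} c'" using coch[of "Suc k" c'] cS(1) by blast
      moreover have "lin (\<lambda>r. sc (of_rat r)) c' (lbd xs) = 0" if xs: "length xs = Suc (Suc (Suc k))" for xs
      proof -
        have "\<theta> (lin (\<lambda>r. sc (of_rat r)) c' (lbd xs)) = coboundary H (\<lambda>xs. \<theta> (c' xs)) xs"
          by (rule cob[symmetric]) (use cS xs in auto)
        also have "\<dots> = coboundary H c xs"
          unfolding coboundary_def
          by (rule H.finsum_cong') (use cS cc xs in \<open>auto simp: complex_ring_def intro!: H.smult_closed\<close>)
        also have "\<dots> = \<theta> 0" using z xs by (simp add: th0)
        finally have "\<theta> (lin (\<lambda>r. sc (of_rat r)) c' (lbd xs)) = \<theta> 0" .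
        moreover have "lin (\<lambda>r. sc (of_rat r)) c' (lbd xs) \<in> S" by (rule linS) (use cS xs in auto)
        ultimately show ?thesis using inj S_zero by blast
      qed
      ultimately obtain b where b: "Q.cochain_on (\<lambda>g. map ((+) g)) {xs. length xs = Suc k} b"
        and cb: "\<And>xs. length xs = Suc (Suc k) \<Longrightarrow> c' xs = lin (\<lambda>r. sc (of_rat r)) b (lbd xs)"
        using van unfolding Q.vanishes_def by blast
      have bS: "\<And>xs. length xs = Suc k \<Longrightarrow> b xs \<in> S" using b by (auto simp: Q.cochain_on_def)
      have "cochain H \<pi> k (\<lambda>xs. \<theta> (b xs))" using coch[of k b] bS b by blast
      moreover have "c xs = coboundary H (\<lambda>xs. \<theta> (b xs)) xs" if xs: "length xs = Suc (Suc k)" for xs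
        using cob[of xs b] bS xs cb[OF xs] cS(2)[OF xs] by auto
      ultimately show "\<exists>b. cochain H \<pi> (Suc k - 1) b \<and>
          (\<forall>xs. length xs = Suc k + 1 \<longrightarrow> c xs = coboundary H b xs)" by auto
    qed
  qed
qed

end

section \<open>From sums of squares to vanishing\<close>

lemma complexify_zero [simp]: "complexify 0 = 0"
  by (rule poly_mapping_eqI) (simp add: lookup_complexify)

lemma complexify_add: "complexify (p + q) = complexify p + complexify q"
  by (rule poly_mapping_eqI) (simp add: lookup_complexify lookup_add of_rat_add)

lemma complexify_single [simp]: "complexify (Poly_Mapping.single g a) = Poly_Mapping.single g (of_rat a)"
  by (rule poly_mapping_eqI) (simp add: lookup_complexify lookup_single when_def)

lemma complexify_diff: "complexify (p - q) = complexify p - complexify q"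
  by (rule poly_mapping_eqI) (simp add: lookup_complexify lookup_minus of_rat_diff)

lemma complexify_sum: "complexify (\<Sum>i\<in>I. f i) = (\<Sum>i\<in>I. complexify (f i))"
  by (induction I rule: infinite_finite_induct) (auto simp: complexify_add)

lemma complexify_mult: "complexify (p * q) = complexify p * complexify q"
proof (induction p rule: pm_induct)
  case (single x a)
  show ?case
    by (induction q rule: pm_induct)
      (simp_all add: complexify_add distrib_left mult_single of_rat_mult)
qed (simp_all add: complexify_add distrib_right)

abbreviation (input) cD :: "(nat \<Rightarrow> ('g::group_add \<Rightarrow>\<^sub>0 rat) mat) \<Rightarrow> nat \<Rightarrow> ('g \<Rightarrow>\<^sub>0 complex) mat" where
  "cD D k \<equiv> map_mat complexify (D k)"

section \<open>Matrices of the differentials and the augmentation ideal\<close>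

locale based_resolution =
  fixes m :: "nat \<Rightarrow> nat" and D :: "nat \<Rightarrow> ('g::group_add \<Rightarrow>\<^sub>0 rat) mat" and \<eta> :: "('g \<Rightarrow>\<^sub>0 rat) vec \<Rightarrow> rat"
  assumes res: "based_free_resolution m D \<eta>" and m0: "m 0 = 1"
begin

lemma D_carrier: "D (Suc k) \<in> carrier_mat (m (Suc k)) (m k)"
  using res by (simp add: based_free_resolution_def)

lemma cD_carrier: "cD D (Suc k) \<in> carrier_mat (m (Suc k)) (m k)"
  using D_carrier[of k] by simp

lemma res_facts:
  shows eta_scale: "\<And>a v. v \<in> carrier_vec 1 \<Longrightarrow> \<eta> (a \<cdot>\<^sub>v v) = aug a * \<eta> v"
    and eta_surj: "\<eta> ` carrier_vec 1 = UNIV"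
    and im1: "(\<lambda>v. row_mult v (D 1)) ` carrier_vec (m 1) = {v \<in> carrier_vec 1. \<eta> v = 0}"
    and im: "\<And>k. (\<lambda>v. row_mult v (D (Suc (Suc k)))) ` carrier_vec (m (Suc (Suc k))) =
       {v \<in> carrier_vec (m (Suc k)). row_mult v (D (Suc k)) = 0\<^sub>v (m k)}"
  using res unfolding based_free_resolution_def resolves_trivial_def left_linear_to_trivial_def m0 by simp_all

lemma eta_aug: "v \<in> carrier_vec 1 \<Longrightarrow> \<eta> v = aug (v $ 0) * \<eta> (unit_vec 1 0)"
proof -
  assume v: "v \<in> carrier_vec 1"
  have "v = (v $ 0) \<cdot>\<^sub>v unit_vec 1 0" using v by (intro eq_vecI) auto
  then show ?thesis using eta_scale[of "unit_vec 1 0" "v $ 0"] by simp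
qed

lemma eta_iff: "v \<in> carrier_vec 1 \<Longrightarrow> \<eta> v = 0 \<longleftrightarrow> aug (v $ 0) = 0"
proof -
  assume v: "v \<in> carrier_vec 1"
  obtain u where "u \<in> carrier_vec 1" "\<eta> u = 1" using eta_surj by (metis UNIV_I imageE)
  then have "\<eta> (unit_vec 1 0) \<noteq> 0" using eta_aug[of u] by auto
  then show ?thesis using eta_aug[OF v] by simp
qed

text \<open>Exactness in degree 0: \<eta> and \<open>aug\<close> have the same kernel, so the
  augmentation ideal is generated, as a left ideal, by the entries of \<open>D 1\<close>.\<close>

lemma aug_factor:
  assumes "aug p = 0"
  shows "\<exists>v\<in>carrier_vec (m 1). p = (\<Sum>j<m 1. v $ j * D 1 $$ (j, 0))"
proof -
  define w where "w = vec 1 (\<lambda>_. p)"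
  have "w \<in> {v \<in> carrier_vec 1. \<eta> v = 0}" using assms eta_iff[of w] by (simp add: w_def)
  then have "w \<in> (\<lambda>v. row_mult v (D 1)) ` carrier_vec (m 1)" unfolding im1 .
  then obtain v where v: "v \<in> carrier_vec (m 1)" "w = row_mult v (D 1)" by (rule imageE)
  have "p = w $ 0" by (simp add: w_def)
  also have "\<dots> = (\<Sum>j<m 1. v $ j * D 1 $$ (j, 0))"
    unfolding v(2) by (rule row_mult_index) (use D_carrier[of 0] m0 in auto)
  finally show ?thesis using v(1) by blast
qed

lemma aug_D1: "j < m 1 \<Longrightarrow> aug (D 1 $$ (j, 0)) = 0"
proof -
  assume j: "j < m 1"
  have "row_mult (unit_vec (m 1) j) (D 1) \<in> {v \<in> carrier_vec 1. \<eta> v = 0}"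
    unfolding im1[symmetric] by auto
  moreover have "row_mult (unit_vec (m 1) j) (D 1) = row (D 1) j"
    by (rule row_mult_unit) (use D_carrier[of 0] j in auto)
  ultimately show ?thesis using eta_iff[of "row (D 1) j"] D_carrier[of 0] j m0 by simp
qed

lemma D_D: "D (Suc (Suc k)) * D (Suc k) = 0\<^sub>m (m (Suc (Suc k))) (m k)"
proof (rule eq_matI)
  fix i j assume "i < dim_row (0\<^sub>m (m (Suc (Suc k))) (m k))" "j < dim_col (0\<^sub>m (m (Suc (Suc k))) (m k))"
  then have ij: "i < m (Suc (Suc k))" "j < m k" by auto
  let ?r = "row_mult (unit_vec (m (Suc (Suc k))) i) (D (Suc (Suc k)))"
  have "?r \<in> {v \<in> carrier_vec (m (Suc k)). row_mult v (D (Suc k)) = 0\<^sub>v (m k)}"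
    unfolding im[symmetric] by auto
  moreover have r: "?r = row (D (Suc (Suc k))) i" by (rule row_mult_unit[OF D_carrier ij(1)])
  ultimately have z: "row_mult (row (D (Suc (Suc k))) i) (D (Suc k)) $ j = 0" using ij by simp
  have "(D (Suc (Suc k)) * D (Suc k)) $$ (i, j) = row_mult (row (D (Suc (Suc k))) i) (D (Suc k)) $ j"
    unfolding row_mult_index[OF D_carrier ij(2)] mat_mult_index[OF D_carrier D_carrier ij]
    using D_carrier[of "Suc k"] ij by simp
  then show "(D (Suc (Suc k)) * D (Suc k)) $$ (i, j) = 0\<^sub>m (m (Suc (Suc k))) (m k) $$ (i, j)"
    using z ij by simp
qed (use D_carrier[of k] D_carrier[of "Suc k"] in auto)

lemma cD_cD: "cD D (Suc (Suc k)) * cD D (Suc k) = 0\<^sub>m (m (Suc (Suc k))) (m k)"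
proof (rule eq_matI)
  fix i j assume "i < dim_row (0\<^sub>m (m (Suc (Suc k))) (m k))" "j < dim_col (0\<^sub>m (m (Suc (Suc k))) (m k))"
  then have ij: "i < m (Suc (Suc k))" "j < m k" by auto
  have "(cD D (Suc (Suc k)) * cD D (Suc k)) $$ (i, j) = complexify ((D (Suc (Suc k)) * D (Suc k)) $$ (i, j))"
    unfolding mat_mult_index[OF cD_carrier cD_carrier ij] mat_mult_index[OF D_carrier D_carrier ij] complexify_sum
    using D_carrier[of k] D_carrier[of "Suc k"] ij by (intro sum.cong refl) (auto simp: complexify_mult)
  then show "(cD D (Suc (Suc k)) * cD D (Suc k)) $$ (i, j) = 0\<^sub>m (m (Suc (Suc k))) (m k) $$ (i, j)"
    unfolding D_D using ij by simp
qed (use D_carrier[of k] D_carrier[of "Suc k"] in auto)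

definition dd :: "nat \<Rightarrow> 'g \<Rightarrow>\<^sub>0 complex" where
  "dd j = cD D 1 $$ (j, 0)"

definition lap0 :: "'g \<Rightarrow>\<^sub>0 complex" where
  "lap0 = laplace (cD D) 0 $$ (0, 0)"

lemma laplace_carrier: "laplace (cD D) k \<in> carrier_mat (m k) (m k)"
proof (cases k)
  case 0
  have "mat_star (cD D 1) * cD D 1 \<in> carrier_mat (m 0) (m 0)"
    using mult_carrier_mat[OF mat_star_carrier[OF cD_carrier[of 0]] cD_carrier[of 0]] by simp
  then show ?thesis using 0 by simp
next
  case (Suc k')
  have "cD D (Suc k') * mat_star (cD D (Suc k')) \<in> carrier_mat (m k) (m k)"
    using mult_carrier_mat[OF cD_carrier[of k'] mat_star_carrier[OF cD_carrier[of k']]] Suc by simp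
  moreover have "mat_star (cD D (Suc k)) * cD D (Suc k) \<in> carrier_mat (m k) (m k)"
    using mult_carrier_mat[OF mat_star_carrier[OF cD_carrier[of k]] cD_carrier[of k]] by simp
  ultimately show ?thesis using Suc by simp
qed

lemma lap0_sum: "lap0 = (\<Sum>j<m 1. star (dd j) * dd j)"
proof -
  have c: "cD D 1 \<in> carrier_mat (m 1) (m 0)" using cD_carrier[of 0] by simp
  have lt: "0 < m 0" by (simp add: m0)
  show ?thesis
    unfolding lap0_def dd_def laplace.simps mat_mult_index[OF mat_star_carrier[OF c] c lt lt]
    by (intro sum.cong refl) (simp add: mat_star_index[OF cD_carrier[of 0]] m0)
qed

lemma star_lap0: "star lap0 = lap0"
  by (simp add: lap0_sum star_sum star_mult)

text \<open>Used in the form that a vector killed by every \<open>dd j\<close> is killed by every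
  \<open>g - 1\<close>, hence invariant.\<close>

lemma dd_factor: "\<exists>v. Poly_Mapping.single g 1 - 1 = (\<Sum>j<m 1. v j * dd j)"
proof -
  have "aug (Poly_Mapping.single g 1 - 1 :: 'g \<Rightarrow>\<^sub>0 rat) = 0"
    by (simp add: aug_csum csum_diff csum_single flip: single_one)
  from aug_factor[OF this] obtain v where v: "Poly_Mapping.single g 1 - 1 = (\<Sum>j<m 1. v $ j * D 1 $$ (j, 0))" by blast
  have "Poly_Mapping.single g 1 - 1 = complexify (Poly_Mapping.single g 1 - 1)"
    by (simp add: complexify_diff flip: single_one)
  also have "\<dots> = (\<Sum>j<m 1. complexify (v $ j) * dd j)"
    unfolding v complexify_sum complexify_mult dd_def using D_carrier[of 0] m0
    by (intro sum.cong refl) auto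
  finally show ?thesis by (intro exI[of _ "\<lambda>j. complexify (v $ j)"])
qed

end

lemma mat_star_scalar: "mat_star (scalar_mat m a) = scalar_mat m (star a)"
  by (rule eq_matI) (auto simp: mat_star_def scalar_mat_def)

lemma scalar_mat_carrier [simp]: "scalar_mat m a \<in> carrier_mat m m"
  by (simp add: scalar_mat_def)

lemma sum_of_squares_carrier: "set xs \<subseteq> carrier_mat m m \<Longrightarrow> sum_of_squares m xs \<in> carrier_mat m m"
  by (induction xs) (auto simp: sum_of_squares_def)

text \<open>A bounded quadratic form is norm continuous, so nonnegativity passes to the limit. The
  continuity is spelled out as an error bound in \<open>h = s n - x\<close>.\<close>

lemma (in pre_hilbert) quadratic_form_limit:
  assumes E: "\<And>x. x \<in> S \<Longrightarrow> E x \<in> S" "\<And>x y. x \<in> S \<Longrightarrow> y \<in> S \<Longrightarrow> E (x + y) = E x + E y"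
    "\<And>x. x \<in> S \<Longrightarrow> nrm ip (E x) \<le> K * nrm ip x"
    and s: "\<And>n. s n \<in> S" "(\<lambda>n. nrm ip (s n - x)) \<longlonglongrightarrow> 0" "\<And>n. 0 \<le> Re (ip (E (s n)) (s n))" and x: "x \<in> S"
  shows "0 \<le> Re (ip (E x) x)"
proof -
  have b: "- Re (ip (E x) x) \<le> nrm ip (E x) * nrm ip (s n - x) + K * nrm ip (s n - x) * nrm ip x
      + K * nrm ip (s n - x) * nrm ip (s n - x)" for n
  proof -
    define h where "h = s n - x"
    have h: "h \<in> S" "s n = x + h" using s(1) x by (auto simp: h_def)
    have "ip (E (s n)) (s n) = ip (E x) x + ip (E x) h + ip (E h) x + ip (E h) h"
      using h x E(1) by (simp add: E(2) ip_add ip_add_right)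
    then have "0 \<le> Re (ip (E x) x) + Re (ip (E x) h) + Re (ip (E h) x) + Re (ip (E h) h)"
      using s(3)[of n] by simp
    moreover have cs: "Re (ip u v) \<le> nrm ip u * nrm ip v" if "u \<in> S" "v \<in> S" for u v
      using cauchy_schwarz[OF that] complex_Re_le_cmod order_trans by blast
    have "Re (ip (E x) h) \<le> nrm ip (E x) * nrm ip h" using cs E(1) x h by blast
    moreover have "Re (ip (E h) v) \<le> K * nrm ip h * nrm ip v" if "v \<in> S" for v
      using cs[OF E(1)[OF h(1)] that] mult_right_mono[OF E(3)[OF h(1)] nrm_nonneg[OF that]] by linarith
    from this[OF x] this[OF h(1)]
    have "Re (ip (E h) x) \<le> K * nrm ip h * nrm ip x" "Re (ip (E h) h) \<le> K * nrm ip h * nrm ip h" .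
    ultimately show ?thesis unfolding h_def[symmetric] by linarith
  qed
  have "(\<lambda>n. nrm ip (E x) * nrm ip (s n - x) + K * nrm ip (s n - x) * nrm ip x
      + K * nrm ip (s n - x) * nrm ip (s n - x)) \<longlonglongrightarrow> nrm ip (E x) * 0 + K * 0 * nrm ip x + K * 0 * 0"
    by (intro tendsto_intros s(2))
  then have "- Re (ip (E x) x) \<le> nrm ip (E x) * 0 + K * 0 * nrm ip x + K * 0 * 0"
    by (rule Lim_bounded2[where N = 0]) (use b in auto)
  then show ?thesis by simp
qed

section \<open>Sums of squares inside a representation\<close>

context unirep
begin

text \<open>Each square contributes the squared norm of \<open>mact x \<xi>\<close>.\<close>

lemma sos_positive:
  assumes xs: "set xs \<subseteq> carrier_mat m m" and \<xi>: "\<xi> \<in> tup m"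
  shows "0 \<le> Re (tip m (mact (sum_of_squares m xs) \<xi>) \<xi>)"
  using xs
proof (induction xs)
  case Nil
  have "mact (0\<^sub>m m m) \<xi> = 0" by (auto simp: mact_def fun_eq_iff)
  then show ?case by (simp add: sum_of_squares_def tip_def tup_nth[OF \<xi>])
next
  case (Cons x xs)
  interpret T: pre_hilbert tsc "tup m" "tip m" by (rule tup_pre_hilbert)
  have x: "x \<in> carrier_mat m m" and xs: "sum_of_squares m xs \<in> carrier_mat m m"
    using Cons sum_of_squares_carrier by auto
  note sx = mat_star_carrier[OF x]
  have "mact (sum_of_squares m (x # xs)) \<xi> = mact (mat_star x) (mact x \<xi>) + mact (sum_of_squares m xs) \<xi>"
    using mact_add_mat[OF mult_carrier_mat[OF sx x] xs] mact_mult[OF sx x \<xi>] by (simp add: sum_of_squares_def)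
  moreover have "tip m (mact (mat_star x) (mact x \<xi>)) \<xi> = tip m (mact x \<xi>) (mact x \<xi>)"
    using mact_adjoint[OF sx mact_tup[OF x \<xi>] \<xi>] by simp
  ultimately have "tip m (mact (sum_of_squares m (x # xs)) \<xi>) \<xi> =
      tip m (mact x \<xi>) (mact x \<xi>) + tip m (mact (sum_of_squares m xs) \<xi>) \<xi>"
    using T.ip_add[OF mact_tup[OF sx mact_tup[OF x \<xi>]] mact_tup[OF xs \<xi>] \<xi>] by simp
  then show ?case using T.ip_nonneg[OF mact_tup[OF x \<xi>]] Cons by simp
qed

text \<open>The outer factors are self-adjoint and move into the two arguments of the inner product.
  This is why the lower bound is obtained only for tuples in the image of \<open>a\<close>.\<close>

lemma gap_on_image:
  assumes A: "A \<in> carrier_mat m m" and xs: "set xs \<subseteq> carrier_mat m m" and a: "star a = a"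
    and sos: "scalar_mat m a * (A - scalar_mat m (Poly_Mapping.single 0 (of_real \<epsilon>))) * scalar_mat m a = sum_of_squares m xs"
    and \<xi>: "\<xi> \<in> tup m" and \<zeta>: "\<zeta> = (\<lambda>i. act a (\<xi> i))"
  shows "\<epsilon> * (nrm (tip m) \<zeta>)\<^sup>2 \<le> Re (tip m (mact A \<zeta>) \<zeta>)"
proof -
  interpret T: pre_hilbert tsc "tup m" "tip m" by (rule tup_pre_hilbert)
  let ?s = "scalar_mat m a" and ?e = "scalar_mat m (Poly_Mapping.single 0 (of_real \<epsilon>))"
  have s: "?s \<in> carrier_mat m m" and e: "?e \<in> carrier_mat m m" by auto
  have B: "A - ?e \<in> carrier_mat m m" by (rule minus_carrier_mat[OF e])
  have \<zeta>': "\<zeta> = mact ?s \<xi>" and \<zeta>t: "\<zeta> \<in> tup m"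
    unfolding \<zeta> using mact_scalar[OF \<xi>] mact_tup[OF s \<xi>] by auto
  have "0 \<le> Re (tip m (mact (?s * (A - ?e) * ?s) \<xi>) \<xi>)" unfolding sos by (rule sos_positive[OF xs \<xi>])
  also have "mact (?s * (A - ?e) * ?s) \<xi> = mact ?s (mact (A - ?e) \<zeta>)"
    using mact_mult[OF mult_carrier_mat[OF s B] s \<xi>] mact_mult[OF s B \<zeta>t] \<zeta>' by simp
  also have "tip m (mact ?s (mact (A - ?e) \<zeta>)) \<xi> = tip m (mact (A - ?e) \<zeta>) \<zeta>"
    using mact_adjoint[OF s mact_tup[OF B \<zeta>t] \<xi>] \<zeta>' a by (simp add: mat_star_scalar)
  also have "mact (A - ?e) \<zeta> = mact A \<zeta> - tsc (of_real \<epsilon>) \<zeta>"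
    unfolding mact_diff_mat[OF A e] mact_scalar[OF \<zeta>t] tsc_def using tup_nth[OF \<zeta>t] by (simp add: rep_zero)
  also have "tip m (mact A \<zeta> - tsc (of_real \<epsilon>) \<zeta>) \<zeta> = tip m (mact A \<zeta>) \<zeta> - of_real \<epsilon> * tip m \<zeta> \<zeta>"
    using T.ip_diff_left[OF mact_tup[OF A \<zeta>t] T.S_scale[OF \<zeta>t] \<zeta>t] T.ip_scale[OF \<zeta>t \<zeta>t] by simp
  finally show ?thesis unfolding T.nrm_sq[OF \<zeta>t] by simp
qed

end

section \<open>The Laplace operators in the presence of a gap\<close>

context based_resolution
begin

definition sos_gap :: "nat \<Rightarrow> bool" where
  "sos_gap k \<longleftrightarrow> (\<exists>\<epsilon>::real. \<epsilon> > 0 \<and> (\<exists>xs. set xs \<subseteq> carrier_mat (m k) (m k) \<and>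
        scalar_mat (m k) lap0 * (laplace (cD D) k - scalar_mat (m k) (Poly_Mapping.single 0 (of_real \<epsilon>)))
            * scalar_mat (m k) lap0 = sum_of_squares (m k) xs))"

text \<open>The form of Delta_0 at \<open>x\<close> is the sum of the squared norms of
  \<open>act (dd j) x\<close>. If it is 0, every \<open>dd j\<close>, and with it every
  \<open>g - 1\<close>, kills \<open>x\<close>.\<close>

lemma lap0_kernel:
  assumes "unirep sc S ip rep" and free: "unirep.invariant_free S rep"
    and x: "x \<in> S" and z: "unirep.act sc rep lap0 x = 0"
  shows "x = 0"
proof -
  interpret unirep sc S ip rep by fact
  have eq: "ip (act lap0 x) x = (\<Sum>j<m 1. ip (act (dd j) x) (act (dd j) x))"
    unfolding lap0_sum act_sum_left using x by (simp add: ip_sum_left act_mult ip_act)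
  have "(\<Sum>j<m 1. Re (ip (act (dd j) x) (act (dd j) x))) = Re (ip (act lap0 x) x)"
    unfolding eq by simp
  then have "(\<Sum>j<m 1. Re (ip (act (dd j) x) (act (dd j) x))) = 0" using z x by simp
  then have d0: "act (dd j) x = 0" if "j < m 1" for j
    using that x ip_definite[of "act (dd j) x"] by (simp add: sum_nonneg_eq_0_iff ip_nonneg)
  have "rep g x = x" for g
  proof -
    obtain v where v: "Poly_Mapping.single g 1 - 1 = (\<Sum>j<m 1. v j * dd j)" using dd_factor by blast
    have "act (Poly_Mapping.single g 1 - 1) x = 0"
      unfolding v act_sum_left using x d0 by (simp add: act_mult)
    then show ?thesis using x by (simp add: act_diff_left rep_zero flip: single_one)
  qed
  then show "x = 0" using free x by (simp add: invariant_free_def)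
qed

text \<open>At first the gap is known on the image of Delta_0 only. Solving
  \<open>act lap0 z = act lap0 x\<close> by approximations from that image, and using injectivity,
  shows that the image is dense. Continuity spreads the gap to all of \<open>S\<close>, where the
  equation is solved a second time.\<close>

lemma lap0_surj:
  assumes "unirep sc S ip rep" and free: "unirep.invariant_free S rep" and gap: "sos_gap 0" and y: "y \<in> S"
  shows "\<exists>x\<in>S. unirep.act sc rep lap0 x = y"
proof -
  interpret unirep sc S ip rep by fact
  obtain \<epsilon> xs where eps: "\<epsilon> > 0" and xs: "set xs \<subseteq> carrier_mat (m 0) (m 0)"
    and sos: "scalar_mat (m 0) lap0 * (laplace (cD D) 0 - scalar_mat (m 0) (Poly_Mapping.single 0 (of_real \<epsilon>)))
            * scalar_mat (m 0) lap0 = sum_of_squares (m 0) xs"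
    using gap unfolding sos_gap_def by blast
  define Y where "Y = act lap0 ` S"
  have gapY: "\<epsilon> * (nrm ip u)\<^sup>2 \<le> Re (ip (act lap0 u) u)" if "u \<in> Y" for u
  proof -
    obtain x where x: "x \<in> S" "u = act lap0 x" using \<open>u \<in> Y\<close> by (auto simp: Y_def)
    define \<xi> where "\<xi> i = (if i = 0 then x else 0)" for i :: nat
    define \<zeta> where "\<zeta> = (\<lambda>i. act lap0 (\<xi> i))"
    have \<xi>: "\<xi> \<in> tup (m 0)" using x by (auto simp: tup_def \<xi>_def m0)
    have \<zeta>: "\<zeta> \<in> tup (m 0)" using x by (auto simp: tup_def \<zeta>_def \<xi>_def m0)
    have z0: "\<zeta> 0 = u" by (simp add: \<zeta>_def \<xi>_def x)
    have "\<epsilon> * (nrm (tip (m 0)) \<zeta>)\<^sup>2 \<le> Re (tip (m 0) (mact (laplace (cD D) 0) \<zeta>) \<zeta>)"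
      by (rule gap_on_image[OF laplace_carrier xs star_lap0 sos \<xi> \<zeta>_def])
    moreover have "mact (laplace (cD D) 0) \<zeta> 0 = act lap0 u"
      using mact_nth[OF laplace_carrier[of 0], of 0 \<zeta>] by (simp add: m0 z0 lap0_def del: laplace.simps)
    ultimately show ?thesis unfolding tup_nrm_sq[OF \<zeta>] by (simp add: tip_def m0 z0 del: laplace.simps)
  qed
  obtain R where R: "\<And>x. x \<in> S \<Longrightarrow> nrm ip (act lap0 x) \<le> R * nrm ip x" using act_bounded by blast
  have Y: "Y \<subseteq> S" "0 \<in> Y" "\<And>x y. x \<in> Y \<Longrightarrow> y \<in> Y \<Longrightarrow> x + y \<in> Y" "\<And>a x. x \<in> Y \<Longrightarrow> sc a x \<in> Y"
    unfolding Y_def using act_add act_scale act_zero S_zero S_add S_scale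
    by (auto intro: image_eqI[of _ _ 0] simp flip: act_add act_scale)
  have Y5: "act lap0 x \<in> Y" if "x \<in> Y" for x using that Y(1) by (auto simp: Y_def)
  have solve: "\<exists>z\<in>S. act lap0 z = y \<and> (\<exists>s. (\<forall>n. s n \<in> Z) \<and> (\<lambda>n. nrm ip (s n - z)) \<longlonglongrightarrow> 0)"
    if "Z \<subseteq> S" "0 \<in> Z" "\<And>x y. x \<in> Z \<Longrightarrow> y \<in> Z \<Longrightarrow> x + y \<in> Z" "\<And>a x. x \<in> Z \<Longrightarrow> sc a x \<in> Z"
      "\<And>x. x \<in> Z \<Longrightarrow> act lap0 x \<in> Z" "\<And>u. u \<in> Z \<Longrightarrow> \<epsilon> * (nrm ip u)\<^sup>2 \<le> Re (ip (act lap0 u) u)" "y \<in> Z" for Z y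
    by (rule coercive_solve[of "act lap0" R Z \<epsilon> y]) (use that R eps act_add act_scale in auto)
  have "\<epsilon> * (nrm ip x)\<^sup>2 \<le> Re (ip (act lap0 x) x)" if x: "x \<in> S" for x
  proof -
    obtain z s where z: "z \<in> S" "act lap0 z = act lap0 x" and s: "\<And>n. s n \<in> Y" "(\<lambda>n. nrm ip (s n - z)) \<longlonglongrightarrow> 0"
      using solve[OF Y Y5 gapY, of "act lap0 x"] x unfolding Y_def by blast
    have "z - x = 0" by (rule lap0_kernel[OF assms(1,2)]) (use z x in \<open>auto simp: act_diff\<close>)
    then have zx: "z = x" by simp
    define E where "E = act (lap0 - cst (of_real \<epsilon>))"
    have Eu: "Re (ip (E u) u) = Re (ip (act lap0 u) u) - \<epsilon> * (nrm ip u)\<^sup>2" if u: "u \<in> S" for u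
      using u by (simp add: E_def act_diff_left ip_diff_left ip_scale rep_zero nrm_sq)
    obtain K where K: "\<And>x. x \<in> S \<Longrightarrow> nrm ip (E x) \<le> K * nrm ip x" using act_bounded unfolding E_def by blast
    have "0 \<le> Re (ip (E x) x)"
      by (rule quadratic_form_limit[of E K s])
        (use s Y(1) x zx K gapY Eu in \<open>auto simp: act_add E_def subset_iff\<close>)
    then show ?thesis using Eu[OF x] by simp
  qed
  then show ?thesis using solve[of S y] y by auto
qed

theorem sos_gap_vanishing:
  fixes rep :: "'g \<Rightarrow> 'a::ab_group_add \<Rightarrow> 'a"
  assumes "unirep sc S ip rep" and free: "unirep.invariant_free S rep" and gap: "sos_gap 0" "sos_gap (Suc k)"
  shows "std_vanishes sc S rep k"
proof -
  interpret unirep sc S ip rep by fact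
  interpret T: hilbert tsc "tup (m (Suc k))" "tip (m (Suc k))" by (rule tup_hilbert)
  let ?L = "laplace (cD D) (Suc k)" and ?m = "m (Suc k)"
  obtain \<epsilon> xs where eps: "\<epsilon> > 0" and xs: "set xs \<subseteq> carrier_mat ?m ?m"
    and sos: "scalar_mat ?m lap0 * (?L - scalar_mat ?m (Poly_Mapping.single 0 (of_real \<epsilon>)))
            * scalar_mat ?m lap0 = sum_of_squares ?m xs"
    using gap(2) unfolding sos_gap_def by blast
  have gapT: "\<epsilon> * (nrm (tip ?m) \<zeta>)\<^sup>2 \<le> Re (tip ?m (mact ?L \<zeta>) \<zeta>)" if \<zeta>: "\<zeta> \<in> tup ?m" for \<zeta>
  proof -
    \<comment> \<open>Delta_0 is onto, so every tuple is an image and the gap holds without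
      restriction.\<close>
    have "\<forall>i. \<exists>x\<in>S. act lap0 x = \<zeta> i" using lap0_surj[OF assms(1,2) gap(1)] tup_nth[OF \<zeta>] by blast
    then obtain f where f: "\<And>i. f i \<in> S" "\<And>i. act lap0 (f i) = \<zeta> i" by metis
    define \<xi> where "\<xi> i = (if i < ?m then f i else 0)" for i
    have \<xi>: "\<xi> \<in> tup ?m" using f by (auto simp: tup_def \<xi>_def)
    have "\<zeta> = (\<lambda>i. act lap0 (\<xi> i))" using f \<zeta> by (auto simp: \<xi>_def tup_def fun_eq_iff)
    then show ?thesis by (rule gap_on_image[OF laplace_carrier xs star_lap0 sos \<xi>])
  qed
  obtain R where R: "\<And>\<xi>. \<xi> \<in> tup ?m \<Longrightarrow> nrm (tip ?m) (mact ?L \<xi>) \<le> R * nrm (tip ?m) \<xi>"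
    using mact_bounded[OF laplace_carrier] by blast
  note C = cD_carrier[of k] and C' = cD_carrier[of "Suc k"]
  show ?thesis
    unfolding vanishing_iff[OF res m0]
  proof (intro ballI impI)
    fix \<xi> assume \<xi>: "\<xi> \<in> tup ?m" and z: "mact (cD D (Suc (Suc k))) \<xi> = 0"
    have "\<exists>\<zeta>\<in>tup ?m. mact ?L \<zeta> = \<xi> \<and> (\<exists>s. (\<forall>n. s n \<in> tup ?m) \<and> (\<lambda>n. nrm (tip ?m) (s n - \<zeta>)) \<longlonglongrightarrow> 0)"
      by (rule T.coercive_solve[of "mact ?L" R "tup ?m" \<epsilon> \<xi>])
        (use \<xi> R gapT eps mact_add mact_scale mact_tup[OF laplace_carrier[of "Suc k"]] in
          \<open>auto simp del: laplace.simps\<close>)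
    then obtain \<zeta> where \<zeta>: "\<zeta> \<in> tup ?m" "mact ?L \<zeta> = \<xi>" by blast
    define u where "u = mact (mat_star (cD D (Suc k))) \<zeta>"
    define v where "v = mact (cD D (Suc (Suc k))) \<zeta>"
    \<comment> \<open>The part of Delta \<zeta> that has to vanish. It is a cocycle, as \<xi> minus
      a coboundary, and it lies in the image of the adjoint differential, so it is orthogonal to
      itself.\<close>
    define y where "y = mact (mat_star (cD D (Suc (Suc k)))) v"
    have u: "u \<in> tup (m k)" unfolding u_def by (rule mact_tup[OF mat_star_carrier[OF C] \<zeta>(1)])
    have v: "v \<in> tup (m (Suc (Suc k)))" unfolding v_def by (rule mact_tup[OF C' \<zeta>(1)])
    have y: "y \<in> tup ?m" unfolding y_def by (rule mact_tup[OF mat_star_carrier[OF C'] v])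
    have cu: "mact (cD D (Suc k)) u \<in> tup ?m" by (rule mact_tup[OF C u])
    have \<xi>_eq: "\<xi> = mact (cD D (Suc k)) u + y"
      using \<zeta>(2) mact_add_mat[OF mult_carrier_mat[OF C mat_star_carrier[OF C]] mult_carrier_mat[OF mat_star_carrier[OF C'] C']]
      by (simp add: mact_mult[OF C mat_star_carrier[OF C] \<zeta>(1)] mact_mult[OF mat_star_carrier[OF C'] C' \<zeta>(1)]
          u_def v_def y_def)
    have "mact (cD D (Suc (Suc k))) (mact (cD D (Suc k)) u) = 0"
      unfolding mact_mult[OF C' C u, symmetric] cD_cD by (auto simp: mact_def fun_eq_iff)
    then have "mact (cD D (Suc (Suc k))) y = 0"
      using z unfolding \<xi>_eq by (simp add: mact_add[OF cu y])
    moreover have "tip ?m y y = tip (m (Suc (Suc k))) v (mact (cD D (Suc (Suc k))) y)"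
      using mact_adjoint[OF mat_star_carrier[OF C'] v y] by (simp add: y_def)
    ultimately have "tip ?m y y = 0" using tup_nth[OF v] by (simp add: tip_def)
    then have "y = 0" using T.ip_definite[OF y] by simp
    then show "\<exists>\<zeta>\<in>tup (m k). \<xi> = mact (cD D (Suc k)) \<zeta>" using \<xi>_eq u by auto
  qed
qed

end

section \<open>Change of the carrier of a Hilbert space\<close>

definition fsc :: "complex \<Rightarrow> ('x \<Rightarrow> complex) \<Rightarrow> ('x \<Rightarrow> complex)" where
  "fsc a f = (\<lambda>x. a * f x)"

lemma fsc_vector_space: "vector_space fsc"
proof
  fix a b :: complex and f g :: "'x \<Rightarrow> complex"
  show "fsc a (f + g) = fsc a f + fsc a g" by (rule ext) (simp add: fsc_def distrib_left)
  show "fsc (a + b) f = fsc a f + fsc b f" by (rule ext) (simp add: fsc_def distrib_right)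
  show "fsc a (fsc b f) = fsc (a * b) f" by (rule ext) (simp add: fsc_def)
  show "fsc 1 f = f" by (rule ext) (simp add: fsc_def)
qed

interpretation fsc: vector_space fsc
  by (rule fsc_vector_space)

text \<open>A Hilbert space is moved into the type of complex functions, where sums need no carrier,
  by sending a vector to the functional that it represents.\<close>

lemma unitary_representation_as_functions:
  fixes H :: "('v, 'b) inner_product_space_scheme" and \<pi> :: "'g::group_add \<Rightarrow> 'v \<Rightarrow> 'v"
  assumes "unitary_representation H \<pi>"
  shows "\<exists>(S :: ('v \<Rightarrow> complex) set) ip rep \<theta>. unirep fsc S ip rep \<and> bij_betw \<theta> S (carrier H) \<and>
    (\<forall>x\<in>S. \<forall>y\<in>S. \<theta> (x + y) = \<theta> x \<oplus>\<^bsub>H\<^esub> \<theta> y) \<and> (\<forall>a. \<forall>x\<in>S. \<theta> (fsc a x) = a \<odot>\<^bsub>H\<^esub> \<theta> x) \<and>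
    (\<forall>g. \<forall>x\<in>S. \<theta> (rep g x) = \<pi> g (\<theta> x))"
proof -
  interpret unitary_representation H \<pi> by fact
  \<comment> \<open>The inner product is linear in its first argument, so \<open>J\<close> is linear
    and not merely conjugate linear.\<close>
  define J where "J x = (\<lambda>y. if y \<in> carrier H then cinner H x y else 0)" for x
  define S where "S = J ` carrier H"
  define \<theta> where "\<theta> = inv_into (carrier H) J"
  define ip where "ip f g = cinner H (\<theta> f) (\<theta> g)" for f g
  define rep where "rep g f = J (\<pi> g (\<theta> f))" for g f
  have [simp]: "a \<odot>\<^bsub>H\<^esub> x \<in> carrier H" if "x \<in> carrier H" for a x
    using smult_closed[of a x] that by (simp add: complex_ring_def)
  have J_add: "J (x \<oplus>\<^bsub>H\<^esub> y) = J x + J y" if "x \<in> carrier H" "y \<in> carrier H" for x y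
    using that by (auto simp: J_def fun_eq_iff cinner_add)
  have J_sc: "J (a \<odot>\<^bsub>H\<^esub> x) = fsc a (J x)" if "x \<in> carrier H" for a x
    using that by (auto simp: J_def fun_eq_iff cinner_smult fsc_def)
  have inj: "inj_on J (carrier H)"
  proof (rule inj_onI)
    fix x y assume xy: "x \<in> carrier H" "y \<in> carrier H" "J x = J y"
    define d where "d = x \<oplus>\<^bsub>H\<^esub> (-1) \<odot>\<^bsub>H\<^esub> y"
    have d: "d \<in> carrier H" using xy by (simp add: d_def)
    have "J d = 0" using xy by (simp add: d_def J_add J_sc fsc_def fun_eq_iff)
    then have "cinner H d d = 0" using d by (metis J_def zero_fun_apply)
    then have "d = \<zero>\<^bsub>H\<^esub>" using cinner_pos[OF d] by force
    moreover have "(-1) \<odot>\<^bsub>H\<^esub> y \<oplus>\<^bsub>H\<^esub> y = \<zero>\<^bsub>H\<^esub>"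
      using smult_l_distr[of "-1" 1 y] smult_one[of y] smult_l_null[of y] xy by (simp add: complex_ring_def)
    moreover have "d \<oplus>\<^bsub>H\<^esub> y = x \<oplus>\<^bsub>H\<^esub> ((-1) \<odot>\<^bsub>H\<^esub> y \<oplus>\<^bsub>H\<^esub> y)" using xy by (simp add: d_def a_assoc)
    ultimately show "x = y" using xy by simp
  qed
  have \<theta>J: "\<theta> (J x) = x" if "x \<in> carrier H" for x using inj that by (simp add: \<theta>_def)
  have \<theta>S: "\<theta> f \<in> carrier H" "J (\<theta> f) = f" if "f \<in> S" for f using that \<theta>J by (auto simp: S_def)
  have JS: "J x \<in> S" if "x \<in> carrier H" for x using that by (simp add: S_def)
  have bij: "bij_betw \<theta> S (carrier H)"
    by (rule bij_betw_byWitness[where f' = J]) (use \<theta>J \<theta>S JS in auto)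
  have S_add: "f + g \<in> S" and \<theta>_add: "\<theta> (f + g) = \<theta> f \<oplus>\<^bsub>H\<^esub> \<theta> g" if "f \<in> S" "g \<in> S" for f g
    using J_add[of "\<theta> f" "\<theta> g"] \<theta>S[OF that(1)] \<theta>S[OF that(2)] \<theta>J[of "\<theta> f \<oplus>\<^bsub>H\<^esub> \<theta> g"] JS[of "\<theta> f \<oplus>\<^bsub>H\<^esub> \<theta> g"] by auto
  have S_sc: "fsc a f \<in> S" and \<theta>_sc: "\<theta> (fsc a f) = a \<odot>\<^bsub>H\<^esub> \<theta> f" if "f \<in> S" for a f
    using J_sc[of "\<theta> f" a] \<theta>S[OF that] \<theta>J[of "a \<odot>\<^bsub>H\<^esub> \<theta> f"] JS[of "a \<odot>\<^bsub>H\<^esub> \<theta> f"] by auto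
  have \<theta>_rep: "\<theta> (rep g f) = \<pi> g (\<theta> f)" and rep_S: "rep g f \<in> S" if "f \<in> S" for g f
    using \<theta>S[OF that] \<theta>J JS rep_closed by (auto simp: rep_def)
  have inj\<theta>: "f = g" if "f \<in> S" "g \<in> S" "\<theta> f = \<theta> g" for f g using \<theta>S that by metis
  have S_0: "0 \<in> S" and \<theta>_0: "\<theta> 0 = \<zero>\<^bsub>H\<^esub>"
  proof -
    have "J \<zero>\<^bsub>H\<^esub> + J \<zero>\<^bsub>H\<^esub> = J \<zero>\<^bsub>H\<^esub>" using J_add[of "\<zero>\<^bsub>H\<^esub>" "\<zero>\<^bsub>H\<^esub>"] by simp
    then have "J \<zero>\<^bsub>H\<^esub> = 0" by simp
    then show "0 \<in> S" "\<theta> 0 = \<zero>\<^bsub>H\<^esub>" using JS[of "\<zero>\<^bsub>H\<^esub>"] \<theta>J[of "\<zero>\<^bsub>H\<^esub>"] by auto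
  qed
  have pre: "pre_hilbert fsc S ip"
  proof
    fix f assume f: "f \<in> S"
    have pos: "\<theta> f \<noteq> \<zero>\<^bsub>H\<^esub> \<Longrightarrow> 0 < Re (cinner H (\<theta> f) (\<theta> f))" using cinner_pos \<theta>S f by blast
    have z: "cinner H \<zero>\<^bsub>H\<^esub> \<zero>\<^bsub>H\<^esub> = 0" using cinner_add[of "\<zero>\<^bsub>H\<^esub>" "\<zero>\<^bsub>H\<^esub>" "\<zero>\<^bsub>H\<^esub>"] by simp
    show "0 \<le> Re (ip f f)" using pos z by (cases "\<theta> f = \<zero>\<^bsub>H\<^esub>") (auto simp: ip_def)
    assume "Re (ip f f) = 0"
    then show "f = 0" using pos inj\<theta>[OF f S_0] \<theta>_0 by (auto simp: ip_def)
  qed (use S_0 S_add S_sc \<theta>S in \<open>auto simp: ip_def \<theta>_add \<theta>_sc cinner_add cinner_smult intro: cinner_commute\<close>)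
  interpret P: pre_hilbert fsc S ip by (rule pre)
  have nrm: "nrm ip f = hnorm H (\<theta> f)" for f by (simp add: nrm_def hnorm_def ip_def)
  have \<theta>_diff: "\<theta> (f - g) = \<theta> f \<ominus>\<^bsub>H\<^esub> \<theta> g" if "f \<in> S" "g \<in> S" for f g
  proof -
    have "\<theta> f = \<theta> (f - g) \<oplus>\<^bsub>H\<^esub> \<theta> g" using \<theta>_add[of "f - g" g] that by simp
    then have "\<theta> f \<ominus>\<^bsub>H\<^esub> \<theta> g = \<theta> (f - g) \<oplus>\<^bsub>H\<^esub> (\<theta> g \<oplus>\<^bsub>H\<^esub> \<ominus>\<^bsub>H\<^esub> \<theta> g)"
      using \<theta>S that by (simp add: a_minus_def a_assoc)
    then show ?thesis using \<theta>S that by (simp add: r_neg)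
  qed
  have "hilbert fsc S ip"
  proof
    fix s :: "nat \<Rightarrow> 'v \<Rightarrow> complex"
    assume s: "\<And>n. s n \<in> S"
      and ca: "\<And>e. 0 < e \<Longrightarrow> \<exists>N. \<forall>p\<ge>N. \<forall>q\<ge>N. nrm ip (s p - s q) < e"
    have "\<exists>l\<in>carrier H. (\<lambda>n. hnorm H (\<theta> (s n) \<ominus>\<^bsub>H\<^esub> l)) \<longlonglongrightarrow> 0"
      by (rule complete) (use \<theta>S s ca in \<open>auto simp: nrm \<theta>_diff\<close>)
    then obtain l where l: "l \<in> carrier H" "(\<lambda>n. hnorm H (\<theta> (s n) \<ominus>\<^bsub>H\<^esub> l)) \<longlonglongrightarrow> 0" by blast
    have "(\<lambda>n. nrm ip (s n - J l)) \<longlonglongrightarrow> 0" using l s JS \<theta>J by (simp add: nrm \<theta>_diff)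
    then show "\<exists>l\<in>S. (\<lambda>n. nrm ip (s n - l)) \<longlonglongrightarrow> 0" using JS[OF l(1)] by blast
  qed
  moreover have "unirep_axioms fsc S ip rep"
  proof
    fix f g h k assume f: "f \<in> S"
    show "rep h f \<in> S" by (rule rep_S[OF f])
    show "rep h (fsc a f) = fsc a (rep h f)" for a
      by (rule inj\<theta>) (use f \<theta>S in \<open>auto simp: rep_S S_sc \<theta>_rep \<theta>_sc rep_smult\<close>)
    show "rep 0 f = f" by (rule inj\<theta>) (use f \<theta>S in \<open>auto simp: rep_S \<theta>_rep rep_one\<close>)
    show "rep (h + k) f = rep h (rep k f)"
      by (rule inj\<theta>) (use f \<theta>S in \<open>auto simp: rep_S \<theta>_rep rep_mult\<close>)
    assume g: "g \<in> S"
    show "rep h (f + g) = rep h f + rep h g"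
      by (rule inj\<theta>) (use f g \<theta>S in \<open>auto simp: rep_S S_add \<theta>_rep \<theta>_add rep_add\<close>)
    show "ip (rep h f) (rep h g) = ip f g" using f g \<theta>S by (simp add: ip_def \<theta>_rep rep_isometric)
  qed
  ultimately have "unirep fsc S ip rep" by (simp add: unirep_def)
  then show ?thesis using bij \<theta>_add \<theta>_sc \<theta>_rep by blast
qed

section \<open>Moving a representation into the universe type\<close>

context unirep
begin

lemma to_unitary_representation:
  fixes \<iota> :: "'a \<Rightarrow> 'v"
  assumes inj: "inj_on \<iota> S"
  shows "\<exists>(H :: 'v inner_product_space) \<pi>. unitary_representation H \<pi> \<and> bij_betw \<iota> S (carrier H) \<and>
    (\<forall>x\<in>S. \<forall>y\<in>S. \<iota> (x + y) = \<iota> x \<oplus>\<^bsub>H\<^esub> \<iota> y) \<and> (\<forall>a. \<forall>x\<in>S. \<iota> (sc a x) = a \<odot>\<^bsub>H\<^esub> \<iota> x) \<and>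
    (\<forall>g. \<forall>x\<in>S. \<iota> (rep g x) = \<pi> g (\<iota> x))"
proof -
  define \<iota>' where "\<iota>' = inv_into S \<iota>"
  have i [simp]: "\<iota>' (\<iota> x) = x" if "x \<in> S" for x using inj that by (simp add: \<iota>'_def)
  define H :: "'v inner_product_space" where
    "H = \<lparr>carrier = \<iota> ` S, mult = (\<lambda>_ _. \<iota> 0), one = \<iota> 0, zero = \<iota> 0, add = (\<lambda>x y. \<iota> (\<iota>' x + \<iota>' y)),
       smult = (\<lambda>a x. \<iota> (sc a (\<iota>' x))), cinner = (\<lambda>x y. ip (\<iota>' x) (\<iota>' y))\<rparr>"
  define \<pi> where "\<pi> g x = \<iota> (rep g (\<iota>' x))" for g x
  have H [simp]: "carrier H = \<iota> ` S" "\<zero>\<^bsub>H\<^esub> = \<iota> 0" "x \<oplus>\<^bsub>H\<^esub> y = \<iota> (\<iota>' x + \<iota>' y)"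
    "a \<odot>\<^bsub>H\<^esub> x = \<iota> (sc a (\<iota>' x))" "cinner H x y = ip (\<iota>' x) (\<iota>' y)" for x y a
    by (simp_all add: H_def)
  have ag: "abelian_group H"
  proof (rule abelian_groupI)
    fix x assume "x \<in> carrier H"
    then obtain u where u: "u \<in> S" "x = \<iota> u" by auto
    then have "\<iota> (- u) \<in> carrier H" "\<iota> (- u) \<oplus>\<^bsub>H\<^esub> x = \<zero>\<^bsub>H\<^esub>" by auto
    then show "\<exists>y\<in>carrier H. y \<oplus>\<^bsub>H\<^esub> x = \<zero>\<^bsub>H\<^esub>" by blast
  qed (auto simp: add_ac)
  have mod: "module complex_ring H"
    by (rule moduleI[OF cring_complex_ring ag])
      (auto simp: complex_ring_def scale_left_distrib scale_right_distrib)
  interpret M: module complex_ring H by (rule mod)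
  have diff: "\<iota> x \<ominus>\<^bsub>H\<^esub> \<iota> y = \<iota> (x - y)" if "x \<in> S" "y \<in> S" for x y
  proof -
    have "\<iota> x = \<iota> (x - y) \<oplus>\<^bsub>H\<^esub> \<iota> y" "\<iota> y \<in> carrier H" "\<iota> (x - y) \<in> carrier H" using that by auto
    then have "\<iota> x \<ominus>\<^bsub>H\<^esub> \<iota> y = \<iota> (x - y) \<oplus>\<^bsub>H\<^esub> (\<iota> y \<oplus>\<^bsub>H\<^esub> \<ominus>\<^bsub>H\<^esub> \<iota> y)"
      unfolding a_minus_def by (metis M.a_assoc M.a_inv_closed)
    also have "\<dots> = \<iota> (x - y)" using that M.r_neg[of "\<iota> y"] by simp
    finally show ?thesis .
  qed
  have hn: "hnorm H (\<iota> x) = nrm ip x" if "x \<in> S" for x using that by (simp add: hnorm_def nrm_def)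
  have "complex_hilbert_space_axioms H"
  proof
    fix x y z a assume "x \<in> carrier H" "y \<in> carrier H"
    then obtain u v where uv: "u \<in> S" "x = \<iota> u" "v \<in> S" "y = \<iota> v" by auto
    show "cinner H (a \<odot>\<^bsub>H\<^esub> x) y = a * cinner H x y" using uv by (simp add: ip_scale)
    show "cinner H y x = cnj (cinner H x y)" using uv ip_commute[of u v] by simp
    assume "z \<in> carrier H"
    then obtain w where "w \<in> S" "z = \<iota> w" by auto
    then show "cinner H (x \<oplus>\<^bsub>H\<^esub> y) z = cinner H x z + cinner H y z" using uv by (simp add: ip_add)
  next
    fix x assume "x \<in> carrier H" and n: "x \<noteq> \<zero>\<^bsub>H\<^esub>"
    then obtain u where u: "u \<in> S" "x = \<iota> u" by auto
    then show "0 < Re (cinner H x x)" using n ip_nonneg[of u] ip_definite[of u] by fastforce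
  next
    fix s :: "nat \<Rightarrow> 'v"
    assume s: "\<And>n. s n \<in> carrier H"
      and ca: "\<And>e. 0 < e \<Longrightarrow> \<exists>N. \<forall>p\<ge>N. \<forall>q\<ge>N. hnorm H (s p \<ominus>\<^bsub>H\<^esub> s q) < e"
    have "\<forall>n. \<exists>t\<in>S. s n = \<iota> t" using s by auto
    then obtain t where t: "\<And>n. t n \<in> S" "\<And>n. s n = \<iota> (t n)" by metis
    have "\<exists>l\<in>S. (\<lambda>n. nrm ip (t n - l)) \<longlonglongrightarrow> 0"
      by (rule complete) (use t ca in \<open>auto simp: diff hn\<close>)
    then obtain l where "l \<in> S" "(\<lambda>n. nrm ip (t n - l)) \<longlonglongrightarrow> 0" by blast
    then show "\<exists>l\<in>carrier H. (\<lambda>n. hnorm H (s n \<ominus>\<^bsub>H\<^esub> l)) \<longlonglongrightarrow> 0"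
      using t by (intro bexI[of _ "\<iota> l"]) (auto simp: diff hn)
  qed
  then have "complex_hilbert_space H" using mod by (simp add: complex_hilbert_space_def)
  moreover have "unitary_representation_axioms H \<pi>"
  proof
    fix g h x y a assume "x \<in> carrier H" "y \<in> carrier H"
    then obtain u v where uv: "u \<in> S" "x = \<iota> u" "v \<in> S" "y = \<iota> v" by auto
    show "\<pi> g (x \<oplus>\<^bsub>H\<^esub> y) = \<pi> g x \<oplus>\<^bsub>H\<^esub> \<pi> g y" using uv by (simp add: \<pi>_def rep_add)
    show "cinner H (\<pi> g x) (\<pi> g y) = cinner H x y" using uv by (simp add: \<pi>_def rep_ip)
  next
    fix g h x a assume "x \<in> carrier H"
    then obtain u where u: "u \<in> S" "x = \<iota> u" by auto
    show "\<pi> g x \<in> carrier H" "\<pi> g (a \<odot>\<^bsub>H\<^esub> x) = a \<odot>\<^bsub>H\<^esub> \<pi> g x" "\<pi> 0 x = x"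
      "\<pi> (g + h) x = \<pi> g (\<pi> h x)"
      using u by (simp_all add: \<pi>_def rep_scale rep_zero rep_plus)
  qed
  ultimately have "unitary_representation H \<pi>" by (simp add: unitary_representation_def)
  moreover have "bij_betw \<iota> S (carrier H)" using inj by (simp add: bij_betw_def)
  ultimately show ?thesis
    by (intro exI[of _ H] exI[of _ \<pi>]) (simp add: \<pi>_def)
qed

text \<open>The form in which property (T_n) is exploited: it applies to every representation
  without invariant vectors whose vectors inject into \<open>'v\<close>, however the representation
  was built.\<close>

lemma property_T_vanishing:
  fixes \<iota> :: "'a \<Rightarrow> 'v"
  assumes T: "property_T TYPE('v) TYPE('g) n" and k: "Suc k \<le> n"
    and inj: "inj_on \<iota> S" and free: invariant_free
  shows "std_vanishes sc S rep k"
proof -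
  obtain H :: "'v inner_product_space" and \<pi> where u: "unitary_representation H \<pi>" and
    bij: "bij_betw \<iota> S (carrier H)" and add: "\<forall>x\<in>S. \<forall>y\<in>S. \<iota> (x + y) = \<iota> x \<oplus>\<^bsub>H\<^esub> \<iota> y" and
    scale: "\<forall>a. \<forall>x\<in>S. \<iota> (sc a x) = a \<odot>\<^bsub>H\<^esub> \<iota> x" and rep: "\<forall>g. \<forall>x\<in>S. \<iota> (rep g x) = \<pi> g (\<iota> x)"
    using to_unitary_representation[OF inj] by blast
  interpret H: unitary_representation H \<pi> by fact
  have mod: "module complex_ring H" by (rule H.module_axioms)
  have z: "\<iota> 0 = \<zero>\<^bsub>H\<^esub>"
  proof -
    have "\<iota> (0 + 0) = \<iota> 0 \<oplus>\<^bsub>H\<^esub> \<iota> 0" using add S_zero by blast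
    then have "\<iota> 0 \<oplus>\<^bsub>H\<^esub> \<iota> 0 = \<iota> 0" by simp
    moreover have "\<iota> 0 \<in> carrier H" using bij by (auto simp: bij_betw_def)
    ultimately show ?thesis using H.add.l_cancel_one by blast
  qed
  have "no_invariant_vectors H \<pi>"
    unfolding no_invariant_vectors_def
  proof (intro ballI impI)
    fix x assume x: "x \<in> carrier H" "\<forall>g. \<pi> g x = x"
    then obtain v where v: "v \<in> S" "x = \<iota> v" using bij by (auto simp: bij_betw_def)
    have "rep g v = v" for g using x(2) v rep inj by (metis inj_onD rep_S)
    then have "v = 0" using free v(1) unfolding invariant_free_def by blast
    then show "x = \<zero>\<^bsub>H\<^esub>" using v(2) z by simp
  qed
  then have "cohomology_vanishes H \<pi> (Suc k)" using T u k unfolding property_T_def by auto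
  then show ?thesis
    using cohomology_iff[OF mod bij, of \<pi> k] add scale rep by blast
qed

end

section \<open>Completion\<close>

text \<open>A function on a countable set is coded by the rational lower cuts of its real and
  imaginary parts, hence by a set of natural numbers, hence by a real. This lets the completions fit
  into \<open>'v\<close>.\<close>

lemma countable_functions_embed:
  assumes "\<exists>f :: real \<Rightarrow> 'v. inj f"
  shows "\<exists>\<iota> :: ('x::countable \<Rightarrow> complex) \<Rightarrow> 'v. inj \<iota>"
proof -
  obtain f :: "real \<Rightarrow> 'v" where f: "inj f" using assms by blast
  obtain h :: "nat set \<Rightarrow> real" where h: "inj h"
    using nat_sets_eqpoll_reals unfolding eqpoll_def bij_betw_def by blast
  define k :: "('x \<Rightarrow> complex) \<Rightarrow> nat set" where
    "k F = {to_nat (x, b, q) | x b (q :: rat). of_rat q < (if b then Re (F x) else Im (F x))}" for F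
  have mem: "to_nat (x, b, q) \<in> k F \<longleftrightarrow> of_rat q < (if b then Re (F x) else Im (F x))" for x b q F
    by (auto simp: k_def)
  have "inj k"
  proof (rule injI, rule ext)
    fix F G x assume eq: "k F = k G"
    have cut: "r = s" if "\<And>q :: rat. of_rat q < r \<longleftrightarrow> of_rat q < s" for r s :: real
    proof (rule antisym; rule ccontr)
      assume "\<not> r \<le> s"
      then show False using that of_rat_dense[of s r] by (metis not_le order.asym)
    next
      assume "\<not> s \<le> r"
      then show False using that of_rat_dense[of r s] by (metis not_le order.asym)
    qed
    have "Re (F x) = Re (G x)" by (rule cut) (use mem[of x True _ F] mem[of x True _ G] eq in auto)
    moreover have "Im (F x) = Im (G x)" by (rule cut) (use mem[of x False _ F] mem[of x False _ G] eq in auto)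
    ultimately show "F x = G x" by (simp add: complex_eq_iff)
  qed
  then have "inj (f \<circ> h \<circ> k)" using f h by (intro inj_compose)
  then show ?thesis by blast
qed

text \<open>An element \<open>f\<close> of the completion is encoded by its inner products \<open>f x\<close> with the basis
  vectors \<open>x\<close>. This keeps the underlying set within the cardinality of the continuum when there
  are countably many basis vectors.\<close>

locale invariant_form =
  fixes Q :: "('x \<Rightarrow>\<^sub>0 complex) \<Rightarrow> ('x \<Rightarrow>\<^sub>0 complex) \<Rightarrow> complex"
    and U :: "'g::group_add \<Rightarrow> ('x \<Rightarrow>\<^sub>0 complex) \<Rightarrow> ('x \<Rightarrow>\<^sub>0 complex)"
  assumes Q_add: "Q (c + c') d = Q c d + Q c' d" and Q_psc: "Q (psc a c) d = a * Q c d"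
    and Q_commute: "Q d c = cnj (Q c d)" and Q_pos: "0 \<le> Re (Q c c)"
    and U_add: "U g (c + d) = U g c + U g d" and U_psc: "U g (psc a c) = psc a (U g c)"
    and U_zero: "U 0 c = c" and U_plus: "U (g + h) c = U g (U h c)" and U_iso: "Q (U g c) (U g d) = Q c d"
begin

sublocale E: semi_hilbert psc UNIV Q
  by standard (auto simp: Q_add Q_psc Q_commute[symmetric] intro: Q_pos)

definition emb :: "('x \<Rightarrow>\<^sub>0 complex) \<Rightarrow> 'x \<Rightarrow> complex" where
  "emb c = (\<lambda>y. Q c (Poly_Mapping.single y 1))"

text \<open>The inner product of a completed vector with a finite combination of basis vectors,
  recovered from the code of the vector; conjugate linear in \<open>d\<close>.\<close>

definition pair :: "('x \<Rightarrow> complex) \<Rightarrow> ('x \<Rightarrow>\<^sub>0 complex) \<Rightarrow> complex" where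
  "pair f d = (\<Sum>y\<in>Poly_Mapping.keys d. cnj (Poly_Mapping.lookup d y) * f y)"

lemma pair_emb: "pair (emb c) d = Q c d"
proof -
  have "Q c d = Q c (\<Sum>y\<in>Poly_Mapping.keys d. psc (Poly_Mapping.lookup d y) (Poly_Mapping.single y 1))"
    using poly_mapping_expand[of d] by simp
  also have "\<dots> = pair (emb c) d"
    by (subst E.ip_sum_right) (auto simp: pair_def emb_def E.ip_scale_right simp del: psc_single)
  finally show ?thesis by simp
qed

lemma pair_single: "pair f (Poly_Mapping.single y 1) = f y"
  by (simp add: pair_def)

lemma Q_U: "Q (U g c) d = Q c (U (- g) d)"
  using U_iso[of g c "U (- g) d"] by (simp add: U_zero flip: U_plus)

lemma U_diff: "U g (c - d) = U g c - U g d"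
  using U_add[of g "c - d" d] by (simp add: algebra_simps)

lemma emb_add: "emb (c + d) = emb c + emb d"
  and emb_psc: "emb (psc a c) = fsc a (emb c)"
  by (rule ext, simp add: emb_def Q_add fsc_def Q_psc)+

lemma emb_diff: "emb (c - d) = emb c - emb d"
  by (rule ext) (simp add: emb_def E.ip_diff_left)

definition cauchy :: "(nat \<Rightarrow> 'x \<Rightarrow>\<^sub>0 complex) \<Rightarrow> bool" where
  "cauchy s \<longleftrightarrow> (\<forall>e>0. \<exists>N. \<forall>p\<ge>N. \<forall>q\<ge>N. nrm Q (s p - s q) < e)"

text \<open>\<open>f\<close> plays the part of the class of the Cauchy sequence \<open>s\<close>.
  That sequences with the same \<open>f\<close> differ by a null sequence is not built in; it
  follows from \<open>rel_zero_nrm\<close>.\<close>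

definition rel :: "(nat \<Rightarrow> 'x \<Rightarrow>\<^sub>0 complex) \<Rightarrow> ('x \<Rightarrow> complex) \<Rightarrow> bool" where
  "rel s f \<longleftrightarrow> cauchy s \<and> (\<forall>y. (\<lambda>n. emb (s n) y) \<longlonglongrightarrow> f y)"

definition S :: "('x \<Rightarrow> complex) set" where
  "S = {f. \<exists>s. rel s f}"

definition ap :: "('x \<Rightarrow> complex) \<Rightarrow> (nat \<Rightarrow> 'x \<Rightarrow>\<^sub>0 complex)" where
  "ap f = (SOME s. rel s f)"

definition ipc :: "('x \<Rightarrow> complex) \<Rightarrow> ('x \<Rightarrow> complex) \<Rightarrow> complex" where
  "ipc f g = lim (\<lambda>n. Q (ap f n) (ap g n))"

text \<open>Defined through the adjoint, because the code of \<open>f\<close> gives its inner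
  products with finite combinations.\<close>

definition repc :: "'g \<Rightarrow> ('x \<Rightarrow> complex) \<Rightarrow> ('x \<Rightarrow> complex)" where
  "repc g f = (\<lambda>y. pair f (U (- g) (Poly_Mapping.single y 1)))"

lemma rel_ap: "f \<in> S \<Longrightarrow> rel (ap f) f"
  unfolding S_def ap_def using someI_ex[of "\<lambda>s. rel s f"] by simp

lemma cauchy_add: "cauchy s \<Longrightarrow> cauchy t \<Longrightarrow> cauchy (\<lambda>n. s n + t n)"
  unfolding cauchy_def
proof (intro allI impI)
  fix e :: real assume s: "\<forall>e>0. \<exists>N. \<forall>p\<ge>N. \<forall>q\<ge>N. nrm Q (s p - s q) < e"
    and t: "\<forall>e>0. \<exists>N. \<forall>p\<ge>N. \<forall>q\<ge>N. nrm Q (t p - t q) < e" and e: "0 < e"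
  from s e obtain N where N: "\<And>p q. p \<ge> N \<Longrightarrow> q \<ge> N \<Longrightarrow> nrm Q (s p - s q) < e / 2" by (meson half_gt_zero)
  from t e obtain M where M: "\<And>p q. p \<ge> M \<Longrightarrow> q \<ge> M \<Longrightarrow> nrm Q (t p - t q) < e / 2" by (meson half_gt_zero)
  have "nrm Q (s p + t p - (s q + t q)) < e" if "p \<ge> max N M" "q \<ge> max N M" for p q
  proof -
    have "nrm Q ((s p - s q) + (t p - t q)) \<le> nrm Q (s p - s q) + nrm Q (t p - t q)"
      by (rule E.nrm_triangle) auto
    moreover have "(s p - s q) + (t p - t q) = s p + t p - (s q + t q)" by simp
    ultimately show ?thesis using N[of p q] M[of p q] that by simp
  qed
  then show "\<exists>N. \<forall>p\<ge>N. \<forall>q\<ge>N. nrm Q (s p + t p - (s q + t q)) < e" by blast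
qed

lemma cauchy_psc: "cauchy s \<Longrightarrow> cauchy (\<lambda>n. psc a (s n))"
  unfolding cauchy_def
proof (intro allI impI)
  fix e :: real assume s: "\<forall>e>0. \<exists>N. \<forall>p\<ge>N. \<forall>q\<ge>N. nrm Q (s p - s q) < e" and e: "0 < e"
  have "0 < e / (cmod a + 1)" using e by (simp add: add_nonneg_pos)
  then obtain N where N: "\<And>p q. p \<ge> N \<Longrightarrow> q \<ge> N \<Longrightarrow> nrm Q (s p - s q) < e / (cmod a + 1)" using s by blast
  have "nrm Q (psc a (s p) - psc a (s q)) < e" if "p \<ge> N" "q \<ge> N" for p q
  proof -
    have "nrm Q (psc a (s p) - psc a (s q)) = cmod a * nrm Q (s p - s q)"
      by (simp add: E.nrm_scale flip: psc.scale_right_diff_distrib)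
    also have "\<dots> \<le> (cmod a + 1) * nrm Q (s p - s q)" by (intro mult_right_mono) auto
    also have "\<dots> < (cmod a + 1) * (e / (cmod a + 1))"
      using N[OF that] by (intro mult_strict_left_mono) (auto simp: add_nonneg_pos)
    also have "\<dots> = e"
    proof -
      have "cmod a + 1 \<noteq> 0" using norm_ge_zero[of a] by linarith
      then show ?thesis by simp
    qed
    finally show ?thesis .
  qed
  then show "\<exists>N. \<forall>p\<ge>N. \<forall>q\<ge>N. nrm Q (psc a (s p) - psc a (s q)) < e" by blast
qed

lemma rel_add: "rel s f \<Longrightarrow> rel t g \<Longrightarrow> rel (\<lambda>n. s n + t n) (f + g)"
  unfolding rel_def by (auto simp: emb_add intro: cauchy_add tendsto_add)

lemma rel_psc: "rel s f \<Longrightarrow> rel (\<lambda>n. psc a (s n)) (fsc a f)"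
  unfolding rel_def by (auto simp: emb_psc fsc_def intro: cauchy_psc tendsto_mult_left)

lemma rel_diff: "rel s f \<Longrightarrow> rel t g \<Longrightarrow> rel (\<lambda>n. s n - t n) (f - g)"
  using rel_add[OF _ rel_psc[of t g "- 1"], of s f] by simp

lemma rel_emb: "rel (\<lambda>_. c) (emb c)"
  by (simp add: rel_def cauchy_def)

lemma rel_unique: "rel s f \<Longrightarrow> rel s g \<Longrightarrow> f = g"
  unfolding rel_def by (intro ext) (blast intro: LIMSEQ_unique)

lemma rel_pair: "rel s f \<Longrightarrow> (\<lambda>n. Q (s n) d) \<longlonglongrightarrow> pair f d"
proof -
  assume "rel s f"
  then have "(\<lambda>n. pair (emb (s n)) d) \<longlonglongrightarrow> pair f d"
    unfolding pair_def by (intro tendsto_intros) (auto simp: rel_def)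
  then show ?thesis by (simp add: pair_emb)
qed

lemma rel_U: "rel s f \<Longrightarrow> rel (\<lambda>n. U g (s n)) (repc g f)"
proof -
  assume r: "rel s f"
  have "nrm Q (U g (s p) - U g (s q)) = nrm Q (s p - s q)" for p q
    by (simp add: nrm_def U_iso flip: U_diff)
  then have "cauchy (\<lambda>n. U g (s n))" using r by (simp add: rel_def cauchy_def)
  moreover have "(\<lambda>n. emb (U g (s n)) y) \<longlonglongrightarrow> repc g f y" for y
    using rel_pair[OF r] by (simp add: emb_def repc_def Q_U)
  ultimately show ?thesis by (simp add: rel_def)
qed

lemma cauchy_bounded: "cauchy s \<Longrightarrow> \<exists>B>0. \<forall>n. nrm Q (s n) \<le> B"
proof -
  assume s: "cauchy s"
  have "\<exists>N. \<forall>p\<ge>N. \<forall>q\<ge>N. nrm Q (s p - s q) < 1"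
    using s[unfolded cauchy_def, rule_format, of 1] by simp
  then obtain N where N: "\<And>p q. p \<ge> N \<Longrightarrow> q \<ge> N \<Longrightarrow> nrm Q (s p - s q) < 1" by blast
  define B where "B = (\<Sum>i\<le>N. nrm Q (s i)) + 1"
  have le: "nrm Q (s i) \<le> (\<Sum>i\<le>N. nrm Q (s i))" if "i \<le> N" for i
    by (rule member_le_sum) (use that in auto)
  have "nrm Q (s n) \<le> B" for n
  proof (cases "n \<le> N")
    case True
    then show ?thesis using le[OF True] by (simp add: B_def)
  next
    case False
    have "nrm Q (s n - s N + s N) \<le> nrm Q (s n - s N) + nrm Q (s N)" by (rule E.nrm_triangle) auto
    then show ?thesis using N[of n N] False le[of N] by (simp add: B_def)
  qed
  moreover have "0 < B" unfolding B_def by (intro add_nonneg_pos sum_nonneg) auto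
  ultimately show ?thesis by blast
qed

lemma re_le: "Re (Q c d) \<le> nrm Q c * nrm Q d"
  using E.cauchy_schwarz[of c d] complex_Re_le_cmod order_trans by auto

text \<open>Weak convergence to 0 becomes norm convergence for a Cauchy sequence: the squared norm
  of \<open>u n\<close> splits into its products with \<open>u n - u N\<close>, small by the Cauchy
  property and boundedness, and with the fixed vector \<open>u N\<close>, small by weak
  convergence.\<close>

lemma rel_zero_nrm:
  assumes r: "rel u 0"
  shows "(\<lambda>n. nrm Q (u n)) \<longlonglongrightarrow> 0"
proof -
  have "(\<lambda>n. (nrm Q (u n))\<^sup>2) \<longlonglongrightarrow> 0"
  proof (rule LIMSEQ_I)
    fix e :: real assume e: "0 < e"
    obtain B where B: "0 < B" "\<And>n. nrm Q (u n) \<le> B" using cauchy_bounded r unfolding rel_def by blast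
    then have "0 < e / (2 * B)" using e by simp
    then obtain N where N: "\<And>p q. p \<ge> N \<Longrightarrow> q \<ge> N \<Longrightarrow> nrm Q (u p - u q) < e / (2 * B)"
      using r unfolding rel_def cauchy_def by blast
    have "(\<lambda>n. Q (u n) (u N)) \<longlonglongrightarrow> 0" using rel_pair[OF r, of "u N"] by (simp add: pair_def)
    then obtain M where M: "\<And>n. n \<ge> M \<Longrightarrow> cmod (Q (u n) (u N)) < e / 2"
      using LIMSEQ_D[of _ 0 "e / 2"] e by fastforce
    have "norm ((nrm Q (u n))\<^sup>2 - 0) < e" if n: "n \<ge> max N M" for n
    proof -
      have eq: "(nrm Q (u n))\<^sup>2 = Re (Q (u n) (u n - u N)) + Re (Q (u n) (u N))"
        using E.ip_diff_right[of "u n" "u N" "u n"] E.nrm_sq[of "u n"] by simp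
      have "nrm Q (u n) * nrm Q (u n - u N) \<le> B * (e / (2 * B))"
        using B N[of n N] n by (intro mult_mono) (auto intro: less_imp_le)
      then have le1: "Re (Q (u n) (u n - u N)) \<le> e / 2"
        using re_le[of "u n" "u n - u N"] B(1) by simp
      have le2: "Re (Q (u n) (u N)) < e / 2"
        using M[of n] n complex_Re_le_cmod[of "Q (u n) (u N)"] by simp
      have "(nrm Q (u n))\<^sup>2 < e" using eq le1 le2 by linarith
      then show ?thesis by simp
    qed
    then show "\<exists>no. \<forall>n\<ge>no. norm ((nrm Q (u n))\<^sup>2 - 0) < e" by blast
  qed
  then have "(\<lambda>n. sqrt ((nrm Q (u n))\<^sup>2)) \<longlonglongrightarrow> sqrt 0" by (rule tendsto_real_sqrt)
  then show ?thesis by simp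
qed

lemma Q_convergent:
  assumes s: "cauchy s" and t: "cauchy t"
  shows "convergent (\<lambda>n. Q (s n) (t n))"
proof -
  obtain B where B: "0 < B" "\<And>n. nrm Q (s n) \<le> B" using cauchy_bounded[OF s] by blast
  obtain B' where B': "0 < B'" "\<And>n. nrm Q (t n) \<le> B'" using cauchy_bounded[OF t] by blast
  have "Cauchy (\<lambda>n. Q (s n) (t n))"
  proof (rule CauchyI)
    fix e :: real assume e: "0 < e"
    then have "0 < e / (2 * B')" "0 < e / (2 * B)" using B B' by simp_all
    then obtain N M where N: "\<And>p q. p \<ge> N \<Longrightarrow> q \<ge> N \<Longrightarrow> nrm Q (s p - s q) < e / (2 * B')"
      and M: "\<And>p q. p \<ge> M \<Longrightarrow> q \<ge> M \<Longrightarrow> nrm Q (t p - t q) < e / (2 * B)"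
      using s t unfolding cauchy_def by meson
    have "norm (Q (s p) (t p) - Q (s q) (t q)) < e" if pq: "p \<ge> max N M" "q \<ge> max N M" for p q
    proof -
      have "Q (s p) (t p) - Q (s q) (t q) = Q (s p - s q) (t p) + Q (s q) (t p - t q)"
        by (simp add: E.ip_diff_left E.ip_diff_right)
      then have "norm (Q (s p) (t p) - Q (s q) (t q)) \<le> nrm Q (s p - s q) * nrm Q (t p) + nrm Q (s q) * nrm Q (t p - t q)"
        using norm_triangle_le[of "Q (s p - s q) (t p)" "Q (s q) (t p - t q)"]
          E.cauchy_schwarz[of "s p - s q" "t p"] E.cauchy_schwarz[of "s q" "t p - t q"] by simp
      also have "nrm Q (s p - s q) * nrm Q (t p) \<le> nrm Q (s p - s q) * B'"
        using B'(2) by (intro mult_left_mono) auto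
      also have "nrm Q (s p - s q) * B' < e / (2 * B') * B'"
        using N[of p q] pq B' by (intro mult_strict_right_mono) auto
      also have "nrm Q (s q) * nrm Q (t p - t q) \<le> B * (e / (2 * B))"
        using B M[of p q] pq by (intro mult_mono) (auto intro: less_imp_le)
      also have "e / (2 * B') * B' + B * (e / (2 * B)) = e" using B B' by simp
      finally show ?thesis by simp
    qed
    then show "\<exists>K. \<forall>p\<ge>K. \<forall>q\<ge>K. norm (Q (s p) (t p) - Q (s q) (t q)) < e" by blast
  qed
  then show ?thesis by (rule Cauchy_convergent)
qed

lemma Q_limit_zero:
  assumes u: "(\<lambda>n. nrm Q (u n)) \<longlonglongrightarrow> 0" and t: "cauchy t"
  shows "(\<lambda>n. Q (u n) (t n)) \<longlonglongrightarrow> 0" "(\<lambda>n. Q (t n) (u n)) \<longlonglongrightarrow> 0"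
proof -
  obtain B where B: "0 < B" "\<And>n. nrm Q (t n) \<le> B" using cauchy_bounded[OF t] by blast
  have le: "cmod (Q (u n) (t n)) \<le> nrm Q (u n) * B" for n
    using E.cauchy_schwarz[of "u n" "t n"] mult_left_mono[OF B(2)[of n], of "nrm Q (u n)"] by simp
  show "(\<lambda>n. Q (u n) (t n)) \<longlonglongrightarrow> 0"
    by (rule tendsto_0_le[OF u, where K = B]) (use le in auto)
  show "(\<lambda>n. Q (t n) (u n)) \<longlonglongrightarrow> 0"
    by (rule tendsto_0_le[OF u, where K = B]) (use le in \<open>auto simp: Q_commute[of "t _"]\<close>)
qed

text \<open>Independence of the chosen sequences \<open>ap\<close>: another choice changes the inner
  products by a null sequence.\<close>

lemma ipc_limit:
  assumes s: "rel s f" and t: "rel t g"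
  shows "(\<lambda>n. Q (s n) (t n)) \<longlonglongrightarrow> ipc f g"
proof -
  have fg: "f \<in> S" "g \<in> S" using s t by (auto simp: S_def)
  note s' = rel_ap[OF fg(1)] and t' = rel_ap[OF fg(2)]
  have c: "cauchy s" "cauchy t" "cauchy (ap f)" "cauchy (ap g)" using s t s' t' by (auto simp: rel_def)
  have 1: "(\<lambda>n. Q (ap f n) (ap g n)) \<longlonglongrightarrow> ipc f g"
    using Q_convergent[OF c(3,4)] by (simp add: ipc_def convergent_LIMSEQ_iff)
  have "rel (\<lambda>n. s n - ap f n) 0" "rel (\<lambda>n. t n - ap g n) 0"
    using rel_diff[OF s s'] rel_diff[OF t t'] by simp_all
  note z = rel_zero_nrm[OF this(1)] rel_zero_nrm[OF this(2)]
  have "(\<lambda>n. Q (s n - ap f n) (t n)) \<longlonglongrightarrow> 0" "(\<lambda>n. Q (ap f n) (t n - ap g n)) \<longlonglongrightarrow> 0"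
    by (rule Q_limit_zero(1)[OF z(1) c(2)], rule Q_limit_zero(2)[OF z(2) c(3)])
  from tendsto_add[OF tendsto_add[OF this] 1] show ?thesis
    by (simp add: E.ip_diff_left E.ip_diff_right)
qed

lemma nrm_limit: "rel s f \<Longrightarrow> (\<lambda>n. nrm Q (s n)) \<longlonglongrightarrow> nrm ipc f"
  unfolding nrm_def by (intro tendsto_real_sqrt tendsto_Re ipc_limit)

lemma completion_pre_hilbert: "pre_hilbert fsc S ipc"
proof
  show "0 \<in> S" using rel_emb[of 0] by (auto simp: S_def emb_def zero_fun_def)
  fix f a assume f: "f \<in> S"
  note rf = rel_ap[OF f]
  show "fsc a f \<in> S" using rel_psc[OF rf] by (auto simp: S_def)
  show "0 \<le> Re (ipc f f)"
    by (rule LIMSEQ_le_const[OF tendsto_Re[OF ipc_limit[OF rf rf]]]) (use Q_pos in auto)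
  {
    \<comment> \<open>By the Cauchy-Schwarz inequality a vector of norm 0 has all its coordinates 0,
      and the vector is its family of coordinates.\<close>
    assume "Re (ipc f f) = 0"
    then have "(\<lambda>n. nrm Q (ap f n)) \<longlonglongrightarrow> 0" using nrm_limit[OF rf] by (simp add: nrm_def[of ipc])
    from Q_limit_zero(1)[OF this, of "\<lambda>_. Poly_Mapping.single y 1" for y]
    have "(\<lambda>n. emb (ap f n) y) \<longlonglongrightarrow> 0" for y using rel_emb by (simp add: emb_def rel_def)
    then have "f y = 0" for y using rf LIMSEQ_unique unfolding rel_def by blast
    then show "f = 0" by (simp add: fun_eq_iff)
  }
  fix g assume g: "g \<in> S"
  note rg = rel_ap[OF g]
  show "f + g \<in> S" using rel_add[OF rf rg] by (auto simp: S_def)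
  show "ipc (fsc a f) g = a * ipc f g"
    by (rule LIMSEQ_unique[OF ipc_limit[OF rel_psc[OF rf] rg]])
      (use tendsto_mult_left[OF ipc_limit[OF rf rg], of a] in \<open>simp add: Q_psc\<close>)
  show "ipc g f = cnj (ipc f g)"
    by (rule LIMSEQ_unique[OF ipc_limit[OF rg rf]])
      (use tendsto_cnj[OF ipc_limit[OF rf rg]] in \<open>simp flip: Q_commute\<close>)
  fix h assume h: "h \<in> S"
  note rh = rel_ap[OF h]
  show "ipc (f + g) h = ipc f h + ipc g h"
    by (rule LIMSEQ_unique[OF ipc_limit[OF rel_add[OF rf rg] rh]])
      (use tendsto_add[OF ipc_limit[OF rf rh] ipc_limit[OF rg rh]] in \<open>simp add: Q_add\<close>)
qed

sublocale P: pre_hilbert fsc S ipc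
  by (rule completion_pre_hilbert)

lemma emb_S [simp]: "emb c \<in> S"
  using rel_emb by (auto simp: S_def)

lemma ipc_emb: "ipc (emb c) (emb d) = Q c d"
  using LIMSEQ_unique[OF ipc_limit[OF rel_emb rel_emb]] tendsto_const by blast

lemma nrm_emb: "nrm ipc (emb c) = nrm Q c"
  by (simp add: nrm_def ipc_emb)

lemma ipc_emb_right: "f \<in> S \<Longrightarrow> ipc f (emb d) = pair f d"
  using LIMSEQ_unique[OF ipc_limit[OF rel_ap rel_emb] rel_pair[OF rel_ap]] by blast

lemma emb_dense:
  assumes r: "rel s f"
  shows "(\<lambda>n. nrm ipc (f - emb (s n))) \<longlonglongrightarrow> 0"
proof (rule LIMSEQ_I)
  fix e :: real assume e: "0 < e"
  then obtain N where N: "\<And>p q. p \<ge> N \<Longrightarrow> q \<ge> N \<Longrightarrow> nrm Q (s p - s q) < e / 2"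
    using r unfolding rel_def cauchy_def by (meson half_gt_zero)
  have f: "f \<in> S" using r by (auto simp: S_def)
  have "norm (nrm ipc (f - emb (s n)) - 0) < e" if "n \<ge> N" for n
  proof -
    have "nrm ipc (f - emb (s n)) \<le> e / 2"
      by (rule LIMSEQ_le_const2[OF nrm_limit[OF rel_diff[OF r rel_emb]]])
        (use N that in \<open>auto intro: less_imp_le exI[of _ N]\<close>)
    moreover have "0 \<le> nrm ipc (f - emb (s n))" using f by simp
    ultimately show ?thesis using e by simp
  qed
  then show "\<exists>no. \<forall>n\<ge>no. norm (nrm ipc (f - emb (s n)) - 0) < e" by blast
qed

text \<open>Diagonal argument: the n-th vector is replaced by a finite combination at distance less
  than \<open>1 / (n + 1)\<close>. These combinations form a Cauchy sequence, whose class is the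
  limit.\<close>

lemma completion_hilbert: "hilbert fsc S ipc"
proof
  fix F :: "nat \<Rightarrow> 'x \<Rightarrow> complex"
  assume F: "\<And>n. F n \<in> S" and ca: "\<And>e. 0 < e \<Longrightarrow> \<exists>N. \<forall>p\<ge>N. \<forall>q\<ge>N. nrm ipc (F p - F q) < e"
  have "\<exists>c. nrm ipc (F n - emb c) < inverse (real (Suc n))" for n
  proof -
    have "eventually (\<lambda>k. nrm ipc (F n - emb (ap (F n) k)) < inverse (real (Suc n))) sequentially"
      by (rule order_tendstoD(2)[OF emb_dense[OF rel_ap[OF F]]]) simp
    then show ?thesis by (auto simp: eventually_sequentially)
  qed
  then obtain c where c: "\<And>n. nrm ipc (F n - emb (c n)) < inverse (real (Suc n))" by metis
  have cc: "cauchy c"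
    unfolding cauchy_def
  proof (intro allI impI)
    fix e :: real assume e: "0 < e"
    then obtain N where N: "\<And>p q. p \<ge> N \<Longrightarrow> q \<ge> N \<Longrightarrow> nrm ipc (F p - F q) < e / 3"
      using ca[of "e / 3"] by auto
    obtain M where M: "inverse (real (Suc M)) < e / 3" using reals_Archimedean[of "e / 3"] e by auto
    have small: "nrm ipc (F n - emb (c n)) < e / 3" if "n \<ge> M" for n
    proof -
      have "inverse (real (Suc n)) \<le> inverse (real (Suc M))" using that by (simp add: le_imp_inverse_le)
      then show ?thesis using c[of n] M by linarith
    qed
    have "nrm Q (c p - c q) < e" if pq: "p \<ge> max N M" "q \<ge> max N M" for p q
    proof -
      have t: "nrm Q (c p - c q) = nrm ipc (emb (c p) - emb (c q))" by (simp add: nrm_emb flip: emb_diff)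
      have "nrm Q (c p - c q) \<le> nrm ipc (F p - emb (c p)) + (nrm ipc (F p - F q) + nrm ipc (F q - emb (c q)))"
        unfolding t P.nrm_diff_commute[OF F[of p] emb_S[of "c p"]]
        using P.nrm_triangle_diff[OF emb_S[of "c p"] F[of p] emb_S[of "c q"]]
          P.nrm_triangle_diff[OF F[of p] F[of q] emb_S[of "c q"]] by linarith
      moreover have "p \<ge> N" "q \<ge> N" "p \<ge> M" "q \<ge> M" using pq by auto
      ultimately show ?thesis using small[of p] small[of q] N[of p q] by linarith
    qed
    then show "\<exists>N. \<forall>p\<ge>N. \<forall>q\<ge>N. nrm Q (c p - c q) < e" by blast
  qed
  have "convergent (\<lambda>n. emb (c n) y)" for y
    unfolding emb_def by (rule Q_convergent[OF cc]) (use rel_emb in \<open>simp add: rel_def\<close>)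
  then obtain f where "\<And>y. (\<lambda>n. emb (c n) y) \<longlonglongrightarrow> f y" unfolding convergent_def by metis
  then have r: "rel c f" using cc by (simp add: rel_def)
  then have f: "f \<in> S" by (auto simp: S_def)
  have le: "nrm ipc (F n - f) \<le> inverse (real (Suc n)) + nrm ipc (f - emb (c n))" for n
    using P.nrm_triangle_diff[of "F n" "emb (c n)" f] P.nrm_diff_commute[of f "emb (c n)"] c[of n] F f by simp
  have "(\<lambda>n. inverse (real (Suc n)) + nrm ipc (f - emb (c n))) \<longlonglongrightarrow> 0 + 0"
    by (rule tendsto_add[OF LIMSEQ_inverse_real_of_nat emb_dense[OF r]])
  then have lim: "(\<lambda>n. inverse (real (Suc n)) + nrm ipc (f - emb (c n))) \<longlonglongrightarrow> 0" by simp
  have "norm (nrm ipc (F n - f)) \<le> norm (inverse (real (Suc n)) + nrm ipc (f - emb (c n))) * 1" for n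
    using le[of n] P.nrm_nonneg[OF P.S_diff[OF F[of n] f]] by simp
  then have "(\<lambda>n. nrm ipc (F n - f)) \<longlonglongrightarrow> 0"
    by (intro tendsto_0_le[OF lim, where K = 1] always_eventually allI)
  then show "\<exists>l\<in>S. (\<lambda>n. nrm ipc (F n - l)) \<longlonglongrightarrow> 0" using f by blast
qed

lemma completion_unirep: "unirep fsc S ipc repc"
proof -
  have "unirep_axioms fsc S ipc repc"
  proof
    fix f a and g h :: 'g assume f: "f \<in> S"
    note rf = rel_ap[OF f]
    show "repc g f \<in> S" using rel_U[OF rf] by (auto simp: S_def)
    show "repc g (fsc a f) = fsc a (repc g f)"
      by (rule rel_unique[OF rel_U[OF rel_psc[OF rf]]]) (use rel_psc[OF rel_U[OF rf]] in \<open>simp add: U_psc\<close>)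
    show "repc 0 f = f" by (rule rel_unique[OF rel_U[OF rf]]) (use rf in \<open>simp add: U_zero\<close>)
    show "repc (g + h) f = repc g (repc h f)"
      by (rule rel_unique[OF rel_U[OF rf]]) (use rel_U[OF rel_U[OF rf]] in \<open>simp add: U_plus\<close>)
    fix f' assume f': "f' \<in> S"
    note rf' = rel_ap[OF f']
    show "repc g (f + f') = repc g f + repc g f'"
      by (rule rel_unique[OF rel_U[OF rel_add[OF rf rf']]])
        (use rel_add[OF rel_U[OF rf] rel_U[OF rf']] in \<open>simp add: U_add\<close>)
    show "ipc (repc g f) (repc g f') = ipc f f'"
      by (rule LIMSEQ_unique[OF ipc_limit[OF rel_U[OF rf] rel_U[OF rf']]])
        (use ipc_limit[OF rf rf'] in \<open>simp add: U_iso\<close>)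
  qed
  then show ?thesis using completion_hilbert by (simp add: unirep_def)
qed

sublocale R: unirep fsc S ipc repc
  by (rule completion_unirep)

lemma repc_emb: "repc g (emb c) = emb (U g c)"
  by (rule rel_unique[OF rel_U[OF rel_emb] rel_emb])

lemma S_apply: "f \<in> S \<Longrightarrow> f y = ipc f (emb (Poly_Mapping.single y 1))"
  by (simp add: ipc_emb_right pair_single)

end

section \<open>No characters under property (T)\<close>

text \<open>The chord is at most as long as the arc: its length is twice the modulus of the sine of
  half the angle.\<close>

lemma cmod_cis_diff: "cmod (cis a - cis b) \<le> \<bar>a - b\<bar>"
proof -
  define x where "x = (a - b) / 2"
  have "b + 2 * x = a" by (simp add: x_def diff_divide_distrib)
  then have "cis a = cis b * cis (2 * x)" by (simp add: cis_mult)
  then have "cis a - cis b = cis b * (cis (2 * x) - 1)" by (simp add: right_diff_distrib)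
  then have "cmod (cis a - cis b) = cmod (cis (2 * x) - 1)" by (simp add: norm_mult)
  moreover have "(cmod (cis (2 * x) - 1))\<^sup>2 = (2 * sin x)\<^sup>2"
  proof -
    have "(cmod (cis (2 * x) - 1))\<^sup>2 = (cos (2 * x) - 1)\<^sup>2 + (sin (2 * x))\<^sup>2" by (simp add: cmod_power2)
    also have "\<dots> = 2 - 2 * cos (2 * x)"
      using sin_cos_squared_add[of "2 * x"] by (simp add: power2_diff)
    also have "\<dots> = (2 * sin x)\<^sup>2" by (simp add: cos_double_sin power_mult_distrib)
    finally show ?thesis .
  qed
  then have "cmod (cis (2 * x) - 1) = \<bar>2 * sin x\<bar>"
    by (metis abs_norm_cancel power2_eq_iff_nonneg abs_ge_zero power2_abs norm_ge_zero)
  moreover have "\<bar>2 * sin x\<bar> \<le> \<bar>a - b\<bar>" using abs_sin_x_le_abs_x[of x] by (simp add: x_def abs_mult)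
  ultimately show ?thesis by simp
qed

definition lform :: "(nat \<Rightarrow>\<^sub>0 complex) \<Rightarrow> (nat \<Rightarrow>\<^sub>0 complex) \<Rightarrow> complex" where
  "lform c d = lin (*) (\<lambda>i. cnj (Poly_Mapping.lookup d i)) c"

text \<open>Summable, which makes the coboundary square summable, and within \<open>(0, 1]\<close>,
  so that \<open>cis (dyad i)\<close> is never 1 and no coordinate is fixed by an element on which
  the character takes the value 1.\<close>

definition dyad :: "nat \<Rightarrow> real" where
  "dyad i = (1 / 2) ^ i"

text \<open>The sum of the characters \<open>exp (i 2^-k \<chi>)\<close>, \<open>k = 0, 1, \<dots>\<close>. The coboundary of the
  constant family \<open>1\<close> is square summable, although that family is not.\<close>

definition ltwist :: "('g \<Rightarrow> real) \<Rightarrow> 'g \<Rightarrow> (nat \<Rightarrow>\<^sub>0 complex) \<Rightarrow> (nat \<Rightarrow>\<^sub>0 complex)" where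
  "ltwist \<chi> g = lin psc (\<lambda>i. Poly_Mapping.single i (cis (dyad i * \<chi> g)))"

lemma lookup_ltwist: "Poly_Mapping.lookup (ltwist \<chi> g c) i = Poly_Mapping.lookup c i * cis (dyad i * \<chi> g)"
  by (simp add: ltwist_def lin_def lookup_sum lookup_single when_def in_keys_iff sum.delta' if_distrib cong: if_cong)

lemma lform_super:
  "finite A \<Longrightarrow> Poly_Mapping.keys c \<subseteq> A \<Longrightarrow>
    lform c d = (\<Sum>i\<in>A. Poly_Mapping.lookup c i * cnj (Poly_Mapping.lookup d i))"
  unfolding lform_def by (rule fld.lin_super)

lemma keys_ltwist: "Poly_Mapping.keys (ltwist \<chi> g c) \<subseteq> Poly_Mapping.keys c"
  by (auto simp: in_keys_iff lookup_ltwist)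

lemma twisted_form:
  assumes \<chi>: "\<And>g h. \<chi> (g + h) = \<chi> g + \<chi> (h :: 'g::group_add)"
  shows "invariant_form lform (ltwist \<chi>)"
proof
  fix c d :: "nat \<Rightarrow>\<^sub>0 complex" and a g h
  let ?A = "Poly_Mapping.keys c \<union> Poly_Mapping.keys d"
  have \<chi>0: "\<chi> 0 = 0" using \<chi>[of 0 0] by simp
  show "lform (c + c') d = lform c d + lform c' d" for c' by (simp add: lform_def fld.lin_add)
  show "lform (psc a c) d = a * lform c d" by (simp add: lform_def fld.lin_psc)
  show "lform d c = cnj (lform c d)"
    by (simp add: lform_super[of ?A] mult.commute)
  have "lform c c = (\<Sum>i\<in>?A. of_real ((cmod (Poly_Mapping.lookup c i))\<^sup>2))"
    unfolding complex_norm_square by (rule lform_super) auto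
  then show "0 \<le> Re (lform c c)" by (simp add: sum_nonneg)
  show "ltwist \<chi> g (c + d) = ltwist \<chi> g c + ltwist \<chi> g d" by (simp add: ltwist_def psc.lin_add)
  show "ltwist \<chi> g (psc a c) = psc a (ltwist \<chi> g c)" by (simp add: ltwist_def psc.lin_psc)
  show "ltwist \<chi> 0 c = c" by (rule poly_mapping_eqI) (simp add: lookup_ltwist \<chi>0)
  show "ltwist \<chi> (g + h) c = ltwist \<chi> g (ltwist \<chi> h c)"
  proof (rule poly_mapping_eqI)
    fix i
    have "cis (dyad i * \<chi> (g + h)) = cis (dyad i * \<chi> h) * cis (dyad i * \<chi> g)"
      unfolding \<chi> distrib_left cis_mult by (rule arg_cong[where f = cis]) (rule add.commute)
    then show "Poly_Mapping.lookup (ltwist \<chi> (g + h) c) i = Poly_Mapping.lookup (ltwist \<chi> g (ltwist \<chi> h c)) i"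
      by (simp only: lookup_ltwist mult.assoc)
  qed
  have cancel: "x * u * cnj (y * u) = x * cnj y" if "u * cnj u = 1" for x y u :: complex
  proof -
    have "x * u * cnj (y * u) = (x * cnj y) * (u * cnj u)" by (simp only: complex_cnj_mult mult_ac)
    then show ?thesis using that by simp
  qed
  have "lform (ltwist \<chi> g c) (ltwist \<chi> g d) = (\<Sum>i\<in>?A. Poly_Mapping.lookup (ltwist \<chi> g c) i * cnj (Poly_Mapping.lookup (ltwist \<chi> g d) i))"
    by (rule lform_super) (use keys_ltwist[of \<chi> g c] in auto)
  also have "\<dots> = (\<Sum>i\<in>?A. Poly_Mapping.lookup c i * cnj (Poly_Mapping.lookup d i))"
    unfolding lookup_ltwist by (intro sum.cong refl cancel) (simp add: cis_cnj cis_mult)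
  also have "\<dots> = lform c d" by (rule lform_super[symmetric]) auto
  finally show "lform (ltwist \<chi> g c) (ltwist \<chi> g d) = lform c d" .
qed

text \<open>The coboundary of the constant family 1 takes values in the square summable families. A
  square summable primitive would differ from that family by an invariant one, hence be constantly 1
  itself, since every coordinate is moved by \<open>g0\<close>.\<close>

lemma property_T_no_character:
  fixes \<chi> :: "'g::group_add \<Rightarrow> real"
  assumes univ: "\<exists>f :: real \<Rightarrow> 'v. inj f" and T: "property_T TYPE('v) TYPE('g) n" and n: "1 \<le> n"
    and \<chi>: "\<And>g h. \<chi> (g + h) = \<chi> g + \<chi> h" and g0: "\<chi> g0 = 1"
  shows False
proof -
  interpret F: invariant_form lform "ltwist \<chi>" by (rule twisted_form[OF \<chi>])
  have \<chi>m: "\<chi> (- g) = - \<chi> g" for g using \<chi>[of g "- g"] \<chi>[of 0 0] by simp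
  have emb_i: "F.emb c i = Poly_Mapping.lookup c i" for c i
    unfolding F.emb_def
    by (subst lform_super[of "insert i (Poly_Mapping.keys c)"])
      (auto simp: lookup_single when_def in_keys_iff if_distrib sum.delta cong: if_cong)
  have rep_i: "F.repc g f i = cis (dyad i * \<chi> g) * f i" for g f i
    by (simp add: F.repc_def F.pair_def ltwist_def cis_cnj \<chi>m)
  have cis_ne: "cis (dyad i) \<noteq> 1" for i
  proof
    assume "cis (dyad i) = 1"
    then have "sin (dyad i) = 0" by (simp add: complex_eq_iff)
    moreover have "0 < dyad i" "dyad i \<le> 1" by (simp_all add: dyad_def power_le_one)
    ultimately show False using sin_gt_zero_02[of "dyad i"] by simp
  qed
  have free: "F.R.invariant_free"
    unfolding F.R.invariant_free_def
  proof (intro ballI impI ext)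
    fix f i assume "\<forall>g. F.repc g f = f"
    then have "F.repc g0 f i = f i" by simp
    then have "(cis (dyad i) - 1) * f i = 0" unfolding rep_i by (simp add: g0 algebra_simps)
    then show "f i = (0 :: nat \<Rightarrow> complex) i" using cis_ne by simp
  qed
  obtain \<iota> :: "(nat \<Rightarrow> complex) \<Rightarrow> 'v" where \<iota>: "inj \<iota>" using countable_functions_embed[OF univ] by blast
  have van: "std_vanishes fsc F.S F.repc 0"
    by (rule F.R.property_T_vanishing[OF T _ _ free, where \<iota> = \<iota>]) (use n \<iota> in \<open>auto intro: inj_on_subset\<close>)
  \<comment> \<open>The difference of two translates of the constant family 1, each translate alone
    being outside the space.\<close>
  define c where "c xs = (\<lambda>i. cis (dyad i * \<chi> (xs ! 1)) - cis (dyad i * \<chi> (xs ! 0)))" for xs :: "'g list"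
  have cS: "c xs \<in> F.S" for xs
  proof -
    define s where "s n = (\<Sum>i<n. Poly_Mapping.single i (c xs i))" for n
    have st: "nrm lform (s (Suc k) - s k) = cmod (c xs k)" for k
    proof -
      have "s (Suc k) - s k = Poly_Mapping.single k (c xs k)" by (simp add: s_def)
      then have "lform (s (Suc k) - s k) (s (Suc k) - s k) = of_real ((cmod (c xs k))\<^sup>2)"
        unfolding complex_norm_square by (simp add: lform_def)
      then show ?thesis by (simp add: nrm_def)
    qed
    have b: "cmod (c xs k) \<le> \<bar>\<chi> (xs ! 1) - \<chi> (xs ! 0)\<bar> * (1 / 2) ^ k" for k
    proof -
      have "cmod (c xs k) \<le> \<bar>dyad k * \<chi> (xs ! 1) - dyad k * \<chi> (xs ! 0)\<bar>"
        unfolding c_def by (rule cmod_cis_diff)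
      also have "\<dots> = \<bar>\<chi> (xs ! 1) - \<chi> (xs ! 0)\<bar> * dyad k"
        by (simp add: dyad_def abs_mult flip: right_diff_distrib)
      finally show ?thesis by (simp add: dyad_def)
    qed
    have "F.cauchy s"
      unfolding F.cauchy_def
      by (intro allI impI, rule F.E.geometric_cauchy[where r = "1 / 2"]) (use st b in auto)
    moreover have "(\<lambda>n. F.emb (s n) i) \<longlonglongrightarrow> c xs i" for i
    proof (rule tendsto_eventually)
      have "F.emb (s n) i = c xs i" if "n \<ge> Suc i" for n
        using that by (simp add: emb_i s_def lookup_sum lookup_single when_def sum.delta')
      then show "\<forall>\<^sub>F n in sequentially. F.emb (s n) i = c xs i" by (rule eventually_sequentiallyI)
    qed
    ultimately show ?thesis unfolding F.S_def F.rel_def by blast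
  qed
  have c1: "F.R.Q.cochain_on (\<lambda>g. map ((+) g)) {xs. length xs = Suc (Suc 0)} c"
    unfolding F.R.Q.cochain_on_def
  proof (intro ballI conjI allI cS)
    fix xs :: "'g list" and g assume "xs \<in> {xs. length xs = Suc (Suc 0)}"
    then show "c (map ((+) g) xs) = F.repc g (c xs)"
      by (intro ext) (simp add: c_def rep_i \<chi> right_diff_distrib cis_mult distrib_left)
  qed
  have c2: "\<forall>x\<in>{xs. length xs = Suc (Suc (Suc 0))}. lin (\<lambda>r. fsc (of_rat r)) c (lbd x) = 0"
  proof safe
    fix xs :: "'g list" assume "length xs = Suc (Suc (Suc 0))"
    then obtain x y z where xs: "xs = [x, y, z]" by (auto simp: length_Suc_conv)
    have "lin (\<lambda>r. fsc (of_rat r)) c (lbd xs) = c [y, z] - c [x, z] + c [x, y]"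
      by (simp add: xs psc.lin_diff F.R.Q.lin_diff)
    also have "\<dots> = 0" by (rule ext) (simp add: c_def)
    finally show "lin (\<lambda>r. fsc (of_rat r)) c (lbd xs) = 0" .
  qed
  obtain b where bb: "F.R.Q.cochain_on (\<lambda>g. map ((+) g)) {xs. length xs = Suc 0} b \<and>
      (\<forall>x\<in>{xs. length xs = Suc (Suc 0)}. c x = lin (\<lambda>r. fsc (of_rat r)) b (lbd x))"
    using van[unfolded F.R.Q.vanishes_def, THEN spec, THEN mp, OF conjI[OF c1 c2]] by blast
  note b = conjunct1[OF bb]
  have cb: "c [x, y] = lin (\<lambda>r. fsc (of_rat r)) b (lbd [x, y])" for x y
    by (rule bspec[OF conjunct2[OF bb], of "[x, y]"]) simp
  define v where "v = b [0]"
  have v: "v \<in> F.S" and bg: "b [g0] = F.repc g0 v"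
  proof -
    have 1: "b [0] \<in> F.S \<and> (\<forall>g. b (map ((+) g) [0]) = F.repc g (b [0]))"
      by (rule bspec[OF b[unfolded F.R.Q.cochain_on_def], of "[0]"]) simp
    show "v \<in> F.S" unfolding v_def by (rule conjunct1[OF 1])
    show "b [g0] = F.repc g0 v"
      using spec[OF conjunct2[OF 1], of g0] unfolding v_def list.map add_0_right .
  qed
  have "c [0, g0] = b [g0] - b [0]" unfolding cb by (simp add: F.R.Q.lin_diff)
  then have eq: "c [0, g0] i = F.repc g0 v i - v i" for i unfolding bg v_def by simp
  have v1: "v i = 1" for i
  proof -
    have \<chi>0: "\<chi> 0 = 0" using \<chi>[of 0 0] by simp
    have "(cis (dyad i) - 1) * (v i - 1) = 0"
      using eq[of i] unfolding rep_i c_def by (simp add: g0 \<chi>0 algebra_simps)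
    then show ?thesis using cis_ne by simp
  qed
  obtain s where s: "F.rel s v" using v by (auto simp: F.S_def)
  obtain N where N: "\<And>p. p \<ge> N \<Longrightarrow> nrm lform (s p - s N) < 1 / 2"
  proof -
    have "\<exists>N. \<forall>p\<ge>N. \<forall>q\<ge>N. nrm lform (s p - s q) < 1 / 2"
      using s[unfolded F.rel_def F.cauchy_def, THEN conjunct1, rule_format, of "1 / 2"] by simp
    then show thesis using that by blast
  qed
  \<comment> \<open>At an index outside the support of \<open>s N\<close> all later approximations
    have modulus at most \<open>1 / 2\<close>, while \<open>v i = 1\<close>.\<close>
  obtain i where i: "i \<notin> Poly_Mapping.keys (s N)"
    using ex_new_if_finite[OF infinite_UNIV_nat finite_keys[of "s N"]] by (rule exE)
  have one: "nrm lform (Poly_Mapping.single i 1) = 1" by (simp add: nrm_def lform_def)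
  have "cmod (F.emb (s p) i) \<le> 1 / 2" if "p \<ge> N" for p
  proof -
    have "F.emb (s p) i = F.emb (s p - s N) i" using i by (simp add: emb_i lookup_minus in_keys_iff)
    also have "cmod \<dots> \<le> nrm lform (s p - s N) * 1"
      unfolding F.emb_def one[symmetric] by (rule F.E.cauchy_schwarz) auto
    finally show ?thesis using N[OF that] by simp
  qed
  moreover have "(\<lambda>n. cmod (F.emb (s n) i)) \<longlonglongrightarrow> cmod (v i)"
    using s by (intro tendsto_norm) (simp add: F.rel_def)
  ultimately have "cmod (v i) \<le> 1 / 2" by (intro LIMSEQ_le_const2) auto
  then show False using v1 by simp
qed

section \<open>From cocycles with trivial coefficients to characters\<close>

context based_resolution
begin

lemma aug_add: "aug (p + q) = aug p + aug (q :: 'g \<Rightarrow>\<^sub>0 rat)"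
  by (simp add: aug_csum csum_def fld.lin_add)

lemma aug_sum: "aug (\<Sum>i\<in>I. f i) = (\<Sum>i\<in>I. aug (f i :: 'g \<Rightarrow>\<^sub>0 rat))"
  by (simp add: aug_csum csum_def fld.lin_sum)

lemma aug_mult: "aug (p * q) = aug p * aug (q :: 'g \<Rightarrow>\<^sub>0 rat)"
proof (induction p rule: pm_induct)
  case (single x a)
  show ?case
    by (induction q rule: pm_induct) (simp_all add: distrib_left mult_single aug_csum csum_def fld.lin_add)
qed (simp_all add: aug_add distrib_right, simp add: aug_def)

text \<open>First cohomology with trivial coefficients consists of homomorphisms. \<open>L\<close>
  evaluates the cocycle \<open>z\<close> on 1-chains and \<open>M\<close> is the boundary to degree
  0; exactness makes \<open>L\<close> depend on the boundary only, so its value on any chain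
  bounding \<open>g - 1\<close> defines the homomorphism at \<open>g\<close>.\<close>

lemma character_of_cocycle:
  assumes z: "\<And>i. i < m 2 \<Longrightarrow> (\<Sum>j<m 1. of_rat (aug (D 2 $$ (i, j))) * z j) = (0 :: complex)"
    and j0: "j0 < m 1" "z j0 \<noteq> 0"
  shows "\<exists>\<chi> :: 'g \<Rightarrow> complex. (\<forall>g h. \<chi> (g + h) = \<chi> g + \<chi> h) \<and> (\<exists>g. \<chi> g \<noteq> 0)"
proof -
  define L where "L v = (\<Sum>j<m 1. of_rat (aug (v j)) * z j)" for v :: "nat \<Rightarrow> 'g \<Rightarrow>\<^sub>0 rat"
  define M where "M v = (\<Sum>j<m 1. v j * D 1 $$ (j, 0))" for v :: "nat \<Rightarrow> 'g \<Rightarrow>\<^sub>0 rat"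
  have D2: "D 2 \<in> carrier_mat (m 2) (m 1)" using D_carrier[of 1] by (simp add: numeral_2_eq_2)
  have L0: "L w = 0" if w: "M w = 0" for w
  proof -
    define w' where "w' = vec (m 1) w"
    have "row_mult w' (D 1) = 0\<^sub>v (m 0)"
    proof (rule eq_vecI)
      fix i assume "i < dim_vec (0\<^sub>v (m 0))"
      then have i: "i = 0" "0 < m 0" by (auto simp: m0)
      have D1: "D 1 \<in> carrier_mat (m 1) (m 0)" using D_carrier[of 0] by simp
      have "row_mult w' (D 1) $ 0 = M w"
        unfolding row_mult_index[OF D1 i(2)] M_def w'_def by (intro sum.cong refl) auto
      then show "row_mult w' (D 1) $ i = 0\<^sub>v (m 0) $ i" using w i by simp
    qed (use D_carrier[of 0] in \<open>simp add: row_mult_def\<close>)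
    then have "w' \<in> (\<lambda>v. row_mult v (D 2)) ` carrier_vec (m 2)"
      using im[of 0] by (simp add: w'_def numeral_2_eq_2)
    then obtain u where u: "w' = row_mult u (D 2)" by blast
    have wj: "w j = (\<Sum>i<m 2. u $ i * D 2 $$ (i, j))" if "j < m 1" for j
      using that row_mult_index[OF D2 that, of u] by (simp add: w'_def flip: u)
    have "L w = (\<Sum>j<m 1. \<Sum>i<m 2. of_rat (aug (u $ i)) * (of_rat (aug (D 2 $$ (i, j))) * z j))"
      unfolding L_def
    proof (intro sum.cong refl)
      fix j assume "j \<in> {..<m 1}"
      then have "w j = (\<Sum>i<m 2. u $ i * D 2 $$ (i, j))" using wj by simp
      then show "of_rat (aug (w j)) * z j = (\<Sum>i<m 2. of_rat (aug (u $ i)) * (of_rat (aug (D 2 $$ (i, j))) * z j))"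
        by (simp only: aug_sum aug_mult of_rat_sum of_rat_mult sum_distrib_right mult.assoc)
    qed
    also have "\<dots> = (\<Sum>i<m 2. of_rat (aug (u $ i)) * (\<Sum>j<m 1. of_rat (aug (D 2 $$ (i, j))) * z j))"
      by (subst sum.swap) (simp add: sum_distrib_left)
    finally show ?thesis using z by simp
  qed
  have L_eq: "L v = L w" if "M v = M w" for v w
  proof -
    have "M (\<lambda>j. v j - w j) = 0" using that by (simp add: M_def left_diff_distrib sum_subtractf)
    then have "L (\<lambda>j. v j - w j) = 0" by (rule L0)
    then show ?thesis
      by (simp add: L_def aug_csum csum_diff of_rat_diff left_diff_distrib sum_subtractf)
  qed
  have "\<exists>v. Poly_Mapping.single g 1 - 1 = M v" for g
  proof -
    have "aug (Poly_Mapping.single g 1 - 1 :: 'g \<Rightarrow>\<^sub>0 rat) = 0"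
      by (simp add: aug_csum csum_diff csum_single flip: single_one)
    from aug_factor[OF this] show ?thesis unfolding M_def by blast
  qed
  then obtain V where V: "\<And>g. M (V g) = Poly_Mapping.single g 1 - 1" by metis
  define \<chi> where "\<chi> g = L (V g)" for g
  have "\<chi> (g + h) = \<chi> g + \<chi> h" for g h
  proof -
    \<comment> \<open>In the group ring gh - 1 = g (h - 1) + (g - 1); \<open>w\<close> is the chain
      with this boundary, and \<open>aug\<close> erases the factor g.\<close>
    define w where "w j = Poly_Mapping.single g 1 * V h j + V g j" for j
    have "M w = Poly_Mapping.single g 1 * M (V h) + M (V g)"
      by (simp add: M_def w_def distrib_right sum.distrib sum_distrib_left mult.assoc)
    also have "\<dots> = M (V (g + h))" by (simp add: V right_diff_distrib mult_single)
    finally have "\<chi> (g + h) = L w" unfolding \<chi>_def by (intro L_eq) simp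
    also have "\<dots> = \<chi> g + \<chi> h"
      by (simp add: L_def w_def \<chi>_def aug_add aug_mult of_rat_add distrib_right sum.distrib)
        (simp add: aug_csum csum_single)
    finally show ?thesis .
  qed
  moreover have "\<exists>g. \<chi> g \<noteq> 0"
  proof (rule ccontr)
    assume "\<not> (\<exists>g. \<chi> g \<noteq> 0)"
    then have \<chi>0: "\<And>g. \<chi> g = 0" by blast
    let ?d = "D 1 $$ (j0, 0)"
    define e where "e j = (if j = j0 then 1 else 0 :: 'g \<Rightarrow>\<^sub>0 rat)" for j
    \<comment> \<open>An element of augmentation 0 is the combination of the \<open>g - 1\<close>
      with its own coefficients. So \<open>w\<close> and the basis chain \<open>e\<close> have the
      same boundary, which expresses \<open>z j0\<close> through values of \<chi>.\<close>
    define w where "w j = (\<Sum>g\<in>Poly_Mapping.keys ?d. psc (Poly_Mapping.lookup ?d g) (V g j))" for j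
    have psc_mult: "psc r p * q = psc r (p * q)" for r and p q :: "'g \<Rightarrow>\<^sub>0 rat"
      unfolding psc_def mult_map_scale_conv_mult by (simp add: mult.assoc)
    have "M w = (\<Sum>g\<in>Poly_Mapping.keys ?d. psc (Poly_Mapping.lookup ?d g) (M (V g)))"
      unfolding M_def w_def sum_distrib_right psc.scale_sum_right psc_mult by (rule sum.swap)
    also have "\<dots> = ?d - psc (aug ?d) 1"
      unfolding V psc.scale_right_diff_distrib sum_subtractf
      by (simp add: aug_def psc.scale_sum_left flip: poly_mapping_expand)
    also have "\<dots> = M e"
      using aug_D1[OF j0(1)] j0(1) by (simp add: M_def e_def if_distrib[of "\<lambda>x. x * _"] sum.delta cong: if_cong)
    finally have "L e = L w" by (intro L_eq) simp
    also have "L w = (\<Sum>g\<in>Poly_Mapping.keys ?d. of_rat (Poly_Mapping.lookup ?d g) * \<chi> g)"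
    proof -
      have "aug (psc r p) = r * aug p" for r and p :: "'g \<Rightarrow>\<^sub>0 rat" by (simp add: aug_csum csum_def fld.lin_psc)
      note A = this
      have "L w = (\<Sum>j<m 1. \<Sum>g\<in>Poly_Mapping.keys ?d. of_rat (Poly_Mapping.lookup ?d g) * (of_rat (aug (V g j)) * z j))"
        unfolding L_def w_def by (simp only: aug_sum A of_rat_sum of_rat_mult sum_distrib_right mult.assoc)
      then show ?thesis by (subst (asm) sum.swap) (simp add: \<chi>_def L_def sum_distrib_left)
    qed
    finally have "L e = 0" using \<chi>0 by simp
    moreover have "L e = z j0"
    proof -
      have "aug (1 :: 'g \<Rightarrow>\<^sub>0 rat) = 1" by (simp add: aug_csum csum_single flip: single_one)
      moreover have "aug (0 :: 'g \<Rightarrow>\<^sub>0 rat) = 0" by (simp add: aug_def)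
      ultimately have "of_rat (aug (e j)) * z j = (if j = j0 then z j0 else 0)" for j by (simp add: e_def)
      then show ?thesis using j0(1) by (simp add: L_def)
    qed
    ultimately show False using j0(2) by simp
  qed
  ultimately show ?thesis by blast
qed

theorem property_T_no_trivial_cocycle:
  assumes univ: "\<exists>f :: real \<Rightarrow> 'v. inj f" and T: "property_T TYPE('v) TYPE('g) n" and n: "1 \<le> n"
    and z: "\<And>i. i < m 2 \<Longrightarrow> (\<Sum>j<m 1. of_rat (aug (D 2 $$ (i, j))) * z j) = (0 :: complex)"
    and j: "j < m 1"
  shows "z j = 0"
proof (rule ccontr)
  assume "z j \<noteq> 0"
  then obtain \<chi> :: "'g \<Rightarrow> complex" and g0 where \<chi>: "\<And>g h. \<chi> (g + h) = \<chi> g + \<chi> h" "\<chi> g0 \<noteq> 0"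
    using character_of_cocycle[OF z j] by blast
  show False
    \<comment> \<open>Division by \<open>\<chi> g0\<close> before taking real parts yields the value
      1 at \<open>g0\<close>.\<close>
    by (rule property_T_no_character[OF univ T n, of "\<lambda>g. Re (\<chi> g / \<chi> g0)" g0])
      (use \<chi> in \<open>auto simp: add_divide_distrib\<close>)
qed

end

section \<open>States on matrices over the group algebra\<close>

text \<open>As simplification rules the pointwise equations get in the way where a schematic variable for
  a function has been eta-expanded.\<close>

lemmas fun_app = plus_fun_apply zero_fun_apply minus_apply uminus_apply

declare fun_app [simp del]

text \<open>For rows \<open>r\<close> and \<open>s\<close> this is the matrix \<open>s\<^sup>* r\<close>. Rows and matrices are functions
  on all indices, so that they form vector spaces; \<open>supported\<close> bounds their size.\<close>

definition sqm :: "(nat \<Rightarrow> 'g::group_add \<Rightarrow>\<^sub>0 complex) \<Rightarrow> (nat \<Rightarrow> 'g \<Rightarrow>\<^sub>0 complex) \<Rightarrow> nat \<Rightarrow> nat \<Rightarrow> 'g \<Rightarrow>\<^sub>0 complex" where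
  "sqm r s = (\<lambda>a b. star (s a) * r b)"

definition rsc :: "complex \<Rightarrow> (nat \<Rightarrow> 'g \<Rightarrow>\<^sub>0 complex) \<Rightarrow> nat \<Rightarrow> 'g \<Rightarrow>\<^sub>0 complex" where
  "rsc t r = (\<lambda>i. psc t (r i))"

definition rmul :: "('g::group_add \<Rightarrow>\<^sub>0 complex) \<Rightarrow> (nat \<Rightarrow> 'g \<Rightarrow>\<^sub>0 complex) \<Rightarrow> nat \<Rightarrow> 'g \<Rightarrow>\<^sub>0 complex" where
  "rmul p r = (\<lambda>i. p * r i)"

definition vsc :: "complex \<Rightarrow> (nat \<Rightarrow> nat \<Rightarrow> 'g \<Rightarrow>\<^sub>0 complex) \<Rightarrow> nat \<Rightarrow> nat \<Rightarrow> 'g \<Rightarrow>\<^sub>0 complex" where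
  "vsc t x = (\<lambda>a b. psc t (x a b))"

definition hst :: "(nat \<Rightarrow> nat \<Rightarrow> 'g::group_add \<Rightarrow>\<^sub>0 complex) \<Rightarrow> nat \<Rightarrow> nat \<Rightarrow> 'g \<Rightarrow>\<^sub>0 complex" where
  "hst x = (\<lambda>a b. star (x b a))"

definition delta_row :: "nat \<Rightarrow> ('g \<Rightarrow>\<^sub>0 complex) \<Rightarrow> nat \<Rightarrow> 'g \<Rightarrow>\<^sub>0 complex" where
  "delta_row a p = (\<lambda>b. if b = a then p else 0)"

lemma vsc_vector_space: "vector_space (vsc :: complex \<Rightarrow> (nat \<Rightarrow> nat \<Rightarrow> 'g \<Rightarrow>\<^sub>0 complex) \<Rightarrow> _)"
proof
  fix a b :: complex and x y :: "nat \<Rightarrow> nat \<Rightarrow> 'g \<Rightarrow>\<^sub>0 complex"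
  show "vsc a (x + y) = vsc a x + vsc a y" by (intro ext) (simp add: fun_app vsc_def psc.scale_right_distrib)
  show "vsc (a + b) x = vsc a x + vsc b x" by (intro ext) (simp add: fun_app vsc_def psc.scale_left_distrib)
  show "vsc a (vsc b x) = vsc (a * b) x" by (intro ext) (simp add: fun_app vsc_def)
  show "vsc 1 x = x" by (intro ext) (simp add: fun_app vsc_def)
qed

interpretation vsc: vector_space vsc
  by (rule vsc_vector_space)

lemma rsc_vector_space: "vector_space (rsc :: complex \<Rightarrow> (nat \<Rightarrow> 'g \<Rightarrow>\<^sub>0 complex) \<Rightarrow> _)"
proof
  fix a b :: complex and x y :: "nat \<Rightarrow> 'g \<Rightarrow>\<^sub>0 complex"
  show "rsc a (x + y) = rsc a x + rsc a y" by (intro ext) (simp add: fun_app rsc_def psc.scale_right_distrib)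
  show "rsc (a + b) x = rsc a x + rsc b x" by (intro ext) (simp add: fun_app rsc_def psc.scale_left_distrib)
  show "rsc a (rsc b x) = rsc (a * b) x" by (intro ext) (simp add: fun_app rsc_def)
  show "rsc 1 x = x" by (intro ext) (simp add: fun_app rsc_def)
qed

interpretation rsc: vector_space rsc
  by (rule rsc_vector_space)

lemma sqm_add_left: "sqm (r + r') s = sqm r s + sqm r' s"
  by (intro ext) (simp add: fun_app sqm_def distrib_left)

lemma sqm_add_right: "sqm r (s + s') = sqm r s + sqm r s'"
  by (intro ext) (simp add: fun_app sqm_def star_add distrib_right)

lemma sqm_diff_left: "sqm (r - r') s = sqm r s - sqm r' s"
  by (intro ext) (simp add: fun_app sqm_def right_diff_distrib)

lemma sqm_diff_right: "sqm r (s - s') = sqm r s - sqm r s'"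
  by (intro ext) (simp add: fun_app sqm_def star_diff left_diff_distrib)

lemma sqm_rsc_left: "sqm (rsc t r) s = vsc t (sqm r s)"
  by (intro ext) (simp add: fun_app sqm_def rsc_def vsc_def psc_mult_right)

lemma sqm_rsc_right: "sqm r (rsc t s) = vsc (cnj t) (sqm r s)"
  by (intro ext) (simp add: fun_app sqm_def rsc_def vsc_def star_psc psc_mult_left)

lemma sqm_zero [simp]: "sqm 0 s = 0" "sqm r 0 = 0"
  by (intro ext, simp add: fun_app sqm_def)+

lemma sqm_shift: "sqm (rmul (Poly_Mapping.single g 1) r) (rmul (Poly_Mapping.single g 1) s) = sqm r s"
proof (intro ext)
  fix a b
  have "star (Poly_Mapping.single g 1 * s a) * (Poly_Mapping.single g 1 * r b)
      = star (s a) * ((Poly_Mapping.single (- g) 1 * Poly_Mapping.single g 1) * r b)"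
    by (simp only: star_mult star_single complex_cnj_one mult.assoc)
  then show "sqm (rmul (Poly_Mapping.single g 1) r) (rmul (Poly_Mapping.single g 1) s) a b = sqm r s a b"
    by (simp add: sqm_def rmul_def mult_single)
qed

lemma hst_sqm: "hst (sqm r s) = sqm s r"
  by (intro ext) (simp add: fun_app hst_def sqm_def star_mult)

lemma hst_add: "hst (x + y) = hst x + hst y"
  and hst_diff: "hst (x - y) = hst x - hst y"
  and hst_minus: "hst (- x) = - hst x"
  and hst_vsc: "hst (vsc t x) = vsc (cnj t) (hst x)"
  and hst_hst: "hst (hst x) = x"
  by (intro ext, simp add: fun_app hst_def star_add star_diff star_minus star_psc vsc_def)+

lemma rmul_mult: "rmul (p * q) r = rmul p (rmul q r)"
  and rmul_add_left: "rmul (p + q) r = rmul p r + rmul q r"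
  and rmul_add: "rmul p (r + s) = rmul p r + rmul p s"
  and rmul_zero [simp]: "rmul p 0 = 0"
  by (intro ext, simp add: fun_app rmul_def mult.assoc distrib_left distrib_right)+

lemma rmul_rsc: "rmul p (rsc t r) = rsc t (rmul p r)"
  by (intro ext) (simp add: fun_app rmul_def rsc_def psc_mult_right)

lemma rmul_single: "rmul (Poly_Mapping.single g a) r = rsc a (rmul (Poly_Mapping.single g 1) r)"
proof (intro ext)
  fix i
  have "Poly_Mapping.single g a * r i = psc a (Poly_Mapping.single g 1) * r i" by simp
  then show "rmul (Poly_Mapping.single g a) r i = rsc a (rmul (Poly_Mapping.single g 1) r) i"
    by (simp only: rmul_def rsc_def psc_mult_left)
qed

lemma rmul_delta: "rmul p (delta_row a q) = delta_row a (p * q)"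
  by (intro ext) (simp add: fun_app rmul_def delta_row_def)

section \<open>The cone of sums of squares and the rows it bounds\<close>

definition supported :: "nat \<Rightarrow> (nat \<Rightarrow> 'b::zero) \<Rightarrow> bool" where
  "supported M r \<longleftrightarrow> (\<forall>i\<ge>M. r i = 0)"

lemma supported_simps [simp]:
  "supported M 0" "supported M r \<Longrightarrow> supported M s \<Longrightarrow> supported M (r + s)"
  "supported M r \<Longrightarrow> supported M s \<Longrightarrow> supported M (r - s)"
  "supported M r \<Longrightarrow> supported M (rsc t r)" "supported M r \<Longrightarrow> supported M (rmul p r)"
  "a < M \<Longrightarrow> supported M (delta_row a q)"
  for r s :: "nat \<Rightarrow> 'g::group_add \<Rightarrow>\<^sub>0 complex"
  by (auto simp: supported_def rsc_def rmul_def delta_row_def fun_app)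

text \<open>Squares of single rows generate the same cone as squares of matrices, since x^* x is the
  sum of the squares of the rows of x. Rows are preferred because they become the vectors of the
  representation.\<close>

definition cone :: "nat \<Rightarrow> (nat \<Rightarrow> nat \<Rightarrow> 'g::group_add \<Rightarrow>\<^sub>0 complex) set" where
  "cone M = {x. \<exists>rs. (\<forall>r\<in>set rs. supported M r) \<and> x = sum_list (map (\<lambda>r. sqm r r) rs)}"

lemma cone_zero: "0 \<in> cone M"
  unfolding cone_def by (rule CollectI, rule exI[of _ "[]"]) simp

lemma cone_step: "x \<in> cone M \<Longrightarrow> supported M r \<Longrightarrow> x + sqm r r \<in> cone M"
proof -
  assume "x \<in> cone M" and r: "supported M r"
  then obtain rs where "\<forall>r\<in>set rs. supported M r" "x = sum_list (map (\<lambda>r. sqm r r) rs)"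
    unfolding cone_def by blast
  then show ?thesis
    unfolding cone_def by (intro CollectI exI[of _ "r # rs"]) (simp add: r add.commute)
qed

lemma cone_induct [consumes 1, case_names cone_zero cone_step]:
  assumes x: "x \<in> cone M" and zero: "P 0"
    and step: "\<And>x r. x \<in> cone M \<Longrightarrow> P x \<Longrightarrow> supported M r \<Longrightarrow> P (x + sqm r r)"
  shows "P x"
proof -
  have "sum_list (map (\<lambda>r. sqm r r) rs) \<in> cone M \<and> P (sum_list (map (\<lambda>r. sqm r r) rs))"
    if "\<forall>r\<in>set rs. supported M r" for rs
    using that
  proof (induction rs)
    case Nil
    show ?case using zero cone_zero by simp
  next
    case (Cons r rs)
    then show ?case using step[of "sum_list (map (\<lambda>r. sqm r r) rs)" r] cone_step[of _ M r]
      by (simp add: add.commute[of "sqm r r"])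
  qed
  then show ?thesis using x unfolding cone_def by blast
qed

lemma cone_sqm: "supported M r \<Longrightarrow> sqm r r \<in> cone M"
  using cone_step[OF cone_zero] by (metis add_0)

lemma cone_add:
  assumes x: "x \<in> cone M" and y: "y \<in> cone M"
  shows "x + y \<in> cone M"
  using y
proof (induction y rule: cone_induct)
  case (cone_step y r)
  then show ?case using Submission.cone_step[of "x + y" M r] by (simp add: add.assoc)
qed (simp add: x)

lemma cone_sum: "(\<And>i. i \<in> I \<Longrightarrow> f i \<in> cone M) \<Longrightarrow> sum f I \<in> cone M"
  by (induction I rule: infinite_finite_induct) (auto intro: cone_zero cone_add)

lemma cone_scale: "x \<in> cone M \<Longrightarrow> 0 \<le> t \<Longrightarrow> vsc (of_real t) x \<in> cone M"
proof (induction x rule: cone_induct)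
  case cone_zero
  show ?case using Submission.cone_zero by simp
next
  case (cone_step x r)
  have "vsc (of_real t) (sqm r r) = sqm (rsc (of_real (sqrt t)) r) (rsc (of_real (sqrt t)) r)"
    using cone_step.prems by (simp add: sqm_rsc_left sqm_rsc_right flip: of_real_mult)
  then have "vsc (of_real t) (x + sqm r r) = vsc (of_real t) x + sqm (rsc (of_real (sqrt t)) r) (rsc (of_real (sqrt t)) r)"
    by (simp add: vsc.scale_right_distrib)
  then show ?case using Submission.cone_step[of "vsc (of_real t) x" M "rsc (of_real (sqrt t)) r"] cone_step by simp
qed

lemma cone_hst: "x \<in> cone M \<Longrightarrow> hst x = x"
proof (induction x rule: cone_induct)
  case cone_zero
  show ?case by (intro ext) (simp add: fun_app hst_def)
qed (simp add: hst_add hst_sqm)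

lemma cone_sum_of_squares:
  "x \<in> cone M \<Longrightarrow> \<exists>xs. set xs \<subseteq> carrier_mat M M \<and> sum_of_squares M xs = mat M M (\<lambda>(a, b). x a b)"
proof (induction x rule: cone_induct)
  case cone_zero
  show ?case by (intro exI[of _ "[]"]) (auto simp: sum_of_squares_def fun_app)
next
  case (cone_step x r)
  then obtain xs where xs: "set xs \<subseteq> carrier_mat M M" "sum_of_squares M xs = mat M M (\<lambda>(a, b). x a b)" by blast
  \<comment> \<open>The row becomes the first row of an otherwise zero square matrix, as
    \<open>sum_of_squares\<close> is taken over square matrices.\<close>
  define A where "A = mat M M (\<lambda>(i, b). if i = 0 then r b else 0)"
  have A: "A \<in> carrier_mat M M" by (simp add: A_def)
  have "(mat_star A * A) $$ (a, b) = sqm r r a b" if "a < M" "b < M" for a b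
  proof -
    have "(mat_star A * A) $$ (a, b) = (\<Sum>i<M. mat_star A $$ (a, i) * A $$ (i, b))"
      by (rule mat_mult_index[OF mat_star_carrier[OF A] A that])
    also have "\<dots> = (\<Sum>i<M. if i = 0 then star (r a) * r b else 0)"
      using that mat_star_index[OF A] by (intro sum.cong refl) (auto simp: A_def)
    also have "\<dots> = sqm r r a b" using that by (simp add: sqm_def)
    finally show ?thesis .
  qed
  then have "sum_of_squares M (A # xs) = mat M M (\<lambda>(a, b). (x + sqm r r) a b)"
    using A xs by (intro eq_matI) (auto simp: sum_of_squares_def add.commute fun_app simp del: index_mult_mat)
  then show ?case using A xs(1) by (intro exI[of _ "A # xs"]) auto
qed

text \<open>The reason why \<open>dominated\<close> is closed under addition: the square of
  \<open>r + s\<close> lies below twice the sum of the squares.\<close>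

lemma parallelogram: "sqm (r + s) (r + s) + sqm (r - s) (r - s) = sqm r r + sqm r r + (sqm s s + sqm s s)"
  by (simp add: sqm_add_left sqm_add_right sqm_diff_left sqm_diff_right)

text \<open>The domain of the inner product that a functional on the matrices bounded by
  \<open>e\<close> induces; a left submodule of the rows.\<close>

definition dominated :: "nat \<Rightarrow> (nat \<Rightarrow> nat \<Rightarrow> 'g::group_add \<Rightarrow>\<^sub>0 complex) \<Rightarrow> (nat \<Rightarrow> 'g \<Rightarrow>\<^sub>0 complex) set" where
  "dominated M e = {r. supported M r \<and> (\<exists>t\<ge>0. vsc (of_real t) e - sqm r r \<in> cone M)}"

lemma dominated_zero: "0 \<in> dominated M e"
  using cone_zero by (auto simp: dominated_def intro!: exI[of _ 0])

lemma dominated_add: "r \<in> dominated M e \<Longrightarrow> s \<in> dominated M e \<Longrightarrow> r + s \<in> dominated M e"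
proof -
  assume "r \<in> dominated M e" "s \<in> dominated M e"
  then obtain t u where *: "supported M r" "supported M s" "0 \<le> t" "0 \<le> u"
    "vsc (of_real t) e - sqm r r \<in> cone M" "vsc (of_real u) e - sqm s s \<in> cone M"
    by (auto simp: dominated_def)
  have "(vsc (of_real t) e - sqm r r) + (vsc (of_real t) e - sqm r r) + ((vsc (of_real u) e - sqm s s) + (vsc (of_real u) e - sqm s s))
      + sqm (r - s) (r - s) \<in> cone M"
    by (intro cone_add cone_sqm) (use * in auto)
  also have "(vsc (of_real t) e - sqm r r) + (vsc (of_real t) e - sqm r r) + ((vsc (of_real u) e - sqm s s) + (vsc (of_real u) e - sqm s s))
      + sqm (r - s) (r - s) = vsc (of_real (t + t + (u + u))) e - sqm (r + s) (r + s)"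
    unfolding of_real_add vsc.scale_left_distrib using parallelogram[of r s] by (simp add: algebra_simps)
  finally show ?thesis using * by (auto simp: dominated_def intro!: exI[of _ "t + t + (u + u)"])
qed

lemma dominated_sum: "(\<And>i. i \<in> I \<Longrightarrow> f i \<in> dominated M e) \<Longrightarrow> sum f I \<in> dominated M e"
  by (induction I rule: infinite_finite_induct) (auto intro: dominated_zero dominated_add)

lemma dominated_rsc: "r \<in> dominated M e \<Longrightarrow> rsc c r \<in> dominated M e"
proof -
  assume "r \<in> dominated M e"
  then obtain t where *: "supported M r" "0 \<le> t" "vsc (of_real t) e - sqm r r \<in> cone M"
    by (auto simp: dominated_def)
  have "vsc (of_real ((cmod c)\<^sup>2)) (vsc (of_real t) e - sqm r r) \<in> cone M" by (rule cone_scale) (use * in auto)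
  also have "vsc (of_real ((cmod c)\<^sup>2)) (vsc (of_real t) e - sqm r r)
      = vsc (of_real ((cmod c)\<^sup>2 * t)) e - sqm (rsc c r) (rsc c r)"
    by (simp add: vsc.scale_right_diff_distrib sqm_rsc_left sqm_rsc_right)
      (simp add: mult.commute flip: complex_norm_square)
  finally show ?thesis using * unfolding dominated_def
    by (intro CollectI conjI exI[of _ "(cmod c)\<^sup>2 * t"]) simp_all
qed

text \<open>Group elements are unitary, so translating a row leaves its square unchanged; general
  elements follow by linearity.\<close>

lemma dominated_rmul: "r \<in> dominated M e \<Longrightarrow> rmul p r \<in> dominated M e"
proof (induction p rule: pm_induct)
  case zero
  have "rmul 0 r = 0" by (intro ext) (simp add: fun_app rmul_def)
  then show ?case using dominated_zero by simp
next
  case (single g a)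
  have "rmul (Poly_Mapping.single g 1) r \<in> dominated M e"
    using single by (auto simp: dominated_def sqm_shift)
  then show ?case unfolding rmul_single[of g a] by (rule dominated_rsc)
qed (simp add: rmul_add_left dominated_add)

text \<open>Adding the skew-hermitian matrices and the multiples of \<open>-q\<close> to the cone forces the
  functional to be hermitian and to vanish at \<open>q\<close>.\<close>

theorem state_exists:
  fixes q e :: "nat \<Rightarrow> nat \<Rightarrow> 'g::group_add \<Rightarrow>\<^sub>0 complex"
  assumes e: "e \<in> cone M" and q: "q \<in> cone M" and qe: "0 \<le> t0" "vsc (of_real t0) e - q \<in> cone M"
    and neg: "\<And>\<epsilon>. 0 < \<epsilon> \<Longrightarrow> q - vsc (of_real \<epsilon>) e \<notin> cone M"
  shows "\<exists>W \<Phi>. (\<forall>x\<in>W. \<forall>y\<in>W. x + y \<in> W \<and> \<Phi> (x + y) = \<Phi> x + \<Phi> y) \<and>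
    (\<forall>c. \<forall>x\<in>W. vsc c x \<in> W \<and> \<Phi> (vsc c x) = c * \<Phi> x) \<and>
    (\<forall>r\<in>dominated M e. \<forall>s\<in>dominated M e. sqm r s \<in> W \<and> \<Phi> (sqm s r) = cnj (\<Phi> (sqm r s))) \<and>
    (\<forall>r\<in>dominated M e. 0 \<le> Re (\<Phi> (sqm r r))) \<and> \<Phi> e = (1::complex) \<and> \<Phi> q = 0"
proof -
  define sc where "sc t x = vsc (of_real t) x" for t :: real and x :: "nat \<Rightarrow> nat \<Rightarrow> 'g \<Rightarrow>\<^sub>0 complex"
  define C where "C = {x. \<exists>c\<in>cone M. \<exists>t\<ge>0. x + hst x = c - sc t q}"
  have vs: "vector_space sc"
    by standard (simp_all add: sc_def vsc.scale_left_distrib vsc.scale_right_distrib)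
  have herm_in: "x \<in> C" if "x \<in> cone M" for x
  proof -
    have "x + hst x = (x + x) - sc 0 q" "x + x \<in> cone M" using that by (auto simp: cone_hst sc_def cone_add)
    then show ?thesis unfolding C_def by blast
  qed
  have cone_sc: "sc t x \<in> cone M" if "x \<in> cone M" "0 \<le> t" for t x
    unfolding sc_def by (rule cone_scale[OF that])
  interpret U: unital_cone sc C e
  proof (intro unital_cone.intro vs unital_cone_axioms.intro)
    show "0 \<in> C" "e \<in> C" using herm_in cone_zero e by auto
    fix x y assume "x \<in> C" "y \<in> C"
    then obtain c t c' t' where *: "c \<in> cone M" "0 \<le> t" "x + hst x = c - sc t q"
      "c' \<in> cone M" "0 \<le> t'" "y + hst y = c' - sc t' q" by (auto simp: C_def)
    have "(x + y) + hst (x + y) = (x + hst x) + (y + hst y)" by (simp add: hst_add add_ac)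
    also have "\<dots> = (c + c') - sc (t + t') q"
      unfolding * sc_def by (simp add: vsc.scale_left_distrib algebra_simps)
    finally show "x + y \<in> C" using * cone_add[of c M c'] by (auto simp: C_def intro!: bexI[of _ "c + c'"] exI[of _ "t + t'"])
  next
    fix x and r :: real assume "x \<in> C" and r: "0 \<le> r"
    then obtain c t where *: "c \<in> cone M" "0 \<le> t" "x + hst x = c - sc t q" by (auto simp: C_def)
    have "sc r x + hst (sc r x) = sc r (x + hst x)" by (simp add: sc_def hst_vsc vsc.scale_right_distrib)
    also have "\<dots> = sc r c - sc (r * t) q" unfolding * by (simp add: sc_def vsc.scale_right_diff_distrib)
    finally show "sc r x \<in> C" using * r cone_sc[of c r] by (auto simp: C_def intro!: bexI[of _ "sc r c"] exI[of _ "r * t"])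
  next
    show "- e \<notin> C"
    proof
      \<comment> \<open>This would put \<open>t\<close> times \<open>q\<close> minus twice
        \<open>e\<close> into the cone. Division by \<open>t\<close> contradicts \<open>neg\<close>,
        and for \<open>t = 0\<close> adding \<open>q\<close> does.\<close>
      assume "- e \<in> C"
      then obtain c t where *: "c \<in> cone M" "0 \<le> t" "- e + hst (- e) = c - sc t q" by (auto simp: C_def)
      have h: "- e + hst (- e) = - sc 2 e"
        unfolding hst_minus cone_hst[OF e] sc_def using vsc.scale_left_distrib[of 1 1 e] by simp
      have c: "c = sc t q - sc 2 e" using *(3) unfolding h by (simp add: algebra_simps)
      show False
      proof (cases "t = 0")
        case True
        have "q - vsc (of_real 2) e \<in> cone M"
          using cone_add[OF q *(1)] True unfolding c by (simp add: sc_def)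
        then show False using neg[of 2] by simp
      next
        case False
        then have t: "0 < t" using * by simp
        have "sc (1 / t) c = q - vsc (of_real (2 / t)) e"
          unfolding c using t by (simp add: sc_def vsc.scale_right_diff_distrib)
        then show False using neg[of "2 / t"] cone_sc[OF *(1), of "1 / t"] t by simp
      qed
    qed
  qed
  obtain \<phi> where p: "(\<forall>x\<in>U.bounded_part. \<forall>y\<in>U.bounded_part. \<phi> (x + y) = \<phi> x + \<phi> y) \<and>
       (\<forall>r. \<forall>x\<in>U.bounded_part. \<phi> (sc r x) = r * \<phi> x) \<and>
       (\<forall>x\<in>U.bounded_part \<inter> C. 0 \<le> \<phi> x) \<and> \<phi> e = (1::real)"
    using U.positive_functional by (rule exE)
  have phi_add: "\<phi> (x + y) = \<phi> x + \<phi> y" if "x \<in> U.bounded_part" "y \<in> U.bounded_part" for x y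
    using p that by simp
  have phi_sc: "\<phi> (sc r x) = r * \<phi> x" if "x \<in> U.bounded_part" for x r
    using p that by simp
  have phi_pos: "0 \<le> \<phi> x" if "x \<in> U.bounded_part" "x \<in> C" for x
    using p that by simp
  have phi_e: "\<phi> e = 1" using p by simp
  note \<phi> = phi_add phi_sc phi_pos phi_e
  let ?B = "U.bounded_part"
  have B_minus: "- x \<in> ?B" "\<phi> (- x) = - \<phi> x" if "x \<in> ?B" for x
    using U.bounded_scale[OF that, of "- 1"] \<phi>(2)[OF that, of "- 1"] by (simp_all add: sc_def)
  have skew: "y \<in> ?B \<and> \<phi> y = 0" if y: "hst y = - y" for y
  proof -
    have "y + hst y = 0 - sc 0 q" "- y + hst (- y) = 0 - sc 0 q" using y by (simp_all add: hst_minus sc_def)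
    then have yC: "y \<in> C" "- y \<in> C" unfolding C_def using cone_zero by blast+
    then have yB: "y \<in> ?B" unfolding U.bounded_part_def by (auto simp: sc_def intro!: exI[of _ 0])
    have "0 \<le> \<phi> y" by (rule \<phi>(3)[OF yB yC(1)])
    moreover have "0 \<le> \<phi> (- y)" by (rule \<phi>(3)[OF B_minus(1)[OF yB] yC(2)])
    ultimately show ?thesis using yB B_minus(2)[OF yB] by simp
  qed
  have hstB: "hst x \<in> ?B \<and> \<phi> (hst x) = \<phi> x" if x: "x \<in> ?B" for x
  proof -
    have s: "hst x - x \<in> ?B \<and> \<phi> (hst x - x) = 0" by (rule skew) (simp add: hst_diff hst_hst)
    have "x + (hst x - x) = hst x" by simp
    then show ?thesis using \<phi>(1)[OF x, of "hst x - x"] U.bounded_add[OF x, of "hst x - x"] s by simp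
  qed
  define W where "W = {x. x \<in> ?B \<and> vsc \<i> x \<in> ?B}"
  \<comment> \<open>The usual complex linear functional with real part \<phi>, defined where both
    \<open>x\<close> and its multiple by \<open>\<i>\<close> are bounded.\<close>
  define \<Phi> where "\<Phi> x = Complex (\<phi> x) (- \<phi> (vsc \<i> x))" for x
  have W_add: "x + y \<in> W \<and> \<Phi> (x + y) = \<Phi> x + \<Phi> y" if "x \<in> W" "y \<in> W" for x y
    using that by (auto simp: W_def \<Phi>_def vsc.scale_right_distrib \<phi>(1) U.bounded_add complex_eq_iff)
  have W_vsc: "vsc c x \<in> W \<and> \<Phi> (vsc c x) = c * \<Phi> x" if x: "x \<in> W" for c x
  proof -
    have xB: "x \<in> ?B" "vsc \<i> x \<in> ?B" using x by (auto simp: W_def)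
    have c: "vsc c x = sc (Re c) x + sc (Im c) (vsc \<i> x)"
      unfolding sc_def vsc.scale_scale vsc.scale_left_distrib[symmetric]
      by (rule arg_cong[where f = "\<lambda>c. vsc c x"]) (simp add: complex_eq_iff)
    have ic: "vsc \<i> (vsc c x) = sc (Re c) (vsc \<i> x) + sc (- Im c) x"
      unfolding sc_def vsc.scale_scale vsc.scale_left_distrib[symmetric]
      by (rule arg_cong[where f = "\<lambda>c. vsc c x"]) (simp add: complex_eq_iff)
    have 1: "vsc c x \<in> ?B" "\<phi> (vsc c x) = Re c * \<phi> x + Im c * \<phi> (vsc \<i> x)"
      unfolding c using xB by (simp_all add: U.bounded_add U.bounded_scale \<phi>)
    have 2: "vsc \<i> (vsc c x) \<in> ?B" "\<phi> (vsc \<i> (vsc c x)) = Re c * \<phi> (vsc \<i> x) - Im c * \<phi> x"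
      unfolding ic
      using U.bounded_add[OF U.bounded_scale[OF xB(2), of "Re c"] U.bounded_scale[OF xB(1), of "- Im c"]]
        phi_add[OF U.bounded_scale[OF xB(2), of "Re c"] U.bounded_scale[OF xB(1), of "- Im c"]]
        phi_sc[OF xB(2), of "Re c"] phi_sc[OF xB(1), of "- Im c"] by simp_all
    show ?thesis using 1 2 by (simp add: W_def \<Phi>_def complex_eq_iff)
  qed
  \<comment> \<open>Polarisation: the squares of \<open>r + s\<close> and \<open>r - s\<close> bound
    the hermitian part of \<open>sqm r s\<close> from below and from above, and only that part is
    tested by \<open>C\<close>.\<close>
  have sqmB: "sqm r s \<in> ?B" if rs: "r \<in> dominated M e" "s \<in> dominated M e" for r s
  proof -
    obtain t u where *: "supported M r" "supported M s" "0 \<le> t" "0 \<le> u"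
      "vsc (of_real t) e - sqm r r \<in> cone M" "vsc (of_real u) e - sqm s s \<in> cone M"
      using rs by (auto simp: dominated_def)
    have h: "sc ((t + u) / 2) e + sc ((t + u) / 2) e = vsc (of_real t) e + vsc (of_real u) e"
      by (simp add: sc_def flip: vsc.scale_left_distrib of_real_add)
    have eh: "hst (sc ((t + u) / 2) e) = sc ((t + u) / 2) e" by (simp add: sc_def hst_vsc cone_hst[OF e])
    let ?h = "sc ((t + u) / 2) e"
    have "(vsc (of_real t) e - sqm r r) + (vsc (of_real u) e - sqm s s) + sqm (r + s) (r + s) \<in> cone M"
      by (intro cone_add cone_sqm) (use * in auto)
    also have "(vsc (of_real t) e - sqm r r) + (vsc (of_real u) e - sqm s s) + sqm (r + s) (r + s)
        = (?h + sqm r s) + hst (?h + sqm r s)"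
      unfolding hst_add eh hst_sqm using h by (simp add: sqm_add_left sqm_add_right algebra_simps)
    finally have p: "?h + sqm r s \<in> C" unfolding C_def by (auto simp: sc_def intro!: bexI exI[of _ 0])
    have "(vsc (of_real t) e - sqm r r) + (vsc (of_real u) e - sqm s s) + sqm (r - s) (r - s) \<in> cone M"
      by (intro cone_add cone_sqm) (use * in auto)
    also have "(vsc (of_real t) e - sqm r r) + (vsc (of_real u) e - sqm s s) + sqm (r - s) (r - s)
        = (?h - sqm r s) + hst (?h - sqm r s)"
      unfolding hst_diff eh hst_sqm using h by (simp add: sqm_diff_left sqm_diff_right algebra_simps)
    finally have "?h - sqm r s \<in> C" unfolding C_def by (auto simp: sc_def intro!: bexI exI[of _ 0])
    with p show ?thesis unfolding U.bounded_part_def by blast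
  qed
  have sqmW: "sqm r s \<in> W" if "r \<in> dominated M e" "s \<in> dominated M e" for r s
    using sqmB[OF that] sqmB[OF dominated_rsc[OF that(1), of \<i>] that(2)] by (simp add: W_def sqm_rsc_left)
  have conj: "\<Phi> (hst x) = cnj (\<Phi> x)" if x: "x \<in> W" for x
  proof -
    have xB: "x \<in> ?B" "vsc \<i> x \<in> ?B" using x by (auto simp: W_def)
    have "vsc \<i> (hst x) = - hst (vsc \<i> x)" by (simp add: hst_vsc)
    then have "\<phi> (vsc \<i> (hst x)) = - \<phi> (vsc \<i> x)"
      using B_minus(2)[of "hst (vsc \<i> x)"] hstB[OF xB(2)] by simp
    then show ?thesis using hstB[OF xB(1)] by (simp add: \<Phi>_def complex_eq_iff)
  qed
  have pos: "0 \<le> Re (\<Phi> (sqm r r))" if r: "r \<in> dominated M e" for r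
    using \<phi>(3)[OF sqmB[OF r r] herm_in[OF cone_sqm]] r by (simp add: \<Phi>_def dominated_def)
  have iskew: "\<phi> (vsc \<i> x) = 0" if "x \<in> cone M" for x
    using skew[of "vsc \<i> x"] cone_hst[OF that] by (simp add: hst_vsc)
  have "\<phi> q = 0"
  proof -
    have "sc t0 e - q \<in> C" using herm_in qe(2) by (simp add: sc_def)
    moreover have "sc t0 e + q \<in> C" using herm_in cone_add[OF cone_sc[OF e qe(1)] q] by simp
    ultimately have qB: "q \<in> ?B" unfolding U.bounded_part_def by blast
    have "- q + hst (- q) = 0 - sc 2 q"
      unfolding hst_minus cone_hst[OF q] sc_def using vsc.scale_left_distrib[of 1 1 q] by simp
    then have "- q \<in> C"
      unfolding C_def by (intro CollectI bexI[of _ 0] exI[of _ 2]) (simp_all add: cone_zero)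
    then have "0 \<le> \<phi> (- q)" by (rule \<phi>(3)[OF B_minus(1)[OF qB]])
    then show ?thesis using B_minus(2)[OF qB] \<phi>(3)[OF qB herm_in[OF q]] by simp
  qed
  then have Pq: "\<Phi> q = 0" using iskew[OF q] by (simp add: \<Phi>_def complex_eq_iff)
  have Pe: "\<Phi> e = 1" using iskew[OF e] \<phi>(4) by (simp add: \<Phi>_def complex_eq_iff)
  have herm: "\<Phi> (sqm s r) = cnj (\<Phi> (sqm r s))" if "r \<in> dominated M e" "s \<in> dominated M e" for r s
    using conj[OF sqmW[OF that]] by (simp add: hst_sqm)
  show ?thesis
    by (rule exI[of _ W], rule exI[of _ \<Phi>], intro conjI ballI allI)
      (rule conjunct1[OF W_add] conjunct2[OF W_add] conjunct1[OF W_vsc] conjunct2[OF W_vsc] sqmW herm pos Pe Pq;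
        assumption)+
qed

section \<open>The representation of a state\<close>

text \<open>Such a tuple is a coboundary because the cohomology vanishes, and orthogonal to all
  coboundaries because the adjoint differential kills it.\<close>

lemma (in unirep) harmonic_zero:
  assumes "based_resolution m D \<eta>" and van: "std_vanishes sc S rep k"
    and \<xi>: "\<xi> \<in> tup (m (Suc k))" and d: "mact (cD D (Suc (Suc k))) \<xi> = 0"
    and ds: "mact (mat_star (cD D (Suc k))) \<xi> = 0"
  shows "\<xi> = 0"
proof -
  interpret B: based_resolution m D \<eta> by fact
  interpret T: pre_hilbert tsc "tup (m (Suc k))" "tip (m (Suc k))" by (rule tup_pre_hilbert)
  obtain \<zeta> where \<zeta>: "\<zeta> \<in> tup (m k)" "\<xi> = mact (cD D (Suc k)) \<zeta>"
    using van \<xi> d unfolding vanishing_iff[OF B.res B.m0] by blast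
  have "tip (m (Suc k)) \<xi> \<xi> = tip (m k) \<zeta> (mact (mat_star (cD D (Suc k))) \<xi>)"
    using mact_adjoint[OF B.cD_carrier \<zeta>(1) \<xi>] \<zeta>(2) by simp
  also have "\<dots> = 0" unfolding ds using tup_nth[OF \<zeta>(1)] by (simp add: tip_def zero_fun_apply)
  finally show ?thesis using T.ip_definite[OF \<xi>] by simp
qed

context based_resolution
begin

text \<open>Generators of the augmentation ideal, one slot at a time. Delta_0 in the same slot is
  d_1^* applied to them, which is \<open>lrow_sum\<close>.\<close>

definition wrow :: "nat \<Rightarrow> nat \<Rightarrow> nat \<Rightarrow> 'g \<Rightarrow>\<^sub>0 complex" where
  "wrow j a = delta_row a (dd j)"

definition lrow :: "nat \<Rightarrow> nat \<Rightarrow> 'g \<Rightarrow>\<^sub>0 complex" where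
  "lrow a = delta_row a lap0"

lemma lrow_sum: "lrow a = (\<Sum>j<m 1. rmul (star (dd j)) (wrow j a))"
proof -
  have "(\<Sum>j\<in>J. delta_row a (f j)) = delta_row a (\<Sum>j\<in>J. f j)" for J and f :: "nat \<Rightarrow> 'g \<Rightarrow>\<^sub>0 complex"
    by (induction J rule: infinite_finite_induct) (auto simp: delta_row_def fun_eq_iff fun_app)
  then show ?thesis by (simp add: lrow_def wrow_def rmul_delta lap0_sum)
qed

end

section \<open>The Gelfand-Naimark-Segal representation spanned by rows\<close>

locale row_functional = based_resolution m D \<eta>
  for m :: "nat \<Rightarrow> nat" and D :: "nat \<Rightarrow> ('g::{group_add,countable} \<Rightarrow>\<^sub>0 rat) mat" and \<eta> +
  fixes M :: nat and e :: "nat \<Rightarrow> nat \<Rightarrow> 'g \<Rightarrow>\<^sub>0 complex"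
    and W :: "(nat \<Rightarrow> nat \<Rightarrow> 'g \<Rightarrow>\<^sub>0 complex) set" and \<Phi> :: "(nat \<Rightarrow> nat \<Rightarrow> 'g \<Rightarrow>\<^sub>0 complex) \<Rightarrow> complex"
  assumes W_add: "x \<in> W \<Longrightarrow> y \<in> W \<Longrightarrow> x + y \<in> W" and \<Phi>_add: "x \<in> W \<Longrightarrow> y \<in> W \<Longrightarrow> \<Phi> (x + y) = \<Phi> x + \<Phi> y"
    and W_vsc: "x \<in> W \<Longrightarrow> vsc c x \<in> W" and \<Phi>_vsc: "x \<in> W \<Longrightarrow> \<Phi> (vsc c x) = c * \<Phi> x"
    and W_sqm: "r \<in> dominated M e \<Longrightarrow> s \<in> dominated M e \<Longrightarrow> sqm r s \<in> W"
    and \<Phi>_herm: "r \<in> dominated M e \<Longrightarrow> s \<in> dominated M e \<Longrightarrow> \<Phi> (sqm s r) = cnj (\<Phi> (sqm r s))"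
    and \<Phi>_pos: "r \<in> dominated M e \<Longrightarrow> 0 \<le> Re (\<Phi> (sqm r r))"
    and wrow_dominated: "j < m 1 \<Longrightarrow> a < M \<Longrightarrow> wrow j a \<in> dominated M e"
begin

lemma \<Phi>_sum: "(\<And>i. i \<in> I \<Longrightarrow> f i \<in> W) \<Longrightarrow> \<Phi> (sum f I) = (\<Sum>i\<in>I. \<Phi> (f i)) \<and> sum f I \<in> W"
proof -
  have base: "0 \<in> W" "\<Phi> 0 = 0"
    using W_sqm[OF dominated_zero dominated_zero] \<Phi>_vsc[OF W_sqm[OF dominated_zero dominated_zero], of 0] by simp_all
  assume "\<And>i. i \<in> I \<Longrightarrow> f i \<in> W"
  then show ?thesis
    by (induction I rule: infinite_finite_induct) (simp_all add: base \<Phi>_add W_add)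
qed

text \<open>The index set is countable, which keeps the completion small. Indices out of range
  receive the zero row and thus become null vectors.\<close>

definition point_row :: "'g \<times> nat \<times> nat \<Rightarrow> nat \<Rightarrow> 'g \<Rightarrow>\<^sub>0 complex" where
  "point_row x = (if fst (snd x) < m 1 \<and> snd (snd x) < M
     then rmul (Poly_Mapping.single (fst x) 1) (wrow (fst (snd x)) (snd (snd x))) else 0)"

definition row_of :: "('g \<times> nat \<times> nat \<Rightarrow>\<^sub>0 complex) \<Rightarrow> nat \<Rightarrow> 'g \<Rightarrow>\<^sub>0 complex" where
  "row_of c = lin rsc point_row c"

definition Q :: "('g \<times> nat \<times> nat \<Rightarrow>\<^sub>0 complex) \<Rightarrow> ('g \<times> nat \<times> nat \<Rightarrow>\<^sub>0 complex) \<Rightarrow> complex" where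
  "Q c d = \<Phi> (sqm (row_of c) (row_of d))"

definition U :: "'g \<Rightarrow> ('g \<times> nat \<times> nat \<Rightarrow>\<^sub>0 complex) \<Rightarrow> ('g \<times> nat \<times> nat \<Rightarrow>\<^sub>0 complex)" where
  "U g = lin psc (\<lambda>x. Poly_Mapping.single (g + fst x, snd x) 1)"

lemma row_of_dominated: "row_of c \<in> dominated M e"
  unfolding row_of_def
  by (rule rsc.lin_mem)
    (auto intro: dominated_zero dominated_add dominated_rsc dominated_rmul wrow_dominated simp: point_row_def
      simp del: One_nat_def)

lemma row_of_add: "row_of (c + d) = row_of c + row_of d"
  and row_of_psc: "row_of (psc a c) = rsc a (row_of c)"
  by (simp_all add: row_of_def rsc.lin_add rsc.lin_psc)

lemma row_of_U: "row_of (U g c) = rmul (Poly_Mapping.single g 1) (row_of c)"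
proof (induction c rule: pm_induct)
  case (single x a)
  have "point_row (g + fst x, snd x) = rmul (Poly_Mapping.single g 1) (point_row x)"
    by (simp add: point_row_def mult_single flip: rmul_mult)
  then show ?case by (simp add: U_def row_of_def rmul_rsc)
qed (simp_all add: U_def psc.lin_add row_of_add rmul_add, simp add: row_of_def)

sublocale F: invariant_form Q U
proof
  fix c c' d :: "'g \<times> nat \<times> nat \<Rightarrow>\<^sub>0 complex" and a g h
  note dom = row_of_dominated
  show "Q (c + c') d = Q c d + Q c' d"
    by (simp add: Q_def row_of_add sqm_add_left \<Phi>_add W_sqm dom)
  show "Q (psc a c) d = a * Q c d" by (simp add: Q_def row_of_psc sqm_rsc_left \<Phi>_vsc W_sqm dom)
  show "Q d c = cnj (Q c d)" unfolding Q_def by (rule \<Phi>_herm[OF dom dom])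
  show "0 \<le> Re (Q c c)" unfolding Q_def by (rule \<Phi>_pos[OF dom])
  show "U g (c + d) = U g c + U g d" "U g (psc a c) = psc a (U g c)"
    by (simp_all add: U_def psc.lin_add psc.lin_psc)
  show "U 0 c = c" by (simp add: U_def)
  show "U (g + h) c = U g (U h c)" by (simp add: U_def psc.lin_lin add.assoc)
  show "Q (U g c) (U g d) = Q c d" by (simp add: Q_def row_of_U sqm_shift)
qed

text \<open>A relation and not a function of the row: vectors are at hand only for rows in the span
  of the translates of \<open>wrow\<close>.\<close>

definition represents :: "('g \<times> nat \<times> nat \<Rightarrow> complex) \<Rightarrow> (nat \<Rightarrow> 'g \<Rightarrow>\<^sub>0 complex) \<Rightarrow> bool" where
  "represents x r \<longleftrightarrow> (\<exists>c. x = F.emb c \<and> row_of c = r)"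

lemma represents_S: "represents x r \<Longrightarrow> x \<in> F.S"
  by (auto simp: represents_def)

lemma represents_ip: "represents x r \<Longrightarrow> represents y s \<Longrightarrow> F.ipc x y = \<Phi> (sqm r s)"
  by (auto simp: represents_def F.ipc_emb Q_def)

text \<open>The passage to the completion has divided out the null vectors of the form.\<close>

lemma represents_null: "represents x r \<Longrightarrow> \<Phi> (sqm r r) = 0 \<Longrightarrow> x = 0"
  using represents_ip[of x r x r] F.P.ip_definite[of x] represents_S[of x r] by simp

lemma \<Phi>_zero: "\<Phi> 0 = 0"
  using \<Phi>_vsc[OF W_sqm[OF dominated_zero dominated_zero], of 0] by simp

lemma represents_zero: "represents x 0 \<Longrightarrow> x = 0"
  using represents_null[of x 0] \<Phi>_zero by simp

lemma represents_0: "represents 0 0"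
  unfolding represents_def
proof (intro exI conjI)
  show "0 = F.emb 0" using F.emb_diff[of 0 0] by simp
  show "row_of 0 = 0" by (simp add: row_of_def)
qed

lemma represents_sum:
  assumes "\<And>i. i \<in> I \<Longrightarrow> represents (x i) (r i)"
  shows "represents (sum x I) (sum r I)"
  using assms
proof (induction I rule: infinite_finite_induct)
  case (insert i I)
  then obtain c d where "x i = F.emb c" "row_of c = r i" "sum x I = F.emb d" "row_of d = sum r I"
    unfolding represents_def by (metis insertI1 insertI2)
  then show ?case
    using insert(1,2) unfolding represents_def by (intro exI[of _ "c + d"]) (simp add: F.emb_add row_of_add)
qed (simp_all add: represents_0)

lemma represents_act:
  assumes "represents x r"
  shows "represents (F.R.act p x) (rmul p r)"
proof -
  obtain c where c: "x = F.emb c" "row_of c = r" using assms by (auto simp: represents_def)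
  show ?thesis
  proof (induction p rule: pm_induct)
    case zero
    have "rmul 0 r = 0" by (intro ext) (simp add: rmul_def zero_fun_apply)
    then show ?case using represents_0 by simp
  next
    case (single g a)
    have "F.R.act (Poly_Mapping.single g a) x = F.emb (psc a (U g c))"
      by (simp add: c F.repc_emb F.emb_psc)
    moreover have "row_of (psc a (U g c)) = rmul (Poly_Mapping.single g a) r"
      by (simp add: row_of_psc row_of_U c rmul_single[of g a])
    ultimately show ?case unfolding represents_def by blast
  next
    case (add p q)
    then obtain c d where "F.R.act p x = F.emb c" "row_of c = rmul p r" "F.R.act q x = F.emb d" "row_of d = rmul q r"
      unfolding represents_def by blast
    then show ?case
      unfolding represents_def by (intro exI[of _ "c + d"]) (simp add: F.emb_add row_of_add F.R.act_add_left rmul_add_left)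
  qed
qed

definition K :: "nat \<Rightarrow> nat \<Rightarrow> 'g \<times> nat \<times> nat \<Rightarrow> complex" where
  "K j a = F.emb (Poly_Mapping.single (0, j, a) 1)"

lemma represents_K: "j < m 1 \<Longrightarrow> a < M \<Longrightarrow> represents (K j a) (wrow j a)"
proof -
  assume "j < m 1" "a < M"
  moreover have "rmul (Poly_Mapping.single 0 1) r = r" for r :: "nat \<Rightarrow> 'g \<Rightarrow>\<^sub>0 complex"
    by (intro ext) (simp add: rmul_def)
  ultimately show ?thesis
    unfolding represents_def K_def
    by (intro exI[of _ "Poly_Mapping.single (0, j, a) 1"]) (simp add: row_of_def point_row_def)
qed

text \<open>For fixed \<open>a\<close> the vectors \<open>K j a\<close> are the basis values of a
  1-cocycle, because consecutive differentials compose to 0.\<close>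

lemma D2_K:
  assumes "i < m 2" "a < M"
  shows "(\<Sum>j<m 1. F.R.act (cD D 2 $$ (i, j)) (K j a)) = 0"
proof (rule represents_zero)
  have "(\<Sum>j<m 1. rmul (cD D 2 $$ (i, j)) (wrow j a)) = delta_row a (\<Sum>j<m 1. cD D 2 $$ (i, j) * dd j)"
  proof -
    have "(\<Sum>j\<in>J. delta_row a (f j)) = delta_row a (\<Sum>j\<in>J. f j)" for J and f :: "nat \<Rightarrow> 'g \<Rightarrow>\<^sub>0 complex"
      by (induction J rule: infinite_finite_induct) (auto simp: delta_row_def fun_eq_iff fun_app)
    then show ?thesis by (simp add: wrow_def rmul_delta)
  qed
  also have "(\<Sum>j<m 1. cD D 2 $$ (i, j) * dd j) = (cD D (Suc (Suc 0)) * cD D (Suc 0)) $$ (i, 0)"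
    using mat_mult_index[OF cD_carrier[of "Suc 0"] cD_carrier[of 0], of i 0] assms
    by (simp add: m0 dd_def numeral_2_eq_2 del: index_mult_mat)
  also have "\<dots> = 0" unfolding cD_cD using assms by (simp add: m0 numeral_2_eq_2)
  also have "delta_row a 0 = (0 :: nat \<Rightarrow> 'g \<Rightarrow>\<^sub>0 complex)" by (intro ext) (simp add: delta_row_def zero_fun_apply)
  finally have "(\<Sum>j<m 1. rmul (cD D 2 $$ (i, j)) (wrow j a)) = 0" .
  then show "represents (\<Sum>j<m 1. F.R.act (cD D 2 $$ (i, j)) (K j a)) 0"
    using represents_sum[of "{..<m 1}" "\<lambda>j. F.R.act (cD D 2 $$ (i, j)) (K j a)" "\<lambda>j. rmul (cD D 2 $$ (i, j)) (wrow j a)"]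
      represents_act[OF represents_K] assms by simp
qed

lemma K_S: "K j a \<in> F.S"
  by (simp add: K_def)

text \<open>Pairing with an invariant vector turns the action on the \<open>K j a\<close> into
  \<open>aug\<close>, so the cocycle equation becomes one with trivial coefficients, which has only
  the zero solution. As the translates of the \<open>K j a\<close> span a dense subspace, the
  invariant vector is 0.\<close>

lemma invariant_free:
  assumes univ: "\<exists>f :: real \<Rightarrow> 'v. inj f" and T: "property_T TYPE('v) TYPE('g) n" and n: "1 \<le> n"
  shows "F.R.invariant_free"
  unfolding F.R.invariant_free_def
proof (intro ballI impI)
  fix f assume f: "f \<in> F.S" and inv: "\<forall>g. F.repc g f = f"
  have z: "F.ipc (K j a) f = 0" if j: "j < m 1" and a: "a < M" for j a
  proof (rule property_T_no_trivial_cocycle[OF univ T n _ j])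
    fix i assume i: "i < m 2"
    have D2: "D 2 \<in> carrier_mat (m 2) (m 1)" using D_carrier[of 1] by (simp add: numeral_2_eq_2)
    have act: "F.ipc (F.R.act (complexify p) x) f = of_rat (aug p) * F.ipc x f" if x: "x \<in> F.S" for p x
    proof (induction p rule: pm_induct)
      case (single g b)
      have "F.ipc (F.repc g x) f = F.ipc x f" using F.R.rep_ip[OF x f, of g] inv by simp
      then show ?case using x f by (simp add: F.P.ip_scale aug_csum csum_single)
    qed (use x f in \<open>simp_all add: complexify_add F.R.act_add_left F.P.ip_add aug_add of_rat_add distrib_right\<close>,
        simp_all add: aug_def)
    have "(\<Sum>j<m 1. of_rat (aug (D 2 $$ (i, j))) * F.ipc (K j a) f)
        = (\<Sum>j<m 1. F.ipc (F.R.act (cD D 2 $$ (i, j)) (K j a)) f)"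
      using D2 i by (intro sum.cong refl) (simp add: act K_S)
    also have "\<dots> = F.ipc (\<Sum>j<m 1. F.R.act (cD D 2 $$ (i, j)) (K j a)) f"
      by (rule F.P.ip_sum_left[symmetric]) (use K_S f in auto)
    also have "\<dots> = 0" unfolding D2_K[OF i a] using f by simp
    finally show "(\<Sum>j<m 1. of_rat (aug (D 2 $$ (i, j))) * F.ipc (K j a) f) = 0" .
  qed
  show "f = 0"
  proof (rule ext, safe)
    fix g j a
    have fx: "f (g, j, a) = F.ipc f (F.emb (Poly_Mapping.single (g, j, a) 1))" by (rule F.S_apply[OF f])
    show "f (g, j, a) = 0 (g, j, a)"
    proof (cases "j < m 1 \<and> a < M")
      case True
      have "F.emb (Poly_Mapping.single (g, j, a) 1) = F.repc g (K j a)"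
        by (simp add: K_def F.repc_emb U_def)
      then have "f (g, j, a) = F.ipc (F.repc g f) (F.repc g (K j a))" using fx inv by simp
      also have "\<dots> = cnj (F.ipc (K j a) f)"
        using F.R.rep_ip[OF f K_S] F.P.ip_commute[OF K_S f] by simp
      finally show ?thesis using z True by (simp add: zero_fun_apply)
    next
      case False
      \<comment> \<open>An index out of range carries the zero row, so this coordinate of every
        vector is 0.\<close>
      then have "represents (F.emb (Poly_Mapping.single (g, j, a) 1)) 0"
        unfolding represents_def by (intro exI[of _ "Poly_Mapping.single (g, j, a) 1"]) (auto simp: row_of_def point_row_def)
      from represents_zero[OF this] show ?thesis using fx f by (simp add: zero_fun_apply)
    qed
  qed
qed

lemma vanishing:
  assumes univ: "\<exists>f :: real \<Rightarrow> 'v. inj f" and T: "property_T TYPE('v) TYPE('g) n" and k: "Suc k \<le> n"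
  shows "std_vanishes fsc F.S F.repc k"
proof -
  obtain \<iota> :: "('g \<times> nat \<times> nat \<Rightarrow> complex) \<Rightarrow> 'v" where \<iota>: "inj \<iota>"
    using countable_functions_embed[OF univ] by blast
  show ?thesis
    by (rule F.R.property_T_vanishing[OF T k _ invariant_free[OF univ T], where \<iota> = \<iota>])
      (use k \<iota> in \<open>auto intro: inj_on_subset\<close>)
qed

lemma no_harmonic:
  assumes univ: "\<exists>f :: real \<Rightarrow> 'v. inj f" and T: "property_T TYPE('v) TYPE('g) n" and k: "Suc k \<le> n"
    and x: "\<And>a. a < m (Suc k) \<Longrightarrow> represents (x a) (r a)"
    and up: "\<And>b. b < m (Suc (Suc k)) \<Longrightarrow> (\<Sum>a<m (Suc k). F.R.act (cD D (Suc (Suc k)) $$ (b, a)) (x a)) = 0"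
    and down: "\<And>b. b < m k \<Longrightarrow> (\<Sum>a<m (Suc k). F.R.act (mat_star (cD D (Suc k)) $$ (b, a)) (x a)) = 0"
    and a: "a < m (Suc k)"
  shows "\<Phi> (sqm (r a) (r a)) = 0"
proof -
  define \<xi> where "\<xi> b = (if b < m (Suc k) then x b else 0)" for b
  have \<xi>: "\<xi> \<in> F.P.tup (m (Suc k))" using x represents_S by (auto simp: F.P.tup_def \<xi>_def)
  have "F.R.mact (cD D (Suc (Suc k))) \<xi> = 0"
  proof
    fix b show "F.R.mact (cD D (Suc (Suc k))) \<xi> b = 0 b"
      using up[of b] F.R.mact_nth[OF cD_carrier, of b "Suc k" \<xi>] F.R.mact_out[OF cD_carrier, of b "Suc k" \<xi>]
      by (cases "b < m (Suc (Suc k))") (simp_all add: \<xi>_def zero_fun_apply)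
  qed
  moreover have "F.R.mact (mat_star (cD D (Suc k))) \<xi> = 0"
  proof
    note c = mat_star_carrier[OF cD_carrier[of k]]
    fix b show "F.R.mact (mat_star (cD D (Suc k))) \<xi> b = 0 b"
      using down[of b] F.R.mact_nth[OF c, of b \<xi>] F.R.mact_out[OF c, of b \<xi>]
      by (cases "b < m k") (simp_all add: \<xi>_def zero_fun_apply)
  qed
  ultimately have z: "\<xi> = 0"
    by (rule F.R.harmonic_zero[OF based_resolution_axioms vanishing[OF univ T k] \<xi>])
  then have "x a = 0"
  proof -
    have "\<xi> a = 0" unfolding z by (simp add: zero_fun_apply)
    then show ?thesis using a by (simp add: \<xi>_def)
  qed
  then show ?thesis using represents_ip[OF x[OF a] x[OF a]] by simp
qed

end

section \<open>Sums of squares from property (T)\<close>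

lemma sum_dominated:
  assumes "finite I" "\<And>i. i \<in> I \<Longrightarrow> r i \<in> dominated M e"
  shows "\<exists>t\<ge>0. vsc (of_real t) e - (\<Sum>i\<in>I. sqm (r i) (r i)) \<in> cone M"
  using assms
proof (induction I)
  case empty
  show ?case using cone_zero by (auto intro!: exI[of _ 0])
next
  case (insert i I)
  then obtain t where t: "0 \<le> t" "vsc (of_real t) e - (\<Sum>i\<in>I. sqm (r i) (r i)) \<in> cone M" by auto
  obtain u where u: "0 \<le> u" "vsc (of_real u) e - sqm (r i) (r i) \<in> cone M"
    using insert.prems[of i] by (auto simp: dominated_def)
  have "vsc (of_real (t + u)) e - (\<Sum>i\<in>insert i I. sqm (r i) (r i)) =
      (vsc (of_real t) e - (\<Sum>i\<in>I. sqm (r i) (r i))) + (vsc (of_real u) e - sqm (r i) (r i))"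
    using insert.hyps unfolding of_real_add vsc.scale_left_distrib by (simp add: algebra_simps)
  then show ?case using cone_add[OF t(2) u(2)] t u by (intro exI[of _ "t + u"]) simp
qed

text \<open>Carries the degree 0 inequality, which concerns 1 by 1 matrices, to a diagonal position
  of a larger matrix.\<close>

definition place :: "nat \<Rightarrow> (nat \<Rightarrow> nat \<Rightarrow> 'g \<Rightarrow>\<^sub>0 complex) \<Rightarrow> nat \<Rightarrow> nat \<Rightarrow> 'g \<Rightarrow>\<^sub>0 complex" where
  "place a x = (\<lambda>b c. if b = a \<and> c = a then x 0 0 else 0)"

lemma place_add: "place a (x + y) = place a x + place a y"
  and place_diff: "place a (x - y) = place a x - place a y"
  and place_zero: "place a 0 = 0"
  and place_vsc: "place a (vsc t x) = vsc t (place a x)"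
  by (intro ext, simp add: place_def fun_app vsc_def)+

lemma place_sum: "place a (sum f I) = (\<Sum>i\<in>I. place a (f i))"
  by (induction I rule: infinite_finite_induct) (auto simp: place_add place_zero)

lemma place_sqm: "place a (sqm r s) = sqm (delta_row a (r 0)) (delta_row a (s 0))"
  by (intro ext) (simp add: place_def sqm_def delta_row_def)

lemma place_cone: "a < M \<Longrightarrow> x \<in> cone N \<Longrightarrow> place a x \<in> cone M"
proof -
  assume a: "a < M" and "x \<in> cone N"
  from this(2) show "place a x \<in> cone M"
  proof (induction x rule: cone_induct)
    case cone_zero
    show ?case unfolding place_zero by (rule Submission.cone_zero)
  next
    case (cone_step x r)
    then show ?case unfolding place_add place_sqm by (intro Submission.cone_step) (use a in auto)
  qed
qed

lemma sandwich_index: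
  assumes A: "A \<in> carrier_mat M M" and ab: "a < M" "b < M"
  shows "(scalar_mat M l * A * scalar_mat M l) $$ (a, b) = l * A $$ (a, b) * (l :: 'r::ring_1)"
proof -
  have s: "scalar_mat M l \<in> carrier_mat M M" by simp
  have sn: "scalar_mat M l $$ (i, j) = (if i = j then l else 0)" if "i < M" "j < M" for i j
    using that by (simp add: scalar_mat_def)
  have 1: "(scalar_mat M l * A) $$ (a, c) = l * A $$ (a, c)" if c: "c < M" for c
  proof -
    have "(scalar_mat M l * A) $$ (a, c) = (\<Sum>k<M. if k = a then l * A $$ (a, c) else 0)"
      unfolding mat_mult_index[OF s A ab(1) c] using ab by (intro sum.cong refl) (auto simp: sn)
    then show ?thesis using ab by simp
  qed
  have "(scalar_mat M l * A * scalar_mat M l) $$ (a, b) = (\<Sum>k<M. if k = b then l * A $$ (a, b) * l else 0)"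
    unfolding mat_mult_index[OF mult_carrier_mat[OF s A] s ab]
    using ab by (intro sum.cong refl) (auto simp: sn 1 simp del: index_mult_mat)
  then show ?thesis using ab by simp
qed

section \<open>The separation argument in each degree\<close>

locale countable_resolution = based_resolution m D \<eta>
  for m :: "nat \<Rightarrow> nat" and D :: "nat \<Rightarrow> ('g::{group_add,countable} \<Rightarrow>\<^sub>0 rat) mat" and \<eta>
begin

lemma functional_exists:
  assumes e: "e \<in> cone M" and q: "q \<in> cone M" and qe: "\<exists>t\<ge>0. vsc (of_real t) e - q \<in> cone M"
    and neg: "\<And>\<epsilon>. 0 < \<epsilon> \<Longrightarrow> q - vsc (of_real \<epsilon>) e \<notin> cone M"
    and w: "\<And>j a. j < m 1 \<Longrightarrow> a < M \<Longrightarrow> wrow j a \<in> dominated M e"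
  shows "\<exists>W \<Phi>. row_functional m D \<eta> M e W \<Phi> \<and> \<Phi> e = 1 \<and> \<Phi> q = 0"
proof -
  obtain t where t: "0 \<le> t" "vsc (of_real t) e - q \<in> cone M" using qe by blast
  obtain W where "\<exists>\<Phi>. (\<forall>x\<in>W. \<forall>y\<in>W. x + y \<in> W \<and> \<Phi> (x + y) = \<Phi> x + \<Phi> y) \<and>
    (\<forall>c. \<forall>x\<in>W. vsc c x \<in> W \<and> \<Phi> (vsc c x) = c * \<Phi> x) \<and>
    (\<forall>r\<in>dominated M e. \<forall>s\<in>dominated M e. sqm r s \<in> W \<and> \<Phi> (sqm s r) = cnj (\<Phi> (sqm r s))) \<and>
    (\<forall>r\<in>dominated M e. 0 \<le> Re (\<Phi> (sqm r r))) \<and> \<Phi> e = (1::complex) \<and> \<Phi> q = 0"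
    using state_exists[OF e q t neg] by (rule exE)
  then obtain \<Phi> where \<Phi>: "(\<forall>x\<in>W. \<forall>y\<in>W. x + y \<in> W \<and> \<Phi> (x + y) = \<Phi> x + \<Phi> y) \<and>
    (\<forall>c. \<forall>x\<in>W. vsc c x \<in> W \<and> \<Phi> (vsc c x) = c * \<Phi> x) \<and>
    (\<forall>r\<in>dominated M e. \<forall>s\<in>dominated M e. sqm r s \<in> W \<and> \<Phi> (sqm s r) = cnj (\<Phi> (sqm r s))) \<and>
    (\<forall>r\<in>dominated M e. 0 \<le> Re (\<Phi> (sqm r r))) \<and> \<Phi> e = (1::complex) \<and> \<Phi> q = 0"
    by (rule exE)
  note c1 = conjunct1[OF \<Phi>] and c2 = conjunct1[OF conjunct2[OF \<Phi>]]
    and c3 = conjunct1[OF conjunct2[OF conjunct2[OF \<Phi>]]]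
    and c4 = conjunct1[OF conjunct2[OF conjunct2[OF conjunct2[OF \<Phi>]]]]
    and c5 = conjunct2[OF conjunct2[OF conjunct2[OF conjunct2[OF \<Phi>]]]]
  have r1: "x + y \<in> W" "\<Phi> (x + y) = \<Phi> x + \<Phi> y" if "x \<in> W" "y \<in> W" for x y
    using bspec[OF bspec[OF c1 that(1)] that(2)] by auto
  have r2: "vsc c x \<in> W" "\<Phi> (vsc c x) = c * \<Phi> x" if "x \<in> W" for c x
    using bspec[OF spec[OF c2, of c] that] by auto
  have r3: "sqm r s \<in> W" "\<Phi> (sqm s r) = cnj (\<Phi> (sqm r s))" if "r \<in> dominated M e" "s \<in> dominated M e" for r s
    using bspec[OF bspec[OF c3 that(1)] that(2)] by auto
  have r4: "0 \<le> Re (\<Phi> (sqm r r))" if "r \<in> dominated M e" for r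
    using bspec[OF c4 that] .
  have "row_functional m D \<eta> M e W \<Phi>"
    by (intro row_functional.intro row_functional_axioms.intro based_resolution_axioms)
      (rule r1 r2 r3 r4 w; assumption)+
  then show ?thesis using c5 by blast
qed

text \<open>Here \<open>e\<close> is Delta_0 and \<open>q\<close> is Delta_0^2. The vectors
  \<open>K j 0\<close> form a 1-cocycle. Its image under d_1^* has squared norm \<Phi> q = 0, so it
  is harmonic, whereas its own squared norm is \<Phi> e = 1.\<close>

theorem gap_degree_0:
  assumes univ: "\<exists>f :: real \<Rightarrow> 'v. inj f" and T: "property_T TYPE('v) TYPE('g) n" and n: "1 \<le> n"
  shows "\<exists>\<epsilon>>0. sqm (lrow 0) (lrow 0) - vsc (of_real \<epsilon>) (\<Sum>j<m 1. sqm (wrow j 0) (wrow j 0)) \<in> cone 1"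
proof (rule ccontr)
  define e where "e = (\<Sum>j<m 1. sqm (wrow j 0) (wrow j 0))"
  define q where "q = sqm (lrow 0) (lrow 0)"
  assume "\<not> ?thesis"
  then have neg: "q - vsc (of_real \<epsilon>) e \<notin> cone 1" if "0 < \<epsilon>" for \<epsilon> using that by (auto simp: e_def q_def)
  have ws: "supported 1 (wrow j 0)" for j by (simp add: wrow_def)
  have e: "e \<in> cone 1" unfolding e_def by (intro cone_sum cone_sqm ws)
  have q: "q \<in> cone 1" unfolding q_def by (rule cone_sqm) (simp add: lrow_def)
  \<comment> \<open>In degree 0 domination is immediate, as the squares of these rows are the
    summands of \<open>e\<close>.\<close>
  have w: "wrow j a \<in> dominated 1 e" if "j < m 1" "a < 1" for j a
  proof -
    have "e - sqm (wrow j 0) (wrow j 0) = (\<Sum>l\<in>{..<m 1} - {j}. sqm (wrow l 0) (wrow l 0))"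
      unfolding e_def using that by (subst sum.remove[of _ j]) auto
    also have "\<dots> \<in> cone 1" by (intro cone_sum cone_sqm ws)
    finally have "vsc (of_real 1) e - sqm (wrow j 0) (wrow j 0) \<in> cone 1" by simp
    then have "wrow j 0 \<in> dominated 1 e"
      unfolding dominated_def using ws by (intro CollectI conjI exI[of _ 1]) simp_all
    then show ?thesis using that by simp
  qed
  have l: "lrow 0 \<in> dominated 1 e"
    unfolding lrow_sum by (intro dominated_sum dominated_rmul w) auto
  then have qe: "\<exists>t\<ge>0. vsc (of_real t) e - q \<in> cone 1" unfolding dominated_def q_def by blast
  obtain W \<Phi> where rf: "row_functional m D \<eta> 1 e W \<Phi>" and \<Phi>: "\<Phi> e = 1" "\<Phi> q = 0"
    using functional_exists[OF e q qe neg w] by blast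
  interpret R: row_functional m D \<eta> 1 e W \<Phi> by (rule rf)
  have z: "\<Phi> (sqm (wrow j 0) (wrow j 0)) = 0" if j: "j < m 1" for j
  proof (rule R.no_harmonic[OF univ T, of 0 "\<lambda>j. R.K j 0" "\<lambda>j. wrow j 0" j])
    show "Suc 0 \<le> n" "j < m (Suc 0)" using n j by auto
    show "R.represents (R.K a 0) (wrow a 0)" if "a < m (Suc 0)" for a using that by (intro R.represents_K) auto
    show "(\<Sum>a<m (Suc 0). R.F.R.act (cD D (Suc (Suc 0)) $$ (b, a)) (R.K a 0)) = 0" if "b < m (Suc (Suc 0))" for b
      using R.D2_K[of b 0] that by (simp add: numeral_2_eq_2)
    show "(\<Sum>a<m (Suc 0). R.F.R.act (mat_star (cD D (Suc 0)) $$ (b, a)) (R.K a 0)) = 0" if "b < m 0" for b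
    proof (rule R.represents_null)
      have "R.represents (\<Sum>a<m 1. R.F.R.act (star (dd a)) (R.K a 0)) (lrow 0)"
        unfolding lrow_sum by (intro R.represents_sum R.represents_act R.represents_K) auto
      moreover have "(\<Sum>a<m (Suc 0). R.F.R.act (mat_star (cD D (Suc 0)) $$ (b, a)) (R.K a 0))
          = (\<Sum>a<m 1. R.F.R.act (star (dd a)) (R.K a 0))"
        using that m0 by (intro sum.cong) (simp_all add: mat_star_index[OF cD_carrier[of 0]] dd_def)
      ultimately show "R.represents (\<Sum>a<m (Suc 0). R.F.R.act (mat_star (cD D (Suc 0)) $$ (b, a)) (R.K a 0)) (lrow 0)" by simp
      show "\<Phi> (sqm (lrow 0) (lrow 0)) = 0" using \<Phi>(2) by (simp add: q_def)
    qed
  qed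
  have "\<Phi> e = (\<Sum>j<m 1. \<Phi> (sqm (wrow j 0) (wrow j 0)))"
    unfolding e_def using R.\<Phi>_sum[of "{..<m 1}" "\<lambda>j. sqm (wrow j 0) (wrow j 0)"] R.W_sqm w by simp
  then show False using z \<Phi>(1) by simp
qed

definition up_row :: "nat \<Rightarrow> nat \<Rightarrow> nat \<Rightarrow> 'g \<Rightarrow>\<^sub>0 complex" where
  "up_row k b = (\<Sum>a<m (Suc k). rmul (cD D (Suc (Suc k)) $$ (b, a)) (lrow a))"

definition down_row :: "nat \<Rightarrow> nat \<Rightarrow> nat \<Rightarrow> 'g \<Rightarrow>\<^sub>0 complex" where
  "down_row k b = (\<Sum>a<m (Suc k). rmul (mat_star (cD D (Suc k)) $$ (b, a)) (lrow a))"

text \<open>Delta_0 Delta Delta_0 in degree \<open>Suc k\<close>, written as a sum of squares so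
  that a positive functional that is 0 on it is 0 on each square.\<close>

definition lap_form :: "nat \<Rightarrow> nat \<Rightarrow> nat \<Rightarrow> 'g \<Rightarrow>\<^sub>0 complex" where
  "lap_form k = (\<Sum>b<m k. sqm (down_row k b) (down_row k b)) + (\<Sum>b<m (Suc (Suc k)). sqm (up_row k b) (up_row k b))"

text \<open>The vectors of the rows \<open>lrow a\<close> form the harmonic tuple: coboundary and
  adjoint send them to the vectors of \<open>up_row\<close> and \<open>down_row\<close>, whose norms
  are 0 when \<Phi> is 0 on \<open>lap_form k\<close>, while their squared norms add up to \<Phi> e
  = 1.\<close>

theorem gap_degree_Suc:
  assumes univ: "\<exists>f :: real \<Rightarrow> 'v. inj f" and T: "property_T TYPE('v) TYPE('g) n" and k: "Suc k \<le> n"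
  shows "\<exists>\<epsilon>>0. lap_form k - vsc (of_real \<epsilon>) (\<Sum>a<m (Suc k). sqm (lrow a) (lrow a)) \<in> cone (m (Suc k))"
proof (rule ccontr)
  let ?M = "m (Suc k)"
  define e where "e = (\<Sum>a<?M. sqm (lrow a) (lrow a))"
  assume "\<not> ?thesis"
  then have neg: "lap_form k - vsc (of_real \<epsilon>) e \<notin> cone ?M" if "0 < \<epsilon>" for \<epsilon> using that by (auto simp: e_def)
  have ls: "supported ?M (lrow a)" if "a < ?M" for a using that by (simp add: lrow_def)
  have e: "e \<in> cone ?M" unfolding e_def by (intro cone_sum cone_sqm ls) auto
  obtain \<epsilon> where eps: "0 < \<epsilon>"
    and g0: "sqm (lrow 0) (lrow 0) - vsc (of_real \<epsilon>) (\<Sum>j<m 1. sqm (wrow j 0) (wrow j 0)) \<in> cone 1"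
    using gap_degree_0[OF univ T] k by auto
  \<comment> \<open>In slot \<open>a\<close> the degree 0 inequality bounds the square of
    \<open>wrow j a\<close> by \<open>1 / \<epsilon>\<close> times the square of
    \<open>lrow a\<close>, which is a summand of \<open>e\<close>.\<close>
  have w: "wrow j a \<in> dominated ?M e" if j: "j < m 1" and a: "a < ?M" for j a
  proof -
    have ws: "supported ?M (wrow l a)" for l using a by (simp add: wrow_def)
    have "place a (sqm (lrow 0) (lrow 0) - vsc (of_real \<epsilon>) (\<Sum>j<m 1. sqm (wrow j 0) (wrow j 0))) \<in> cone ?M"
      by (rule place_cone[OF a g0])
    also have "place a (sqm (lrow 0) (lrow 0) - vsc (of_real \<epsilon>) (\<Sum>j<m 1. sqm (wrow j 0) (wrow j 0)))
        = sqm (lrow a) (lrow a) - vsc (of_real \<epsilon>) (\<Sum>j<m 1. sqm (wrow j a) (wrow j a))"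
      unfolding place_diff place_vsc place_sum place_sqm by (simp add: lrow_def wrow_def delta_row_def)
    finally have "vsc (of_real (1 / \<epsilon>)) (sqm (lrow a) (lrow a) - vsc (of_real \<epsilon>) (\<Sum>j<m 1. sqm (wrow j a) (wrow j a))) \<in> cone ?M"
      by (rule cone_scale) (use eps in simp)
    then have 1: "vsc (of_real (1 / \<epsilon>)) (sqm (lrow a) (lrow a)) - (\<Sum>j<m 1. sqm (wrow j a) (wrow j a)) \<in> cone ?M"
      using eps by (simp add: vsc.scale_right_diff_distrib)
    have 2: "(\<Sum>l\<in>{..<m 1} - {j}. sqm (wrow l a) (wrow l a)) \<in> cone ?M" by (intro cone_sum cone_sqm ws)
    have 3: "vsc (of_real (1 / \<epsilon>)) (\<Sum>b\<in>{..<?M} - {a}. sqm (lrow b) (lrow b)) \<in> cone ?M"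
      by (intro cone_scale cone_sum cone_sqm ls) (use eps in auto)
    have "vsc (of_real (1 / \<epsilon>)) e - sqm (wrow j a) (wrow j a) =
        (vsc (of_real (1 / \<epsilon>)) (sqm (lrow a) (lrow a)) - (\<Sum>j<m 1. sqm (wrow j a) (wrow j a)))
        + (\<Sum>l\<in>{..<m 1} - {j}. sqm (wrow l a) (wrow l a)) + vsc (of_real (1 / \<epsilon>)) (\<Sum>b\<in>{..<?M} - {a}. sqm (lrow b) (lrow b))"
    proof -
      have "e = sqm (lrow a) (lrow a) + (\<Sum>b\<in>{..<?M} - {a}. sqm (lrow b) (lrow b))"
        unfolding e_def by (rule sum.remove) (use a in auto)
      moreover have "(\<Sum>j<m 1. sqm (wrow j a) (wrow j a)) = sqm (wrow j a) (wrow j a) + (\<Sum>l\<in>{..<m 1} - {j}. sqm (wrow l a) (wrow l a))"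
        by (rule sum.remove) (use j in auto)
      ultimately show ?thesis by (simp add: vsc.scale_right_distrib)
    qed
    then have "vsc (of_real (1 / \<epsilon>)) e - sqm (wrow j a) (wrow j a) \<in> cone ?M"
      using cone_add[OF cone_add[OF 1 2] 3] by simp
    then show ?thesis
      unfolding dominated_def using ws eps by (intro CollectI conjI exI[of _ "1 / \<epsilon>"]) simp_all
  qed
  have l: "lrow a \<in> dominated ?M e" if "a < ?M" for a
    unfolding lrow_sum using that by (intro dominated_sum dominated_rmul w) auto
  have ud: "up_row k b \<in> dominated ?M e" "down_row k b \<in> dominated ?M e" for b
    unfolding up_row_def down_row_def by (auto intro!: dominated_sum dominated_rmul l)
  have us: "supported ?M (up_row k b)" "supported ?M (down_row k b)" for b
    using ud[of b] by (simp_all add: dominated_def)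
  have q: "lap_form k \<in> cone ?M" unfolding lap_form_def by (intro cone_add cone_sum cone_sqm us)
  have qe: "\<exists>t\<ge>0. vsc (of_real t) e - lap_form k \<in> cone ?M"
  proof -
    obtain t where t: "0 \<le> t" "vsc (of_real t) e - (\<Sum>b<m k. sqm (down_row k b) (down_row k b)) \<in> cone ?M"
      using sum_dominated[of "{..<m k}" "down_row k" ?M e] ud by auto
    obtain u where u: "0 \<le> u" "vsc (of_real u) e - (\<Sum>b<m (Suc (Suc k)). sqm (up_row k b) (up_row k b)) \<in> cone ?M"
      using sum_dominated[of "{..<m (Suc (Suc k))}" "up_row k" ?M e] ud by auto
    have "vsc (of_real (t + u)) e - lap_form k = (vsc (of_real t) e - (\<Sum>b<m k. sqm (down_row k b) (down_row k b)))
        + (vsc (of_real u) e - (\<Sum>b<m (Suc (Suc k)). sqm (up_row k b) (up_row k b)))"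
      unfolding lap_form_def of_real_add vsc.scale_left_distrib by (simp add: algebra_simps)
    then show ?thesis using cone_add[OF t(2) u(2)] t(1) u(1) by (intro exI[of _ "t + u"]) simp
  qed
  obtain W \<Phi> where rf: "row_functional m D \<eta> ?M e W \<Phi>" and \<Phi>: "\<Phi> e = 1" "\<Phi> (lap_form k) = 0"
    using functional_exists[OF e q qe neg w] by blast
  interpret R: row_functional m D \<eta> ?M e W \<Phi> by (rule rf)
  \<comment> \<open>\<open>lrow a\<close> is not among the generators; its vector is d_1^* applied
    to the generating cocycle in slot \<open>a\<close>.\<close>
  define x where "x a = (\<Sum>j<m 1. R.F.R.act (star (dd j)) (R.K j a))" for a
  have x: "R.represents (x a) (lrow a)" if "a < ?M" for a
    unfolding lrow_sum x_def using that by (intro R.represents_sum R.represents_act R.represents_K) auto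
  have "(\<Sum>b<m k. Re (\<Phi> (sqm (down_row k b) (down_row k b)))) + (\<Sum>b<m (Suc (Suc k)). Re (\<Phi> (sqm (up_row k b) (up_row k b)))) = Re (\<Phi> (lap_form k))"
    unfolding lap_form_def
    using R.\<Phi>_sum[of "{..<m k}" "\<lambda>b. sqm (down_row k b) (down_row k b)"]
      R.\<Phi>_sum[of "{..<m (Suc (Suc k))}" "\<lambda>b. sqm (up_row k b) (up_row k b)"] R.W_sqm[OF ud(1) ud(1)] R.W_sqm[OF ud(2) ud(2)]
    by (simp add: R.\<Phi>_add)
  moreover have nn: "0 \<le> Re (\<Phi> (sqm (down_row k b) (down_row k b)))" "0 \<le> Re (\<Phi> (sqm (up_row k b) (up_row k b)))" for b
    using R.\<Phi>_pos[OF ud(1)] R.\<Phi>_pos[OF ud(2)] by auto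
  ultimately have s0: "(\<Sum>b<m k. Re (\<Phi> (sqm (down_row k b) (down_row k b)))) = 0"
    and s1: "(\<Sum>b<m (Suc (Suc k)). Re (\<Phi> (sqm (up_row k b) (up_row k b)))) = 0"
    using \<Phi>(2) sum_nonneg[of "{..<m k}" "\<lambda>b. Re (\<Phi> (sqm (down_row k b) (down_row k b)))"]
      sum_nonneg[of "{..<m (Suc (Suc k))}" "\<lambda>b. Re (\<Phi> (sqm (up_row k b) (up_row k b)))"] by simp_all
  have re0: "Re (\<Phi> (sqm (down_row k b) (down_row k b))) = 0" if "b < m k" for b
    using s0 nn that by (simp add: sum_nonneg_eq_0_iff)
  have re1: "Re (\<Phi> (sqm (up_row k b) (up_row k b))) = 0" if "b < m (Suc (Suc k))" for b
    using s1 nn that by (simp add: sum_nonneg_eq_0_iff)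
  have im: "\<Phi> (sqm r r) = 0" if "r \<in> dominated ?M e" "Re (\<Phi> (sqm r r)) = 0" for r
    using R.\<Phi>_herm[OF that(1) that(1)] that(2) by (simp add: complex_eq_iff)
  have z: "\<Phi> (sqm (lrow a) (lrow a)) = 0" if a: "a < ?M" for a
  proof (rule R.no_harmonic[OF univ T k x _ _ a])
    fix b assume b: "b < m (Suc (Suc k))"
    have "R.represents (\<Sum>a<?M. R.F.R.act (cD D (Suc (Suc k)) $$ (b, a)) (x a)) (up_row k b)"
      unfolding up_row_def by (intro R.represents_sum R.represents_act x) auto
    then show "(\<Sum>a<?M. R.F.R.act (cD D (Suc (Suc k)) $$ (b, a)) (x a)) = 0"
      by (rule R.represents_null) (rule im[OF ud(1) re1[OF b]])
  next
    fix b assume b: "b < m k"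
    have "R.represents (\<Sum>a<?M. R.F.R.act (mat_star (cD D (Suc k)) $$ (b, a)) (x a)) (down_row k b)"
      unfolding down_row_def by (intro R.represents_sum R.represents_act x) auto
    then show "(\<Sum>a<?M. R.F.R.act (mat_star (cD D (Suc k)) $$ (b, a)) (x a)) = 0"
      by (rule R.represents_null) (rule im[OF ud(2) re0[OF b]])
  qed
  have "\<Phi> e = (\<Sum>a<?M. \<Phi> (sqm (lrow a) (lrow a)))"
    unfolding e_def using R.\<Phi>_sum[of "{..<?M}" "\<lambda>a. sqm (lrow a) (lrow a)"] R.W_sqm l by simp
  then show False using z \<Phi>(1) by simp
qed

section \<open>Back to matrix identities\<close>

lemma sos_gapI:
  assumes eps: "0 < \<epsilon>" and x: "x \<in> cone (m k)"
    and eq: "\<And>a b. a < m k \<Longrightarrow> b < m k \<Longrightarrow>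
      x a b = lap0 * laplace (cD D) k $$ (a, b) * lap0 - (if a = b then psc (of_real \<epsilon>) (lap0 * lap0) else 0)"
  shows "sos_gap k"
proof -
  obtain xs where xs: "set xs \<subseteq> carrier_mat (m k) (m k)" "sum_of_squares (m k) xs = mat (m k) (m k) (\<lambda>(a, b). x a b)"
    using cone_sum_of_squares[OF x] by blast
  let ?A = "laplace (cD D) k - scalar_mat (m k) (Poly_Mapping.single 0 (of_real \<epsilon>))"
  have A: "?A \<in> carrier_mat (m k) (m k)" by (rule minus_carrier_mat) simp
  have "scalar_mat (m k) lap0 * ?A * scalar_mat (m k) lap0 = sum_of_squares (m k) xs"
    unfolding xs(2)
  proof (rule eq_matI)
    fix a b assume "a < dim_row (mat (m k) (m k) (\<lambda>(a, b). x a b))" "b < dim_col (mat (m k) (m k) (\<lambda>(a, b). x a b))"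
    then have ab: "a < m k" "b < m k" by auto
    have s: "scalar_mat (m k) c $$ (a, b) = (if a = b then c else 0)" for c :: "'g \<Rightarrow>\<^sub>0 complex"
      using ab by (simp add: scalar_mat_def)
    have "?A $$ (a, b) = laplace (cD D) k $$ (a, b) - scalar_mat (m k) (cst (of_real \<epsilon>)) $$ (a, b)"
      by (rule index_minus_mat(1)) (use ab in \<open>simp_all add: scalar_mat_def\<close>)
    then have "(scalar_mat (m k) lap0 * ?A * scalar_mat (m k) lap0) $$ (a, b) =
        lap0 * (laplace (cD D) k $$ (a, b) - (if a = b then cst (of_real \<epsilon>) else 0)) * lap0"
      unfolding sandwich_index[OF A ab] s by simp
    also have "\<dots> = x a b"
      unfolding eq[OF ab] by (simp add: right_diff_distrib left_diff_distrib mult_cst psc_mult_left del: laplace.simps)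
    finally show "(scalar_mat (m k) lap0 * ?A * scalar_mat (m k) lap0) $$ (a, b) = mat (m k) (m k) (\<lambda>(a, b). x a b) $$ (a, b)"
      using ab by (simp del: laplace.simps index_mult_mat)
  qed (auto simp: scalar_mat_def)
  then show ?thesis unfolding sos_gap_def using eps xs(1) by blast
qed

theorem property_T_sos_gap_0:
  assumes univ: "\<exists>f :: real \<Rightarrow> 'v. inj f" and T: "property_T TYPE('v) TYPE('g) n" and n: "1 \<le> n"
  shows "sos_gap 0"
proof -
  obtain \<epsilon> where eps: "0 < \<epsilon>"
    and g0: "sqm (lrow 0) (lrow 0) - vsc (of_real \<epsilon>) (\<Sum>j<m 1. sqm (wrow j 0) (wrow j 0)) \<in> cone 1"
    using gap_degree_0[OF univ T n] by auto
  let ?c = "complex_of_real \<epsilon>"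
  \<comment> \<open>With c for the constant, (Delta_0 - c) Delta_0 (Delta_0 - c) + c (Delta_0^2 - c
    Delta_0) = Delta_0^3 - c Delta_0^2. The first term is the sum of the squares of the
    \<open>z j\<close>, the second is c times the inequality already known, so the same constant
    works.\<close>
  define z where "z j = delta_row 0 (dd j * (lap0 - cst ?c))" for j
  define x where "x = (\<Sum>j<m 1. sqm (z j) (z j)) + vsc ?c (sqm (lrow 0) (lrow 0) - vsc ?c (\<Sum>j<m 1. sqm (wrow j 0) (wrow j 0)))"
  have x: "x \<in> cone (m 0)"
    unfolding x_def m0 by (intro cone_add cone_sum cone_sqm cone_scale[OF g0]) (use eps in \<open>auto simp: z_def\<close>)
  have sum_app: "sum f I a b = (\<Sum>i\<in>I. f i a b)" for f :: "nat \<Rightarrow> nat \<Rightarrow> nat \<Rightarrow> 'g \<Rightarrow>\<^sub>0 complex" and I a b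
    by (induction I rule: infinite_finite_induct) (auto simp: fun_app)
  have l: "laplace (cD D) 0 $$ (0, 0) = lap0" by (simp add: lap0_def)
  have sc: "star (cst ?c) = cst ?c" by simp
  have "(\<Sum>j<m 1. star (dd j * (lap0 - cst ?c)) * (dd j * (lap0 - cst ?c))) = (lap0 - cst ?c) * lap0 * (lap0 - cst ?c)"
  proof -
    have "(\<Sum>j<m 1. star (dd j * (lap0 - cst ?c)) * (dd j * (lap0 - cst ?c)))
        = (\<Sum>j<m 1. (lap0 - cst ?c) * (star (dd j) * dd j) * (lap0 - cst ?c))"
      by (intro sum.cong refl) (simp only: star_mult star_diff star_lap0 sc mult.assoc)
    also have "\<dots> = (lap0 - cst ?c) * (\<Sum>j<m 1. star (dd j) * dd j) * (lap0 - cst ?c)"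
      by (simp only: sum_distrib_left sum_distrib_right)
    finally show ?thesis unfolding lap0_sum[symmetric] .
  qed
  moreover have "(\<Sum>i<m (Suc 0). star (dd i) * dd i) = lap0" by (simp add: lap0_sum)
  ultimately have "x 0 0 = (lap0 - cst ?c) * lap0 * (lap0 - cst ?c) + psc ?c (lap0 * lap0 - psc ?c lap0)"
    unfolding x_def by (simp add: fun_app sum_app sqm_def z_def vsc_def lrow_def wrow_def delta_row_def star_lap0)
  also have "\<dots> = lap0 * lap0 * lap0 - psc ?c (lap0 * lap0)"
    by (simp add: left_diff_distrib right_diff_distrib cst_mult mult_cst psc_mult_left psc.scale_right_diff_distrib)
  finally have x00: "x 0 0 = lap0 * lap0 * lap0 - psc ?c (lap0 * lap0)" .
  show ?thesis
    by (rule sos_gapI[OF eps x]) (use x00 l m0 in \<open>simp del: laplace.simps\<close>)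
qed

theorem property_T_sos_gap_Suc:
  assumes univ: "\<exists>f :: real \<Rightarrow> 'v. inj f" and T: "property_T TYPE('v) TYPE('g) n" and k: "Suc k \<le> n"
  shows "sos_gap (Suc k)"
proof -
  obtain \<epsilon> where eps: "0 < \<epsilon>"
    and g: "lap_form k - vsc (of_real \<epsilon>) (\<Sum>a<m (Suc k). sqm (lrow a) (lrow a)) \<in> cone (m (Suc k))"
    using gap_degree_Suc[OF univ T k] by auto
  have sum_app: "sum f I a b = (\<Sum>i\<in>I. f i a b)" for f :: "nat \<Rightarrow> nat \<Rightarrow> nat \<Rightarrow> 'g \<Rightarrow>\<^sub>0 complex" and I a b
    by (induction I rule: infinite_finite_induct) (auto simp: fun_app)
  have sum_app1: "sum f I a = (\<Sum>i\<in>I. f i a)" for f :: "nat \<Rightarrow> nat \<Rightarrow> 'g \<Rightarrow>\<^sub>0 complex" and I a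
    by (induction I rule: infinite_finite_induct) (auto simp: fun_app)
  have row: "(\<Sum>a<m (Suc k). rmul (p a) (lrow a)) c = p c * lap0" if "c < m (Suc k)" for p c
  proof -
    have "(\<Sum>a<m (Suc k). rmul (p a) (lrow a)) c = (\<Sum>a<m (Suc k). if a = c then p c * lap0 else 0)"
      unfolding sum_app1 by (intro sum.cong refl) (auto simp: rmul_def lrow_def delta_row_def)
    then show ?thesis using that by simp
  qed
  note C = cD_carrier[of k] and C' = cD_carrier[of "Suc k"]
  note S = mat_star_carrier[OF C] and S' = mat_star_carrier[OF C']
  show ?thesis
  proof (rule sos_gapI[OF eps g])
    fix a b assume ab: "a < m (Suc k)" "b < m (Suc k)"
    have "(\<Sum>c<m (Suc k). sqm (lrow c) (lrow c) a b) = (\<Sum>c<m (Suc k). if c = a then (if a = b then lap0 * lap0 else 0) else 0)"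
      by (intro sum.cong refl) (auto simp: sqm_def lrow_def delta_row_def star_lap0)
    then have 1: "(\<Sum>c<m (Suc k). sqm (lrow c) (lrow c) a b) = (if a = b then lap0 * lap0 else 0)" using ab by simp
    have 2: "(\<Sum>c<m (Suc (Suc k)). sqm (up_row k c) (up_row k c) a b)
        = lap0 * (mat_star (cD D (Suc (Suc k))) * cD D (Suc (Suc k))) $$ (a, b) * lap0"
      unfolding mat_mult_index[OF S' C' ab] sqm_def up_row_def row[OF ab(1)] row[OF ab(2)] sum_distrib_left sum_distrib_right
      using ab by (intro sum.cong refl) (simp add: mat_star_index[OF C'] star_mult star_lap0 mult.assoc)
    have 3: "(\<Sum>c<m k. sqm (down_row k c) (down_row k c) a b)
        = lap0 * (cD D (Suc k) * mat_star (cD D (Suc k))) $$ (a, b) * lap0"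
      unfolding mat_mult_index[OF C S ab] sqm_def down_row_def row[OF ab(1)] row[OF ab(2)] sum_distrib_left sum_distrib_right
      using ab by (intro sum.cong refl) (simp add: mat_star_index[OF C] star_mult star_lap0 mult.assoc)
    have l: "laplace (cD D) (Suc k) $$ (a, b) = (cD D (Suc k) * mat_star (cD D (Suc k))) $$ (a, b)
        + (mat_star (cD D (Suc (Suc k))) * cD D (Suc (Suc k))) $$ (a, b)"
      unfolding laplace.simps
      by (rule index_add_mat(1)) (use ab mult_carrier_mat[OF S' C'] D_carrier[of "Suc k"] in \<open>auto simp: mat_star_def\<close>)
    show "(lap_form k - vsc (of_real \<epsilon>) (\<Sum>a<m (Suc k). sqm (lrow a) (lrow a))) a b =
      lap0 * laplace (cD D) (Suc k) $$ (a, b) * lap0 - (if a = b then psc (of_real \<epsilon>) (lap0 * lap0) else 0)"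
      unfolding lap_form_def fun_app vsc_def sum_app 1 2 3 l
      by (simp add: distrib_left distrib_right del: index_mult_mat laplace.simps)
  qed
qed

end

(* 'v is an arbitrary universe of Hilbert space elements; quantifying over all types 'v covers all
   unitary representations. Every nonzero complex Hilbert space has at least continuum many elements,
   so a smaller 'v would only contain the zero representation. *)
theorem theorem15:
  fixes m :: "nat \<Rightarrow> nat"
    and D :: "nat \<Rightarrow> ('g::{group_add,countable} \<Rightarrow>\<^sub>0 rat) mat"
    and \<eta> :: "('g \<Rightarrow>\<^sub>0 rat) vec \<Rightarrow> rat"
    and \<Delta> :: "nat \<Rightarrow> ('g \<Rightarrow>\<^sub>0 complex) mat"
    and \<Delta>\<^sub>0 :: "'g \<Rightarrow>\<^sub>0 complex"
    and n :: nat
  assumes universe: "\<exists>f :: real \<Rightarrow> 'v. inj f"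
    and FP: "FP_infinity_rat TYPE('g)"
    and resolution: "based_free_resolution m D \<eta>"
    and rank0: "m 0 = 1"
    and n: "n \<ge> 1"
  defines "\<Delta> \<equiv> laplace (\<lambda>k. map_mat complexify (D k))"
    and "\<Delta>\<^sub>0 \<equiv> \<Delta> 0 $$ (0, 0)"
  shows "property_T TYPE('v) TYPE('g) n \<longleftrightarrow>
    (\<forall>k\<le>n. \<exists>\<epsilon>::real. \<epsilon> > 0 \<and>
      (\<exists>xs. set xs \<subseteq> carrier_mat (m k) (m k) \<and>
        scalar_mat (m k) \<Delta>\<^sub>0 * (\<Delta> k - scalar_mat (m k) (Poly_Mapping.single 0 (of_real \<epsilon>)))
            * scalar_mat (m k) \<Delta>\<^sub>0
          = sum_of_squares (m k) xs))"
proof -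
  interpret countable_resolution m D \<eta> by unfold_locales (rule resolution, rule rank0)
  have "property_T TYPE('v) TYPE('g) n \<longleftrightarrow> (\<forall>k\<le>n. sos_gap k)"
  proof
    assume T: "property_T TYPE('v) TYPE('g) n"
    show "\<forall>k\<le>n. sos_gap k"
    proof (intro allI impI)
      fix k assume "k \<le> n"
      then show "sos_gap k"
        using property_T_sos_gap_0[OF universe T n] property_T_sos_gap_Suc[OF universe T] by (cases k) auto
    qed
  next
    assume gap: "\<forall>k\<le>n. sos_gap k"
    show "property_T TYPE('v) TYPE('g) n"
      unfolding property_T_def
    proof (intro allI impI, elim conjE)
      fix j and H :: "'v inner_product_space" and \<pi> :: "'g \<Rightarrow> 'v \<Rightarrow> 'v"
      assume j: "1 \<le> j" "j \<le> n" and H: "unitary_representation H \<pi>" and free: "no_invariant_vectors H \<pi>"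
      obtain S :: "('v \<Rightarrow> complex) set" and ip rep \<theta> where u: "unirep fsc S ip rep" and bij: "bij_betw \<theta> S (carrier H)"
        and add: "\<forall>x\<in>S. \<forall>y\<in>S. \<theta> (x + y) = \<theta> x \<oplus>\<^bsub>H\<^esub> \<theta> y" and scale: "\<forall>a. \<forall>x\<in>S. \<theta> (fsc a x) = a \<odot>\<^bsub>H\<^esub> \<theta> x"
        and rep: "\<forall>g. \<forall>x\<in>S. \<theta> (rep g x) = \<pi> g (\<theta> x)"
        using unitary_representation_as_functions[OF H] by (elim exE conjE)
      interpret R: unirep fsc S ip rep by (rule u)
      interpret H: unitary_representation H \<pi> by (rule H)
      have inj: "inj_on \<theta> S" using bij by (simp add: bij_betw_def)
      have th0: "\<theta> 0 = \<zero>\<^bsub>H\<^esub>"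
      proof -
        have "\<theta> (0 + 0) = \<theta> 0 \<oplus>\<^bsub>H\<^esub> \<theta> 0" using add R.S_zero by blast
        then have "\<theta> 0 \<oplus>\<^bsub>H\<^esub> \<theta> 0 = \<theta> 0" by simp
        moreover have "\<theta> 0 \<in> carrier H" using bij by (auto simp: bij_betw_def)
        ultimately show ?thesis using H.add.l_cancel_one by blast
      qed
      have "R.invariant_free"
        unfolding R.invariant_free_def
      proof (intro ballI impI)
        fix x assume x: "x \<in> S" "\<forall>g. rep g x = x"
        then have "\<pi> g (\<theta> x) = \<theta> x" for g using rep by metis
        moreover have "\<theta> x \<in> carrier H" using bij x by (auto simp: bij_betw_def)
        ultimately have "\<theta> x = \<theta> 0" using free unfolding no_invariant_vectors_def th0 by blast
        then show "x = 0" using inj_onD[OF inj] x(1) R.S_zero by blast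
      qed
      moreover obtain k where k: "j = Suc k" using j by (cases j) auto
      ultimately have "std_vanishes fsc S rep k"
        using sos_gap_vanishing[OF u] gap j by auto
      then show "cohomology_vanishes H \<pi> j"
        unfolding k using R.cohomology_iff[OF H.module_axioms bij, of \<pi> k] add scale rep by blast
    qed
  qed
  then show ?thesis unfolding sos_gap_def lap0_def \<Delta>\<^sub>0_def \<Delta>_def .
qed

end
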